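(* There is a constant $K\ge 1$ such that for every odd $d\in\mathbb{N}$ there exists a quasiregular map $P:A(1,e^{1/d})\to\overline{B(0,e^3)}\subset\mathbb{R}^3$ that equals $p_d$ on $\{|x|=1\}$, equals $p_{3d}$ on $\{|x|=e^{1/d}\}$, and has maximal dilatation $K(P)\le K$; that is, the dilatation of $P$ is bounded independently of $d$.
   Context: $B(y,r)$ is the open ball of centre $y$ and radius $r$, and $A(r,s)=\{x\in\mathbb{R}^3: r\le|x|\le s\}$. A quasiregular map on a closed ring means a continuous map of the closed ring that is quasiregular on its interior; $K(P)=\max\{K_I(P),K_O(P)\}$ is the maximum of the inner and outer dilatations. Zorich and power maps. For a plane $H\subset\mathbb{R}^3$, $R_H$ denotes reflection in $H$. Fix a bi-Lipschitz map $h$ from $[-1,1]^2$ onto the upper hemisphere $\{y\in\mathbb{R}^3:|y|=1,\ y_3\ge0\}$ with $h(0,0)=(0,0,1)$, and put $\mathcal{Z}(x_1,x_2,x_3)=e^{x_3}h(x_1,x_2)$ on $[-1,1]^2\times\mathbb{R}$. Extend to a Zorich map $\mathcal{Z}:\mathbb{R}^3\to\mathbb{R}^3\setminus\{0\}$ by repeated reflection: $\mathcal{Z}(R_{\{x_i=n\}}(x))=R_{\{x_3=0\}}(\mathcal{Z}(x))$ for $i\in\{1,2\}$ and $n$ an odd integer ($h$ is oriented so that $\mathcal{Z}$ is orientation-preserving; then $\mathcal{Z}$ is quasiregular). The map $\mathcal{Z}$ is fixed throughout. For odd $d\in\mathbb{N}$, $p_d:\mathbb{R}^3\to\mathbb{R}^3$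 is the unique quasiregular map satisfying $p_d(\mathcal{Z}(x))=\mathcal{Z}(dx)$ for all $x\in\mathbb{R}^3$ (so $p_d(0)=0$ and $|p_d(x)|=|x|^d$). *)

theory Defs
  imports "HOL-Analysis.Analysis"
begin

section \<open>Local Sobolev spaces\<close>

definition partial_deriv :: "'n::finite \<Rightarrow> (real^'n \<Rightarrow> real) \<Rightarrow> real^'n \<Rightarrow> real" where
  "partial_deriv j \<phi> x = frechet_derivative \<phi> (at x) (axis j 1)"

primrec C_k :: "nat \<Rightarrow> (real^'n::finite \<Rightarrow> real) \<Rightarrow> bool" where
  "C_k 0 \<phi> \<longleftrightarrow> continuous_on UNIV \<phi>"
| "C_k (Suc k) \<phi> \<longleftrightarrow> \<phi> differentiable_on UNIV \<and> (\<forall>j. C_k k (partial_deriv j \<phi>))"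

definition test_function :: "(real^'n::finite) set \<Rightarrow> (real^'n \<Rightarrow> real) \<Rightarrow> bool" where
  "test_function U \<phi> \<longleftrightarrow> (\<forall>k. C_k k \<phi>) \<and>
     compact (closure {x. \<phi> x \<noteq> 0}) \<and> closure {x. \<phi> x \<noteq> 0} \<subseteq> U"

definition locally_Lp :: "(real^'n::finite) set \<Rightarrow> nat \<Rightarrow> (real^'n \<Rightarrow> 'b::euclidean_space) \<Rightarrow> bool" where
  "locally_Lp U p g \<longleftrightarrow> g \<in> borel_measurable (lebesgue_on U) \<and>
     (\<forall>C. compact C \<longrightarrow> C \<subseteq> U \<longrightarrow> integrable (lebesgue_on C) (\<lambda>x. norm (g x) ^ p))"

text \<open>The entry \<open>D x $ i $ j\<close> is the weak partial derivative of the \<open>i\<close>-th component in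
  the \<open>j\<close>-th coordinate direction, so \<open>D x *v v\<close> is the derivative applied to \<open>v\<close>.\<close>

definition weak_derivative ::
  "(real^'n::finite) set \<Rightarrow> (real^'n \<Rightarrow> real^'m::finite) \<Rightarrow> (real^'n \<Rightarrow> real^'n^'m) \<Rightarrow> bool" where
  "weak_derivative U f D \<longleftrightarrow> (\<forall>i j \<phi>. test_function U \<phi> \<longrightarrow>
     (\<integral>x. f x $ i * partial_deriv j \<phi> x \<partial>lebesgue_on U) =
     - (\<integral>x. D x $ i $ j * \<phi> x \<partial>lebesgue_on U))"

text \<open>\<open>f\<close> lies in the local Sobolev space of order one and exponent \<open>p\<close> on \<open>U\<close>, and \<open>D\<close> is a
  representative of its weak derivative (which is unique up to null sets).\<close>

definition has_sobolev_derivative_loc ::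
  "(real^'n::finite) set \<Rightarrow> nat \<Rightarrow> (real^'n \<Rightarrow> real^'m::finite) \<Rightarrow> (real^'n \<Rightarrow> real^'n^'m) \<Rightarrow> bool" where
  "has_sobolev_derivative_loc U p f D \<longleftrightarrow>
     locally_Lp U p f \<and> locally_Lp U p D \<and> weak_derivative U f D"


section \<open>Quasiregular maps and their dilatations\<close>

definition outer_bound :: "(real^'n::finite) set \<Rightarrow> (real^'n \<Rightarrow> real^'n) \<Rightarrow> real \<Rightarrow> bool" where
  "outer_bound U f K \<longleftrightarrow> (\<exists>D. has_sobolev_derivative_loc U CARD('n) f D \<and>
     (AE x in lebesgue_on U. onorm (\<lambda>v. D x *v v) ^ CARD('n) \<le> K * det (D x)))"

definition inner_bound :: "(real^'n::finite) set \<Rightarrow> (real^'n \<Rightarrow> real^'n) \<Rightarrow> real \<Rightarrow> bool" where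
  "inner_bound U f K \<longleftrightarrow> (\<exists>D. has_sobolev_derivative_loc U CARD('n) f D \<and>
     (AE x in lebesgue_on U. det (D x) \<le> K * (INF v\<in>sphere 0 1. norm (D x *v v)) ^ CARD('n)))"

definition quasiregular_on :: "(real^'n::finite) set \<Rightarrow> (real^'n \<Rightarrow> real^'n) \<Rightarrow> bool" where
  "quasiregular_on U f \<longleftrightarrow> open U \<and> continuous_on U f \<and> (\<exists>K\<ge>1. outer_bound U f K)"

text \<open>For a quasiregular map both sets below are nonempty and the infima are attained.\<close>

definition outer_dilatation :: "(real^'n::finite) set \<Rightarrow> (real^'n \<Rightarrow> real^'n) \<Rightarrow> real" where
  "outer_dilatation U f = Inf {K. 1 \<le> K \<and> outer_bound U f K}"

definition inner_dilatation :: "(real^'n::finite) set \<Rightarrow> (real^'n \<Rightarrow> real^'n) \<Rightarrow> real" where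
  "inner_dilatation U f = Inf {K. 1 \<le> K \<and> inner_bound U f K}"

definition max_dilatation :: "(real^'n::finite) set \<Rightarrow> (real^'n \<Rightarrow> real^'n) \<Rightarrow> real" where
  "max_dilatation U f = max (inner_dilatation U f) (outer_dilatation U f)"

definition closed_ring :: "real \<Rightarrow> real \<Rightarrow> (real^3) set" where
  "closed_ring r s = {x. r \<le> norm x \<and> norm x \<le> s}"

definition quasiregular_on_ring :: "real \<Rightarrow> real \<Rightarrow> (real^3 \<Rightarrow> real^3) \<Rightarrow> bool" where
  "quasiregular_on_ring r s P \<longleftrightarrow>
     continuous_on (closed_ring r s) P \<and> quasiregular_on (interior (closed_ring r s)) P"


section \<open>Zorich maps and power maps\<close>

definition bilipschitz_on :: "'a::metric_space set \<Rightarrow> ('a \<Rightarrow> 'b::metric_space) \<Rightarrow> bool" where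
  "bilipschitz_on S f \<longleftrightarrow> (\<exists>L\<ge>1. \<forall>x\<in>S. \<forall>y\<in>S.
     dist x y / L \<le> dist (f x) (f y) \<and> dist (f x) (f y) \<le> L * dist x y)"

definition square :: "(real^2) set" where
  "square = {a. \<bar>a $ 1\<bar> \<le> 1 \<and> \<bar>a $ 2\<bar> \<le> 1}"

definition upper_hemisphere :: "(real^3) set" where
  "upper_hemisphere = {y. norm y = 1 \<and> 0 \<le> y $ 3}"

definition reflect_plane :: "3 \<Rightarrow> real \<Rightarrow> real^3 \<Rightarrow> real^3" where
  "reflect_plane i c x = (\<chi> j. if j = i then 2 * c - x $ i else x $ j)"

text \<open>The two conditions determine \<open>Z\<close> from \<open>h\<close>, because the square prism over \<open>square\<close> is a
  fundamental domain for the group generated by the reflections in the planes \<open>x $ i = n\<close>.\<close>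

definition zorich_map :: "(real^2 \<Rightarrow> real^3) \<Rightarrow> (real^3 \<Rightarrow> real^3) \<Rightarrow> bool" where
  "zorich_map h Z \<longleftrightarrow>
     (\<forall>x. vector [x $ 1, x $ 2] \<in> square \<longrightarrow> Z x = exp (x $ 3) *\<^sub>R h (vector [x $ 1, x $ 2])) \<and>
     (\<forall>i\<in>{1, 2}. \<forall>n::int. odd n \<longrightarrow>
        (\<forall>x. Z (reflect_plane i (of_int n) x) = reflect_plane 3 0 (Z x)))"

text \<open>Analytic form of orientation for locally Lipschitz maps. Such maps are differentiable
  almost everywhere by Rademacher's theorem, so only the sign of the Jacobian is a condition.\<close>

definition orientation_preserving :: "(real^'n::finite \<Rightarrow> real^'n) \<Rightarrow> bool" where
  "orientation_preserving f \<longleftrightarrow> (AE x in lebesgue.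
     f differentiable (at x) \<and> 0 < det (matrix (frechet_derivative f (at x))))"

definition power_map :: "(real^3 \<Rightarrow> real^3) \<Rightarrow> nat \<Rightarrow> real^3 \<Rightarrow> real^3" where
  "power_map Z d = (THE p. quasiregular_on UNIV p \<and> (\<forall>x. p (Z x) = Z (real d *\<^sub>R x)))"

end

(*
Let Phi be an interpolating map of the fixed ring A(1,e) with Phi(x) = x for |x| = 1 and Phi = p_3 for
|x| = e. Since p_d maps A(1,e^(1/d)) to A(1,e) and p_(3d) = p_3 o p_d, the map P = Phi o p_d has the
required boundary values, and its dilatation is at most that of Phi times that of p_d. The latter is
at most the square of the dilatation of Z, because p_d o Z is Z after a similarity.

Phi must have zeros, since its degree rises from 1 to 9. It is written as Phi(Z x) = Psi(Q x) on the
prism 0 <= x_3 <= 1. Here Psi is the radial extension of h from the bipyramid max |y_1| |y_2| + |y_3| = 1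
to the sphere, so it is bi-Lipschitz, and Q is an explicit piecewise smooth map of the prism with
bounded derivative and Jacobian bounded below. Q starts at the upper half of the bipyramid
and ends at the 3 x 3 folded copies of it, scaled by e^3; it maps the lateral faces to the plane
y_3 = 0, so Phi extends by reflection.

All maps involved are locally Lipschitz, so almost everywhere differentiability (which for Z is part
of being orientation-preserving) identifies the weak derivative with the pointwise one. Almost
everywhere differentiability survives composition because a map with invertible derivatives pulls
null sets back to null sets.
*)
theory Submission
  imports Defs
begin

text \<open>The delicate point is orientation. On a slice of the prism the data in each direction
  are a single tent at the bottom and three tents of alternating sign at the top, and the new tents
  must appear without a change of sign of the Jacobian. They are made to grow out of the walls: for
  a wall at 1 the value of \<open>lateral\<close> is 1 - (radius + 1) * s, which runs from 1 to
  -radius. The zeros of the model lie on the walls, at the height s = 1 / (radius + 1) where this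
  value vanishes. Two such plane solutions are coupled by \<open>signed_min\<close>, whose sign rule
  is the one by which reflections of \<open>Z\<close> in the two directions compose. Distortion is
  measured by the ratio of greatest to least stretching, since this ratio is easy to follow through
  compositions, inverses and reflections; the dilatations are then reached by a cube. The number
  \<open>radius\<close> is exp 3 because p_3 takes |x| = e to |x| = e^3. Every distortion constant
  is an expression in \<open>L\<close> and \<open>radius\<close> alone. Only Lipschitz constants
  depend on \<open>d\<close>, and they serve for regularity, never for distortion.\<close>

section \<open>Distortion of a map at a point\<close>

text \<open>The scale \<open>a\<close> is left free, so that \<open>K\<close> measures only the
  ratio of greatest to least stretching. Such bounds multiply under composition and survive
  inversion, and \<open>K ^ CARD('n)\<close> bounds both dilatations.\<close>

definition qc_at :: "real \<Rightarrow> (real^'n \<Rightarrow> real^'n) \<Rightarrow> real^'n::finite \<Rightarrow> bool" where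
  "qc_at K f x \<longleftrightarrow> (\<exists>A a. (f has_derivative (\<lambda>v. A *v v)) (at x) \<and> 0 < a \<and> 0 < det A \<and>
     (\<forall>v. a * norm v \<le> norm (A *v v) \<and> norm (A *v v) \<le> K * a * norm v))"

text \<open>The unit ball is mapped into the ball of radius \<open>b\<close>; comparing volumes
  gives the bound.\<close>

lemma det_le_power:
  fixes A :: "real^('n::{finite,wellorder})^('n::_)"
  assumes b: "0 \<le> b" "\<And>v. norm (A *v v) \<le> b * norm v"
  shows "\<bar>det A\<bar> \<le> b ^ CARD('n)"
proof -
  let ?B = "cball (0::real^'n::_) 1"
  have m: "measure lebesgue ((\<lambda>v. A *v v) ` ?B) = \<bar>det A\<bar> * measure lebesgue ?B"
    using measure_linear_image[of "\<lambda>v. A *v v" ?B]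
    by (simp add: matrix_vector_mul_linear matrix_of_matrix_vector_mul)
  have sub: "(\<lambda>v. A *v v) ` ?B \<subseteq> cball 0 b"
  proof clarsimp
    fix v :: "real^'n::_" assume "norm v \<le> 1"
    then have "b * norm v \<le> b" using b(1) by (simp add: mult_left_le)
    then show "norm (A *v v) \<le> b" using b(2)[of v] by linarith
  qed
  have "measure lebesgue ((\<lambda>v. A *v v) ` ?B) \<le> measure lebesgue (cball (0::real^'n::_) b)"
    by (rule measure_mono_fmeasurable[OF sub])
       (auto intro!: fmeasurableD compact_imp_closed measurable_linear_image simp: matrix_vector_mul_linear)
  also have "measure lebesgue (cball (0::real^'n::_) b) = b ^ CARD('n) * measure lebesgue ?B"
    using content_cball[OF b(1), of "0::real^'n::_"] content_cball[of 1 "0::real^'n::_"] by simp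
  finally have "\<bar>det A\<bar> * measure lebesgue ?B \<le> b ^ CARD('n) * measure lebesgue ?B" using m by simp
  moreover have "measure lebesgue ?B > 0"
    using content_cball_pos[of 1 "0::real^'n::_"] by simp
  ultimately show ?thesis by simp
qed

text \<open>The lower bound makes \<open>A\<close> injective, and its inverse stretches by at most
  \<open>inverse a\<close>; \<open>det_le_power\<close> for the inverse then bounds
  \<open>det A\<close> from below.\<close>

lemma det_ge_power:
  fixes A :: "real^('n::{finite,wellorder})^('n::_)"
  assumes a: "0 < a" "\<And>v. a * norm v \<le> norm (A *v v)"
  shows "a ^ CARD('n) \<le> \<bar>det A\<bar>"
proof -
  have "inj (\<lambda>v. A *v v)"
  proof (rule injI)
    fix x y assume "A *v x = A *v y"
    then have "A *v (x - y) = 0" by (simp add: matrix_vector_mult_diff_distrib)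
    then show "x = y" using a(2)[of "x - y"] a(1) by (simp add: mult_le_0_iff)
  qed
  then obtain B where B: "B ** A = mat 1" using matrix_left_invertible_injective[of A] by auto
  then have AB: "A ** B = mat 1" by (simp add: matrix_left_right_inverse)
  have bd: "norm (B *v v) \<le> inverse a * norm v" for v
    using a(2)[of "B *v v"] a(1) AB by (simp add: matrix_vector_mul_assoc field_simps)
  have "\<bar>det B\<bar> \<le> inverse a ^ CARD('n)" using det_le_power[OF _ bd] a(1) by simp
  moreover have d: "\<bar>det A\<bar> * \<bar>det B\<bar> = 1" using AB by (metis det_mul det_I abs_mult abs_1)
  ultimately have "\<bar>det A\<bar> * inverse a ^ CARD('n) \<ge> 1"
    by (metis abs_ge_zero mult_left_mono)
  then show ?thesis using a(1) by (simp add: field_simps)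
qed

lemma qc_at_compose:
  assumes "qc_at K f x" "qc_at K' g (f x)"
  shows "qc_at (K * K') (\<lambda>x. g (f x)) x"
proof -
  obtain A a where A: "(f has_derivative (\<lambda>v. A *v v)) (at x)" "0 < a" "0 < det A"
    "\<And>v. a * norm v \<le> norm (A *v v)" "\<And>v. norm (A *v v) \<le> K * a * norm v"
    using assms(1) unfolding qc_at_def by blast
  obtain B b where B: "(g has_derivative (\<lambda>v. B *v v)) (at (f x))" "0 < b" "0 < det B"
    "\<And>v. b * norm v \<le> norm (B *v v)" "\<And>v. norm (B *v v) \<le> K' * b * norm v"
    using assms(2) unfolding qc_at_def by blast
  have "((\<lambda>x. g (f x)) has_derivative (\<lambda>v. B *v (A *v v))) (at x)"
    by (rule has_derivative_compose[OF A(1) B(1)])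
  then have D: "((\<lambda>x. g (f x)) has_derivative (\<lambda>v. (B ** A) *v v)) (at x)"
    by (simp add: matrix_vector_mul_assoc)
  \<comment> \<open>Nonnegativity of \<open>K' * b\<close> is not part of \<open>qc_at\<close>;
    testing the upper bound on some unit vector yields it.\<close>
  have "0 \<le> K' * b * norm (axis undefined 1 :: real^'a)"
    using B(5)[of "axis undefined 1"] norm_ge_zero order_trans by blast
  then have K'b: "0 \<le> K' * b" by simp
  have lo: "(a * b) * norm v \<le> norm ((B ** A) *v v)" for v
  proof -
    have "(a * b) * norm v = b * (a * norm v)" by simp
    also have "\<dots> \<le> b * norm (A *v v)" using A(4)[of v] B(2) by simp
    also have "\<dots> \<le> norm ((B ** A) *v v)" using B(4)[of "A *v v"] by (simp add: matrix_vector_mul_assoc)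
    finally show ?thesis .
  qed
  have up: "norm ((B ** A) *v v) \<le> K * K' * (a * b) * norm v" for v
  proof -
    have "norm ((B ** A) *v v) \<le> K' * b * norm (A *v v)"
      using B(5)[of "A *v v"] by (simp add: matrix_vector_mul_assoc)
    also have "\<dots> \<le> K' * b * (K * a * norm v)" using mult_left_mono[OF A(5)[of v] K'b] .
    finally show ?thesis by (simp add: mult_ac)
  qed
  show ?thesis unfolding qc_at_def
    using D lo up A(2,3) B(2,3) by (intro exI[of _ "B ** A"] exI[of _ "a * b"]) (simp add: det_mul)
qed

lemma qc_at_transform:
  assumes "qc_at K f x" "open S" "x \<in> S" "\<And>y. y \<in> S \<Longrightarrow> f y = g y"
  shows "qc_at K g x"
  using assms unfolding qc_at_def by (meson has_derivative_transform_within_open)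

text \<open>Inversion exchanges the two bounds: \<open>inverse (K * a)\<close> is the new scale and
  \<open>K * inverse (K * a) = inverse a\<close> the new upper factor, so \<open>K\<close> is kept.
  Continuity of \<open>g\<close> suffices for its differentiability because the derivative of
  \<open>f\<close> is invertible.\<close>

lemma qc_at_inverse:
  assumes f: "qc_at K f (g y)" and "isCont g y" "open T" "y \<in> T" "\<And>z. z \<in> T \<Longrightarrow> f (g z) = z"
  shows "qc_at K g y"
proof -
  obtain A a where A: "(f has_derivative (\<lambda>v. A *v v)) (at (g y))" "0 < a" "0 < det A"
    "\<And>v. a * norm v \<le> norm (A *v v)" "\<And>v. norm (A *v v) \<le> K * a * norm v"
    using f unfolding qc_at_def by blast
  have "0 \<le> K * a * norm (axis undefined 1 :: real^'a)"
    using A(5)[of "axis undefined 1"] norm_ge_zero order_trans by blast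
  then have "0 \<le> K * a" by simp
  obtain B where B: "B ** A = mat 1" "A ** B = mat 1"
    using A(3) invertible_det_nz[of A] unfolding invertible_def by auto
  have "0 < a * norm (axis undefined 1 :: real^'a)" using A(2) by (simp add: axis_eq_0_iff)
  then have "0 < K * a * norm (axis undefined 1 :: real^'a)"
    using A(4,5)[of "axis undefined 1"] by linarith
  then have Ka: "0 < K * a" by (simp add: zero_less_mult_iff)
  have "(g has_derivative (\<lambda>v. B *v v)) (at y)"
    by (rule has_derivative_inverse_basic[where f = f and f' = "\<lambda>v. A *v v" and T = T])
       (use assms A(1) B in \<open>auto simp: matrix_vector_mul_bounded_linear matrix_vector_mul_assoc fun_eq_iff\<close>)
  moreover have "det A * det B = 1" using B(2) by (metis det_mul det_I)
  then have "0 < det B" using A(3) by (metis zero_less_mult_pos zero_less_one)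
  moreover have "inverse (K * a) * norm v \<le> norm (B *v v)" for v
    using A(5)[of "B *v v"] B Ka by (simp add: matrix_vector_mul_assoc field_simps)
  moreover have "norm (B *v v) \<le> K * inverse (K * a) * norm v" for v
  proof -
    have "K \<noteq> 0" using Ka by auto
    then have "K * inverse (K * a) = inverse a" by simp
    moreover have "norm (B *v v) \<le> inverse a * norm v"
      using A(4)[of "B *v v"] A(2) B by (simp add: matrix_vector_mul_assoc field_simps)
    ultimately show ?thesis by metis
  qed
  moreover have "0 < inverse (K * a)" using Ka by (rule positive_imp_inverse_positive)
  ultimately show ?thesis unfolding qc_at_def by blast
qed

text \<open>For \<open>Z\<close> there is no formula for the derivative, only metric estimates
  around a point. Applied to short segments in direction \<open>v\<close>, they pass to the
  derivative. The sign of the determinant cannot be read off from them and is a separate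
  assumption.\<close>

lemma qc_at_of_local_bounds:
  fixes f :: "real^'n \<Rightarrow> real^'n"
  assumes f: "f differentiable (at x)" "0 < det (matrix (frechet_derivative f (at x)))"
    and a: "0 < a" and \<delta>: "0 < \<delta>"
    and bd: "\<And>y. y \<in> ball x \<delta> \<Longrightarrow> a * norm (y - x) \<le> norm (f y - f x) \<and> norm (f y - f x) \<le> K * a * norm (y - x)"
  shows "qc_at K f x"
proof -
  let ?F = "frechet_derivative f (at x)"
  let ?A = "matrix ?F"
  have D: "(f has_derivative ?F) (at x)" using f(1) frechet_derivative_works by blast
  have lin: "linear ?F" using D has_derivative_linear by blast
  have FA: "?F v = ?A *v v" for v using lin by (simp add: matrix_works)
  then have "?F = (\<lambda>v. ?A *v v)" by (rule ext)
  then have DA: "(f has_derivative (\<lambda>v. ?A *v v)) (at x)" using D by metis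
  have main: "a * norm v \<le> norm (?F v) \<and> norm (?F v) \<le> K * a * norm v" if v: "v \<noteq> 0" for v
  proof -
    have "a * norm v \<le> norm (?F v) + e \<and> norm (?F v) \<le> K * a * norm v + e" if e: "0 < e" for e
    proof -
      have "0 < e / norm v" using e v by simp
      then obtain d where d: "0 < d" "\<And>y. norm (y - x) < d \<Longrightarrow> norm (f y - f x - ?F (y - x)) \<le> e / norm v * norm (y - x)"
        using D unfolding has_derivative_at_alt by blast
      \<comment> \<open>At the distance \<open>t * norm v\<close> both the differentiability
        estimate (radius \<open>d\<close>) and the metric bounds (radius \<open>\<delta>\<close>)
        have to apply.\<close>
      define t where "t = min d \<delta> / (2 * norm v)"
      have t: "0 < t" using d(1) \<delta> v by (simp add: t_def)
      have tn: "t * norm v = min d \<delta> / 2" using v by (simp add: t_def)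
      define y where "y = x + t *\<^sub>R v"
      have ny: "norm (y - x) = t * norm v" using t by (simp add: y_def)
      have 1: "norm (f y - f x - ?F (y - x)) \<le> t * e"
      proof -
        have "norm (y - x) < d" unfolding ny tn using d(1) \<delta> by (simp add: min_def)
        from d(2)[OF this] have "norm (f y - f x - ?F (y - x)) \<le> e / norm v * (t * norm v)"
          unfolding ny .
        also have "\<dots> = t * e" using v by simp
        finally show ?thesis .
      qed
      have "y \<in> ball x \<delta>" using ny tn d(1) \<delta> by (simp add: dist_norm norm_minus_commute)
      note 2 = bd[OF this]
      have 3: "norm (?F (y - x)) = t * norm (?F v)"
        using t lin by (simp add: y_def linear_scale)
      have "t * (a * norm v) \<le> t * (norm (?F v) + e)"
        using 1 2 3 ny norm_triangle_ineq2[of "f y - f x" "?F (y - x)"] by (simp add: algebra_simps)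
      moreover have "t * norm (?F v) \<le> t * (K * a * norm v + e)"
        using 1 2 3 ny norm_triangle_ineq2[of "?F (y - x)" "f y - f x"]
        by (simp add: algebra_simps norm_minus_commute)
      ultimately show ?thesis using t by simp
    qed
    then show ?thesis by (meson field_le_epsilon)
  qed
  have "a * norm v \<le> norm (?A *v v) \<and> norm (?A *v v) \<le> K * a * norm v" for v
    using main[of v] FA by (cases "v = 0") auto
  then show ?thesis unfolding qc_at_def
    using DA f(2) a by blast
qed

section \<open>Weak derivatives of Lipschitz maps\<close>

text \<open>Stated along a sequence of steps because it feeds dominated convergence. The steps may
  be negative, which the backward shifts of the weak derivative need.\<close>

lemma has_derivative_difference_quotient:
  fixes f :: "'a::real_normed_vector \<Rightarrow> 'b::real_normed_vector"
  assumes f: "(f has_derivative f') (at x)" and t: "t \<longlonglongrightarrow> 0" "\<And>n. t n \<noteq> 0"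
  shows "(\<lambda>n. (f (x + t n *\<^sub>R v) - f x) /\<^sub>R t n) \<longlonglongrightarrow> f' v"
proof -
  have lin: "linear f'" using f has_derivative_linear by blast
  have "((\<lambda>s. f (x + s *\<^sub>R v)) has_derivative (\<lambda>s. f' (s *\<^sub>R v))) (at 0)"
    by (rule has_derivative_compose[of "\<lambda>s. x + s *\<^sub>R v"])
       (use f in \<open>auto intro!: derivative_eq_intros\<close>)
  then have "(\<lambda>s. norm (f (x + s *\<^sub>R v) - f x - s *\<^sub>R f' v) / norm s) \<midarrow>0\<rightarrow> 0"
    using lin by (simp add: has_derivative_at linear_scale)
  moreover have "norm (f (x + s *\<^sub>R v) - f x - s *\<^sub>R f' v) / norm s
      = norm ((f (x + s *\<^sub>R v) - f x) /\<^sub>R s - f' v)" if "s \<noteq> 0" for s :: real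
  proof -
    have "(f (x + s *\<^sub>R v) - f x) /\<^sub>R s - f' v = (f (x + s *\<^sub>R v) - f x - s *\<^sub>R f' v) /\<^sub>R s"
      using that by (simp add: scaleR_right_diff_distrib)
    then show ?thesis by (simp add: divide_inverse mult.commute)
  qed
  ultimately have "(\<lambda>s. norm ((f (x + s *\<^sub>R v) - f x) /\<^sub>R s - f' v)) \<midarrow>0\<rightarrow> 0"
    by (elim Lim_transform_within[where d = 1]) auto
  then have "(\<lambda>s. (f (x + s *\<^sub>R v) - f x) /\<^sub>R s) \<midarrow>0\<rightarrow> f' v"
    using Lim_null tendsto_norm_zero_iff by blast
  then show ?thesis
    by (rule filterlim_compose) (use t in \<open>auto simp: filterlim_at\<close>)
qed

lemma integral_lborel_translation:
  fixes g :: "'a::euclidean_space \<Rightarrow> real"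
  assumes [measurable]: "g \<in> borel_measurable borel"
  shows "(\<integral>x. g (x + c) \<partial>lborel) = (\<integral>x. g x \<partial>lborel)"
proof -
  have "(\<integral>x. g x \<partial>lborel) = (\<integral>x. g x \<partial>(distr lborel borel ((+) c)))"
    by (simp add: lborel_distr_plus)
  also have "\<dots> = (\<integral>x. g (c + x) \<partial>lborel)" by (subst integral_distr) auto
  finally show ?thesis by (simp add: add.commute)
qed

lemma lborel_integrable_bounded_support:
  fixes g :: "'a::euclidean_space \<Rightarrow> real"
  assumes "g \<in> borel_measurable borel" "compact S" "\<And>x. x \<notin> S \<Longrightarrow> g x = 0" "\<And>x. \<bar>g x\<bar> \<le> B"
  shows "integrable lborel g"
  by (rule integrableI_bounded_set[where A = S and B = B])
     (use assms emeasure_bounded_finite[OF compact_imp_bounded[OF assms(2)]] in \<open>auto simp: borel_compact\<close>)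

context
  fixes \<phi> :: "real^'n::finite \<Rightarrow> real" and U
  assumes \<phi>: "test_function U \<phi>"
begin

lemma test_function_has_derivative: "(\<phi> has_derivative frechet_derivative \<phi> (at x)) (at x)"
proof -
  have "C_k (Suc 0) \<phi>" using \<phi> unfolding test_function_def by blast
  then have "\<phi> differentiable (at x)" by (simp add: differentiable_on_def)
  then show ?thesis using frechet_derivative_works by blast
qed

lemma continuous_on_test_function: "continuous_on UNIV \<phi>"
  using has_derivative_continuous[OF test_function_has_derivative]
  by (simp add: continuous_on_eq_continuous_at)

lemma continuous_on_partial_deriv: "continuous_on UNIV (partial_deriv j \<phi>)"
proof -
  have "C_k (Suc 0) \<phi>" using \<phi> unfolding test_function_def by blast
  then show ?thesis by simp
qed

lemma partial_deriv_eq_0: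
  assumes "x \<notin> closure {x. \<phi> x \<noteq> 0}"
  shows "partial_deriv j \<phi> x = 0"
proof -
  have "((\<lambda>_. 0) has_derivative (\<lambda>_. 0)) (at x)" by simp
  then have "(\<phi> has_derivative (\<lambda>_. 0)) (at x)"
    by (rule has_derivative_transform_within_open[where s = "- closure {x. \<phi> x \<noteq> 0}"])
       (use assms closure_subset[of "{x. \<phi> x \<noteq> 0}"] in \<open>auto simp: open_Compl\<close>)
  then have "frechet_derivative \<phi> (at x) = (\<lambda>_. 0)"
    by (metis frechet_derivative_at)
  then show ?thesis by (simp add: partial_deriv_def)
qed

lemma test_function_bounded: "\<exists>B. \<forall>x. \<bar>\<phi> x\<bar> \<le> B"
proof -
  have "compact (closure {x. \<phi> x \<noteq> 0})" using \<phi> by (simp add: test_function_def)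
  then have "compact (\<phi> ` closure {x. \<phi> x \<noteq> 0})"
    by (intro compact_continuous_image continuous_on_subset[OF continuous_on_test_function]) auto
  then obtain B where B: "\<And>x. x \<in> closure {x. \<phi> x \<noteq> 0} \<Longrightarrow> norm (\<phi> x) \<le> B"
    by (meson bounded_iff compact_imp_bounded imageI)
  have "\<bar>\<phi> x\<bar> \<le> max B 0" for x
    using B[of x] closure_subset[of "{x. \<phi> x \<noteq> 0}"] by (cases "\<phi> x = 0") (auto simp: le_max_iff_disj)
  then show ?thesis by blast
qed

lemma partial_deriv_bounded: "\<exists>B. \<forall>x. \<bar>partial_deriv j \<phi> x\<bar> \<le> B"
proof -
  have "compact (closure {x. \<phi> x \<noteq> 0})" using \<phi> by (simp add: test_function_def)
  then have "compact (partial_deriv j \<phi> ` closure {x. \<phi> x \<noteq> 0})"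
    by (intro compact_continuous_image continuous_on_subset[OF continuous_on_partial_deriv]) auto
  then obtain B where B: "\<And>x. x \<in> closure {x. \<phi> x \<noteq> 0} \<Longrightarrow> norm (partial_deriv j \<phi> x) \<le> B"
    by (meson bounded_iff compact_imp_bounded imageI)
  have "\<bar>partial_deriv j \<phi> x\<bar> \<le> max B 0" for x
    using B[of x] partial_deriv_eq_0[of x j] by (cases "x \<in> closure {x. \<phi> x \<noteq> 0}") (auto simp: le_max_iff_disj)
  then show ?thesis by blast
qed

text \<open>The mean value theorem along the \<open>j\<close>-th axis; it dominates the difference
  quotients of a test function uniformly.\<close>

lemma test_function_increment:
  assumes B: "\<And>x. \<bar>partial_deriv j \<phi> x\<bar> \<le> B" and t: "0 < t"
  shows "\<bar>\<phi> (x + t *\<^sub>R axis j 1) - \<phi> x\<bar> \<le> B * t"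
proof -
  let ?g = "\<lambda>s. \<phi> (x + s *\<^sub>R axis j 1)"
  have "(?g has_real_derivative partial_deriv j \<phi> (x + s *\<^sub>R axis j 1)) (at s)" for s
  proof -
    let ?F = "frechet_derivative \<phi> (at (x + s *\<^sub>R axis j 1))"
    have "(?g has_derivative (\<lambda>h. ?F (h *\<^sub>R axis j 1))) (at s)"
      by (rule has_derivative_compose[OF _ test_function_has_derivative]) (auto intro!: derivative_eq_intros)
    moreover have "linear ?F" using test_function_has_derivative has_derivative_linear by blast
    ultimately show ?thesis
      by (simp add: has_field_derivative_def partial_deriv_def linear_scale mult.commute[of _ "?F _"] cong: if_cong)
  qed
  then obtain z where "?g t - ?g 0 = (t - 0) * partial_deriv j \<phi> (x + z *\<^sub>R axis j 1)"
    using MVT2[OF t, of ?g "\<lambda>s. partial_deriv j \<phi> (x + s *\<^sub>R axis j 1)"] by blast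
  then show ?thesis using B[of "x + z *\<^sub>R axis j 1"] t by (simp add: abs_mult)
qed

end

lemma norm_le_sum_entries:
  fixes A :: "real^'n^'m"
  shows "norm A \<le> (\<Sum>i\<in>UNIV. \<Sum>j\<in>UNIV. \<bar>A $ i $ j\<bar>)"
proof -
  have "norm A \<le> (\<Sum>i\<in>UNIV. norm (A $ i))" unfolding norm_vec_def by (rule L2_set_le_sum) simp
  also have "\<dots> \<le> (\<Sum>i\<in>UNIV. \<Sum>j\<in>UNIV. \<bar>A $ i $ j\<bar>)" by (intro sum_mono norm_le_l1_cart)
  finally show ?thesis .
qed

text \<open>Discrete integration by parts: translating the integral moves a forward difference
  quotient of the test function to a backward one of \<open>f\<close>. Both sides converge by
  dominated convergence as the step tends to 0, with the Lipschitz bound as dominating function for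
  the quotients of \<open>f\<close>, so that absolute continuity on lines need not be
  discussed.\<close>

lemma weak_derivative_of_ae_derivative:
  fixes f :: "real^'n::{finite,wellorder} \<Rightarrow> real^'m::finite"
  assumes U: "open U"
    and lip: "\<And>C. compact C \<Longrightarrow> C \<subseteq> U \<Longrightarrow> \<exists>L. L-lipschitz_on C f"
    and N: "negligible N"
    and D: "\<And>x. x \<in> U - N \<Longrightarrow> (f has_derivative (\<lambda>v. D x *v v)) (at x)"
    and Dm: "\<And>i j. (\<lambda>x. D x $ i $ j) \<in> borel_measurable lebesgue"
  shows "weak_derivative U f D"
  unfolding weak_derivative_def
proof (intro allI impI)
  fix i j \<phi>
  assume \<phi>: "test_function U \<phi>"
  define K where "K = closure {x. \<phi> x \<noteq> 0}"
  have K: "compact K" "K \<subseteq> U" using \<phi> by (auto simp: K_def test_function_def)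
  have \<phi>0: "\<phi> x = 0" if "x \<notin> K" for x
    using that closure_subset[of "{x. \<phi> x \<noteq> 0}"] by (auto simp: K_def)
  have d\<phi>0: "partial_deriv j \<phi> x = 0" if "x \<notin> K" for x
    using partial_deriv_eq_0[OF \<phi>] that by (simp add: K_def)
  \<comment> \<open>Room for the shifts: with steps at most \<open>e\<close>, points of the support
    move only within \<open>K'\<close>, where one Lipschitz constant holds.\<close>
  obtain e where e: "0 < e" "(\<Union>x\<in>K. cball x e) \<subseteq> U"
    using compact_subset_open_imp_cball_epsilon_subset[OF K(1) U K(2)] by blast
  define K' where "K' = (\<Union>x\<in>K. cball x e)"
  have K': "compact K'" "K' \<subseteq> U" "K \<subseteq> K'"
    using e compact_minkowski_sum_cball[OF K(1), of e] by (auto simp: K'_def)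
  obtain L where L: "L-lipschitz_on K' f" using lip[OF K'(1,2)] by blast
  obtain B where B: "\<And>x. \<bar>\<phi> x\<bar> \<le> B" using test_function_bounded[OF \<phi>] by blast
  obtain B' where B': "\<And>x. \<bar>partial_deriv j \<phi> x\<bar> \<le> B'" using partial_deriv_bounded[OF \<phi>] by blast
  have L0: "0 \<le> L" using L lipschitz_on_nonneg by blast
  have B0: "0 \<le> B" "0 \<le> B'" using B[of undefined] B'[of undefined] by (meson abs_ge_zero order_trans)+
  \<comment> \<open>Extension by 0 gives a function on the whole space, where Lebesgue measure can
    be translated. The jump at the boundary of \<open>K'\<close> does no harm, because the quotients
    below see \<open>F\<close> only at points within a step of the support of
    \<open>\<phi>\<close>.\<close>
  define F where "F x = (if x \<in> K' then f x $ i else 0)" for x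
  have contf: "continuous_on K' f" using L lipschitz_on_continuous_on by blast
  have "continuous_on K' (\<lambda>x. f x $ i)" using contf by (intro continuous_intros)
  moreover have "K' \<in> sets borel" using K'(1) by (rule borel_compact)
  ultimately have "(\<lambda>x. indicator K' x *\<^sub>R f x $ i) \<in> borel_measurable borel"
    by (intro borel_measurable_continuous_on_indicator)
  moreover have "(\<lambda>x. indicator K' x *\<^sub>R f x $ i) = F" by (auto simp: F_def)
  ultimately have Fm [measurable]: "F \<in> borel_measurable borel" by simp
  have \<phi>m [measurable]: "\<phi> \<in> borel_measurable borel"
    by (rule borel_measurable_continuous_onI[OF continuous_on_test_function[OF \<phi>]])
  have d\<phi>m [measurable]: "partial_deriv j \<phi> \<in> borel_measurable borel"
    by (rule borel_measurable_continuous_onI[OF continuous_on_partial_deriv[OF \<phi>]])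
  obtain BF where BF: "\<And>x. \<bar>F x\<bar> \<le> BF"
  proof -
    have "bounded (f ` K')" using contf K'(1) compact_continuous_image compact_imp_bounded by blast
    then obtain b where "\<And>x. x \<in> K' \<Longrightarrow> norm (f x) \<le> b" by (meson bounded_iff imageI)
    then have "\<bar>F x\<bar> \<le> max b 0" for x
      using component_le_norm_cart[of "f x" i] by (auto simp: F_def le_max_iff_disj intro: order_trans)
    then show ?thesis by (rule that)
  qed
  have BF0: "0 \<le> BF" using BF[of undefined] by (meson abs_ge_zero order_trans)
  define t where "t n = e / real (Suc n)" for n
  have t: "0 < t n" "t n \<le> e" for n using e by (auto simp: t_def field_simps)
  have tlim: "t \<longlonglongrightarrow> 0" unfolding t_def by (rule LIMSEQ_Suc[OF lim_const_over_n])
  define a :: "real^'n::_" where "a = axis j 1"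
  have na: "norm a = 1" by (simp add: a_def)
  define S1 where "S1 n x = F x * ((\<phi> (x + t n *\<^sub>R a) - \<phi> x) / t n)" for n x
  define S2 where "S2 n x = \<phi> x * ((F (x - t n *\<^sub>R a) - F x) / t n)" for n x
  have eq: "(\<integral>x. S1 n x \<partial>lebesgue) = (\<integral>x. S2 n x \<partial>lebesgue)" for n
  proof -
    define G where "G x = F (x - t n *\<^sub>R a) * \<phi> x" for x
    have Gm: "G \<in> borel_measurable borel" unfolding G_def by measurable
    have FB: "\<bar>F x * \<phi> y\<bar> \<le> BF * B" for x y
      by (simp add: abs_mult mult_mono BF B BF0)
    have F0: "F x = 0" if "x \<notin> K'" for x using that by (simp add: F_def)
    have "(\<lambda>x. F x * \<phi> (x + t n *\<^sub>R a)) \<in> borel_measurable borel" by measurable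
    then have i1: "integrable lborel (\<lambda>x. F x * \<phi> (x + t n *\<^sub>R a))"
      by (rule lborel_integrable_bounded_support[where S = K' and B = "BF * B"]) (use K'(1) FB F0 in auto)
    have "(\<lambda>x. F x * \<phi> x) \<in> borel_measurable borel" by measurable
    then have i2: "integrable lborel (\<lambda>x. F x * \<phi> x)"
      by (rule lborel_integrable_bounded_support[where S = K' and B = "BF * B"]) (use K'(1) FB F0 in auto)
    have i3: "integrable lborel G"
      by (rule lborel_integrable_bounded_support[OF Gm, where S = K and B = "BF * B"])
         (use K(1) FB \<phi>0 in \<open>auto simp: G_def\<close>)
    \<comment> \<open>The substitution that moves the shift from \<open>\<phi>\<close> to
      \<open>F\<close>.\<close>
    have tr: "(\<integral>x. F x * \<phi> (x + t n *\<^sub>R a) \<partial>lborel) = (\<integral>x. G x \<partial>lborel)"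
      using integral_lborel_translation[OF Gm, of "t n *\<^sub>R a"] by (simp add: G_def)
    have "(\<integral>x. S1 n x \<partial>lebesgue) = (\<integral>x. S1 n x \<partial>lborel)"
      by (rule integral_completion) (simp add: S1_def)
    also have "\<dots> = (\<integral>x. (F x * \<phi> (x + t n *\<^sub>R a) - F x * \<phi> x) / t n \<partial>lborel)"
      by (simp add: S1_def algebra_simps)
    also have "\<dots> = ((\<integral>x. F x * \<phi> (x + t n *\<^sub>R a) \<partial>lborel) - (\<integral>x. F x * \<phi> x \<partial>lborel)) / t n"
      using i1 i2 by simp
    also have "\<dots> = (\<integral>x. (G x - F x * \<phi> x) / t n \<partial>lborel)"
      using i2 i3 by (simp add: tr)
    also have "\<dots> = (\<integral>x. S2 n x \<partial>lborel)"
      by (simp add: S2_def G_def algebra_simps)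
    also have "\<dots> = (\<integral>x. S2 n x \<partial>lebesgue)"
      by (rule integral_completion[symmetric]) (simp add: S2_def)
    finally show ?thesis .
  qed
  have K'm: "emeasure lborel K' < \<infinity>" by (intro emeasure_bounded_finite compact_imp_bounded K'(1))
  have w: "integrable lebesgue (\<lambda>x. c * indicator K' x :: real)" for c
    using K'(1) K'm by (intro integrable_completion[THEN iffD2] integrable_mult_right integrable_real_indicator)
      (auto simp: borel_compact)
  have lim1: "(\<lambda>n. \<integral>x. S1 n x \<partial>lebesgue) \<longlonglongrightarrow> (\<integral>x. F x * partial_deriv j \<phi> x \<partial>lebesgue)"
  proof (rule integral_dominated_convergence[where w = "\<lambda>x. BF * B' * indicator K' x"])
    show "AE x in lebesgue. (\<lambda>n. S1 n x) \<longlonglongrightarrow> F x * partial_deriv j \<phi> x"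
    proof (rule AE_I2)
      fix x
      have "(\<lambda>n. (\<phi> (x + t n *\<^sub>R a) - \<phi> x) /\<^sub>R t n) \<longlonglongrightarrow> frechet_derivative \<phi> (at x) a"
        by (rule has_derivative_difference_quotient[OF test_function_has_derivative[OF \<phi>] tlim])
           (use t in \<open>simp add: less_imp_neq[symmetric]\<close>)
      then show "(\<lambda>n. S1 n x) \<longlonglongrightarrow> F x * partial_deriv j \<phi> x"
        unfolding S1_def partial_deriv_def a_def
        by (intro tendsto_mult tendsto_const) (simp add: divide_inverse mult.commute)
    qed
    show "AE x in lebesgue. norm (S1 n x) \<le> BF * B' * indicator K' x" for n
    proof (rule AE_I2)
      fix x
      have "\<bar>(\<phi> (x + t n *\<^sub>R a) - \<phi> x) / t n\<bar> \<le> B'"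
        using test_function_increment[OF \<phi> B' t(1)] t(1)[of n] by (simp add: a_def abs_divide pos_divide_le_eq)
      then have "norm (S1 n x) \<le> BF * B'"
        unfolding S1_def real_norm_def abs_mult by (intro mult_mono BF BF0 abs_ge_zero)
      then show "norm (S1 n x) \<le> BF * B' * indicator K' x"
        by (auto simp: S1_def F_def indicator_def)
    qed
    show "integrable lebesgue (\<lambda>x. BF * B' * indicator K' x)" by (rule w)
  qed (auto simp: S1_def intro!: measurable_completion)
  have lim2: "(\<lambda>n. \<integral>x. S2 n x \<partial>lebesgue) \<longlonglongrightarrow> (\<integral>x. - (\<phi> x * D x $ i $ j) \<partial>lebesgue)"
  proof (rule integral_dominated_convergence[where w = "\<lambda>x. B * L * indicator K' x"])
    have "negligible N" by (rule N)
    then have "N \<in> null_sets lebesgue" by (simp add: negligible_iff_null_sets)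
    then show "AE x in lebesgue. (\<lambda>n. S2 n x) \<longlonglongrightarrow> - (\<phi> x * D x $ i $ j)"
    proof (rule AE_I', intro subsetI, rule_tac ccontr)
      fix x assume x: "x \<in> {x \<in> space lebesgue. \<not> (\<lambda>n. S2 n x) \<longlonglongrightarrow> - (\<phi> x * D x $ i $ j)}" "x \<notin> N"
      have "x \<in> K" 
      proof (rule ccontr)
        assume "x \<notin> K"
        then have "\<And>n. S2 n x = 0" using \<phi>0 by (simp add: S2_def)
        then show False using x(1) \<phi>0[OF \<open>x \<notin> K\<close>] by simp
      qed
      then have "x \<in> U" using K(2) by blast
      have F1: "F (x - t n *\<^sub>R a) = f (x - t n *\<^sub>R a) $ i" for n
        using \<open>x \<in> K\<close> t[of n] na by (auto simp: F_def K'_def dist_norm intro!: bexI[of _ x])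
      have F2: "F x = f x $ i" using \<open>x \<in> K\<close> K'(3) by (auto simp: F_def)
      have "(\<lambda>n. (f (x + (- t n) *\<^sub>R a) - f x) /\<^sub>R (- t n)) \<longlonglongrightarrow> D x *v a"
        by (rule has_derivative_difference_quotient[OF D])
           (use x \<open>x \<in> U\<close> t tendsto_minus[OF tlim] in \<open>auto simp: less_imp_neq[symmetric]\<close>)
      then have "(\<lambda>n. ((f (x + (- t n) *\<^sub>R a) - f x) /\<^sub>R (- t n)) $ i) \<longlonglongrightarrow> (D x *v a) $ i"
        by (rule tendsto_vec_nth)
      then have "(\<lambda>n. - (\<phi> x * ((f (x + (- t n) *\<^sub>R a) - f x) /\<^sub>R (- t n)) $ i)) \<longlonglongrightarrow> - (\<phi> x * (D x *v a) $ i)"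
        by (intro tendsto_minus tendsto_mult tendsto_const)
      moreover have "- (\<phi> x * ((f (x + (- t n) *\<^sub>R a) - f x) /\<^sub>R (- t n)) $ i) = S2 n x" for n
        by (simp add: S2_def F1 F2 divide_inverse)
      moreover have "(D x *v a) $ i = D x $ i $ j" 
        by (simp add: a_def matrix_vector_mul_component inner_axis)
      ultimately show False using x(1) by simp
    qed
    show "AE x in lebesgue. norm (S2 n x) \<le> B * L * indicator K' x" for n
    proof (rule AE_I2)
      fix x
      show "norm (S2 n x) \<le> B * L * indicator K' x"
      proof (cases "x \<in> K")
        case True
        then have xK: "x \<in> K'" "x - t n *\<^sub>R a \<in> K'"
          using K'(3) t[of n] na by (auto simp: K'_def dist_norm intro!: bexI[of _ x])
        have "\<bar>F (x - t n *\<^sub>R a) - F x\<bar> \<le> norm (f (x - t n *\<^sub>R a) - f x)"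
          using component_le_norm_cart[of "f (x - t n *\<^sub>R a) - f x" i] xK by (simp add: F_def)
        also have "\<dots> \<le> L * t n"
          using lipschitz_on_normD[OF L xK(2,1)] t(1)[of n] na by simp
        finally have "\<bar>(F (x - t n *\<^sub>R a) - F x) / t n\<bar> \<le> L"
          using t(1)[of n] by (simp add: abs_divide pos_divide_le_eq)
        then have "norm (S2 n x) \<le> B * L"
          unfolding S2_def real_norm_def abs_mult by (intro mult_mono B B0 abs_ge_zero)
        then show ?thesis using xK by simp
      qed (use B0 L0 in \<open>simp add: S2_def \<phi>0\<close>)
    qed
    show "integrable lebesgue (\<lambda>x. B * L * indicator K' x)" by (rule w)
    have "\<phi> \<in> borel_measurable lebesgue" by (rule measurable_completion) simp
    then show "(\<lambda>x. - (\<phi> x * D x $ i $ j)) \<in> borel_measurable lebesgue"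
      using Dm by (intro borel_measurable_uminus borel_measurable_times)
    show "S2 n \<in> borel_measurable lebesgue" for n
      unfolding S2_def by (rule measurable_completion) simp
  qed
  have lims: "(\<integral>x. F x * partial_deriv j \<phi> x \<partial>lebesgue) = (\<integral>x. - (\<phi> x * D x $ i $ j) \<partial>lebesgue)"
    using LIMSEQ_unique[OF lim1] lim2 by (simp add: eq)
  have Um: "U \<inter> space lebesgue \<in> sets lebesgue" using U by auto
  have "(\<integral>x. f x $ i * partial_deriv j \<phi> x \<partial>lebesgue_on U) = (\<integral>x. F x * partial_deriv j \<phi> x \<partial>lebesgue)"
    unfolding integral_restrict_space[OF Um]
    by (rule Bochner_Integration.integral_cong) (use K'(2,3) d\<phi>0 in \<open>auto simp: F_def indicator_def\<close>)
  moreover have "(\<integral>x. D x $ i $ j * \<phi> x \<partial>lebesgue_on U) = (\<integral>x. \<phi> x * D x $ i $ j \<partial>lebesgue)"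
    unfolding integral_restrict_space[OF Um]
    by (rule Bochner_Integration.integral_cong) (use K(2) \<phi>0 in \<open>auto simp: indicator_def\<close>)
  ultimately show "(\<integral>x. f x $ i * partial_deriv j \<phi> x \<partial>lebesgue_on U) = - (\<integral>x. D x $ i $ j * \<phi> x \<partial>lebesgue_on U)"
    using lims by simp
qed

lemma locally_Lp_of_bounded_on_compact:
  fixes g :: "real^'n::finite \<Rightarrow> 'b::euclidean_space"
  assumes U: "open U" and g: "g \<in> borel_measurable (lebesgue_on U)"
    and bd: "\<And>C. compact C \<Longrightarrow> C \<subseteq> U \<Longrightarrow> \<exists>B. \<forall>x\<in>C. norm (g x) \<le> B"
  shows "locally_Lp U p g"
  unfolding locally_Lp_def
proof (intro conjI allI impI g)
  fix C assume C: "compact C" "C \<subseteq> U"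
  obtain B where B: "\<And>x. x \<in> C \<Longrightarrow> norm (g x) \<le> B" using bd[OF C] by blast
  have Cm: "C \<in> lmeasurable" using C(1) by (rule lmeasurable_compact)
  then interpret finite_measure "lebesgue_on C" by (rule finite_measure_lebesgue_on)
  have gC: "g \<in> borel_measurable (lebesgue_on C)"
    by (rule measurable_restrict_mono[OF g C(2)])
  show "integrable (lebesgue_on C) (\<lambda>x. norm (g x) ^ p)"
  proof (rule integrable_const_bound[where B = "B ^ p"])
    show "AE x in lebesgue_on C. norm (norm (g x) ^ p) \<le> B ^ p"
    proof (rule AE_I2)
      fix x assume "x \<in> space (lebesgue_on C)"
      then have "x \<in> C" by simp
      then show "norm (norm (g x) ^ p) \<le> B ^ p" using power_mono[OF B norm_ge_zero] by simp
    qed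
    show "(\<lambda>x. norm (g x) ^ p) \<in> borel_measurable (lebesgue_on C)"
      by (rule borel_measurable_power[OF measurable_compose[OF gC borel_measurable_norm]])
  qed
qed

text \<open>\<open>D\<close> consists of pointwise derivatives on the good set and is 0 on the
  exceptional null set. It is bounded on compact sets, since each entry is a limit of difference
  quotients and these obey a Lipschitz bound; hence any exponent \<open>p\<close> will do.\<close>

lemma ae_qc_sobolev:
  fixes f :: "real^'n::{finite,wellorder} \<Rightarrow> real^'n::_"
  assumes U: "open U"
    and lip: "\<And>C. compact C \<Longrightarrow> C \<subseteq> U \<Longrightarrow> \<exists>L. L-lipschitz_on C f"
    and N: "negligible {x \<in> U. \<not> qc_at K f x}"
  obtains D where "has_sobolev_derivative_loc U p f D"
    "AE x in lebesgue_on U. \<exists>a>0. 0 < det (D x) \<and>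
       (\<forall>v. a * norm v \<le> norm (D x *v v) \<and> norm (D x *v v) \<le> K * a * norm v)"
proof -
  let ?N = "{x \<in> U. \<not> qc_at K f x}"
  define S where "S = U - ?N"
  have Um: "U \<in> sets lebesgue" using U by auto
  have Nm: "?N \<in> sets lebesgue" using N negligible_imp_sets by blast
  have Sm: "S \<in> sets lebesgue" unfolding S_def using Um Nm by (rule sets.Diff)
  define good where "good x A a \<longleftrightarrow> (f has_derivative (\<lambda>v. A *v v)) (at x) \<and> 0 < a \<and> 0 < det A \<and>
     (\<forall>v. a * norm v \<le> norm (A *v v) \<and> norm (A *v v) \<le> K * a * norm v)" for x A and a :: real
  have "\<forall>x. \<exists>A. x \<in> S \<longrightarrow> (\<exists>a. good x A a)" unfolding S_def qc_at_def good_def by auto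
  then obtain A where A: "\<And>x. x \<in> S \<Longrightarrow> \<exists>a. good x (A x) a" by metis
  define D where "D x = (if x \<in> S then A x else 0)" for x
  have D: "(f has_derivative (\<lambda>v. D x *v v)) (at x)" if "x \<in> S" for x
    using A[OF that] that by (auto simp: D_def good_def)
  have Dm: "(\<lambda>x. D x $ i $ j) \<in> borel_measurable lebesgue" for i j
  proof -
    have "(\<lambda>x. matrix (\<lambda>v. D x *v v) $ i $ j) \<in> borel_measurable (lebesgue_on S)"
      by (rule borel_measurable_partial_derivatives[OF Sm]) (use D has_derivative_at_withinI in blast)
    then have "(\<lambda>x. if x \<in> S then D x $ i $ j else 0) \<in> borel_measurable lebesgue"
      by (intro borel_measurable_if_I[OF _ Sm]) (simp add: matrix_of_matrix_vector_mul)
    moreover have "(\<lambda>x. if x \<in> S then D x $ i $ j else 0) = (\<lambda>x. D x $ i $ j)"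
      by (auto simp: D_def)
    ultimately show ?thesis by simp
  qed
  have contU: "continuous_on U f"
  proof (rule continuous_at_imp_continuous_on, rule ballI)
    fix x assume "x \<in> U"
    then obtain e where e: "0 < e" "cball x e \<subseteq> U" using U open_contains_cball by blast
    obtain L where "L-lipschitz_on (cball x e) f" using lip[OF compact_cball e(2)] by blast
    then have "continuous_on (cball x e) f" by (rule lipschitz_on_continuous_on)
    then show "isCont f x"
      using e(1) by (meson ball_subset_cball centre_in_ball continuous_on_eq_continuous_at
          continuous_on_subset open_ball)
  qed
  have f_Lp: "locally_Lp U p f"
  proof (rule locally_Lp_of_bounded_on_compact[OF U])
    show "f \<in> borel_measurable (lebesgue_on U)"
      by (rule continuous_imp_measurable_on_sets_lebesgue[OF contU Um])
    fix C assume "compact C" "C \<subseteq> U"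
    then have "bounded (f ` C)"
      using contU compact_continuous_image compact_imp_bounded continuous_on_subset by metis
    then show "\<exists>B. \<forall>x\<in>C. norm (f x) \<le> B" by (meson bounded_iff imageI)
  qed
  have D_Lp: "locally_Lp U p D"
  proof (rule locally_Lp_of_bounded_on_compact[OF U])
    have "D \<in> borel_measurable lebesgue"
      unfolding borel_measurable_euclidean_space[of D]
      using Dm by (auto simp: Basis_vec_def inner_axis)
    then show "D \<in> borel_measurable (lebesgue_on U)" by (rule measurable_restrict_space1)
    fix C assume C: "compact C" "C \<subseteq> U"
    \<comment> \<open>Difference quotients at points of \<open>C\<close> also use points outside
      \<open>C\<close>, hence the thickening.\<close>
    obtain e where e: "0 < e" "(\<Union>x\<in>C. cball x e) \<subseteq> U"
      using compact_subset_open_imp_cball_epsilon_subset[OF C(1) U C(2)] by blast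
    define C' where "C' = (\<Union>x\<in>C. cball x e)"
    have C': "compact C'" "C' \<subseteq> U"
      using e compact_minkowski_sum_cball[OF C(1), of e] by (auto simp: C'_def)
    obtain L where L: "L-lipschitz_on C' f" using lip[OF C'] by blast
    have entry: "\<bar>D x $ i $ j\<bar> \<le> L" if "x \<in> C" for x i j
    proof (cases "x \<in> S")
      case True
      define t where "t n = e / real (Suc n)" for n
      have t: "0 < t n" "t n \<le> e" for n using e by (auto simp: t_def field_simps)
      have tlim: "t \<longlonglongrightarrow> 0" unfolding t_def by (rule LIMSEQ_Suc[OF lim_const_over_n])
      define a :: "real^'n::_" where "a = axis j 1"
      have na: "norm a = 1" by (simp add: a_def)
      have "(\<lambda>n. (f (x + t n *\<^sub>R a) - f x) /\<^sub>R t n) \<longlonglongrightarrow> D x *v a"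
        by (rule has_derivative_difference_quotient[OF D[OF True] tlim])
           (use t in \<open>simp add: less_imp_neq[symmetric]\<close>)
      then have "(\<lambda>n. norm ((f (x + t n *\<^sub>R a) - f x) /\<^sub>R t n)) \<longlonglongrightarrow> norm (D x *v a)"
        by (rule tendsto_norm)
      moreover have "norm ((f (x + t n *\<^sub>R a) - f x) /\<^sub>R t n) \<le> L" for n
      proof -
        have "x + t n *\<^sub>R a \<in> C'" "x \<in> C'"
          using that t[of n] e(1) na by (auto simp: C'_def dist_norm intro!: bexI[of _ x])
        then have "norm (f (x + t n *\<^sub>R a) - f x) \<le> L * t n"
          using lipschitz_on_normD[OF L, of "x + t n *\<^sub>R a" x] t(1)[of n] na by simp
        moreover have "norm ((f (x + t n *\<^sub>R a) - f x) /\<^sub>R t n) = norm (f (x + t n *\<^sub>R a) - f x) / t n"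
          using t(1)[of n] by (simp add: divide_inverse mult.commute)
        ultimately show ?thesis using t(1)[of n] by (simp add: pos_divide_le_eq)
      qed
      ultimately have "norm (D x *v a) \<le> L" by (intro LIMSEQ_le_const2) auto
      moreover have "(D x *v a) $ i = D x $ i $ j"
        by (simp add: a_def matrix_vector_mul_component inner_axis)
      ultimately show ?thesis using component_le_norm_cart[of "D x *v a" i] by simp
    qed (use lipschitz_on_nonneg[OF L] in \<open>simp add: D_def\<close>)
    have "norm (D x) \<le> (\<Sum>i\<in>(UNIV::'n set). \<Sum>j\<in>(UNIV::'n set). L)" if "x \<in> C" for x
      by (rule order_trans[OF norm_le_sum_entries]) (intro sum_mono entry that)
    then show "\<exists>B. \<forall>x\<in>C. norm (D x) \<le> B" by blast
  qed
  have "weak_derivative U f D"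
    by (rule weak_derivative_of_ae_derivative[OF U lip N _ Dm]) (auto intro: D simp: S_def)
  with f_Lp D_Lp have 1: "has_sobolev_derivative_loc U p f D"
    by (simp add: has_sobolev_derivative_loc_def)
  have "?N \<in> null_sets (lebesgue_on U)"
    using N Um by (subst null_sets_restrict_space) (auto simp: negligible_iff_null_sets)
  then have 2: "AE x in lebesgue_on U. \<exists>a>0. 0 < det (D x) \<and>
       (\<forall>v. a * norm v \<le> norm (D x *v v) \<and> norm (D x *v v) \<le> K * a * norm v)"
  proof (rule AE_I')
    show "{x \<in> space (lebesgue_on U). \<not> (\<exists>a>0. 0 < det (D x) \<and>
       (\<forall>v. a * norm v \<le> norm (D x *v v) \<and> norm (D x *v v) \<le> K * a * norm v))} \<subseteq> ?N"
      using A by (fastforce simp: S_def D_def good_def)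
  qed
  show ?thesis by (rule that[OF 1 2])
qed

text \<open>One \<open>D\<close> serves for both bounds. With n the dimension, the operator norm is
  at most \<open>K * a\<close> while the determinant is at least \<open>a ^ n\<close>; and the
  determinant is at most \<open>(K * a) ^ n\<close> while the least stretching is at least
  \<open>a\<close>.\<close>

lemma ae_qc_dilatation_bounds:
  fixes f :: "real^'n::{finite,wellorder} \<Rightarrow> real^'n::_"
  assumes U: "open U"
    and lip: "\<And>C. compact C \<Longrightarrow> C \<subseteq> U \<Longrightarrow> \<exists>L. L-lipschitz_on C f"
    and N: "negligible {x \<in> U. \<not> qc_at K f x}" and K: "0 \<le> K"
  shows "outer_bound U f (K ^ CARD('n))" "inner_bound U f (K ^ CARD('n))"
proof -
  obtain D where D: "has_sobolev_derivative_loc U CARD('n) f D"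
    "AE x in lebesgue_on U. \<exists>a>0. 0 < det (D x) \<and>
       (\<forall>v. a * norm v \<le> norm (D x *v v) \<and> norm (D x *v v) \<le> K * a * norm v)"
    using ae_qc_sobolev[OF U lip N] by blast
  have 1: "onorm (\<lambda>v. D x *v v) ^ CARD('n) \<le> K ^ CARD('n) * det (D x) \<and>
     det (D x) \<le> K ^ CARD('n) * (INF v\<in>sphere 0 1. norm (D x *v v)) ^ CARD('n)"
    if "\<exists>a>0. 0 < det (D x) \<and> (\<forall>v. a * norm v \<le> norm (D x *v v) \<and> norm (D x *v v) \<le> K * a * norm v)" for x
  proof -
    obtain a where a: "0 < a" "0 < det (D x)" "\<And>v. a * norm v \<le> norm (D x *v v)"
      "\<And>v. norm (D x *v v) \<le> K * a * norm v" using \<open>\<exists>a>0. _\<close> by blast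
    have Ka: "0 \<le> K * a" using K a(1) by simp
    have "onorm (\<lambda>v. D x *v v) \<le> K * a" by (rule onorm_bound[OF Ka a(4)])
    then have "onorm (\<lambda>v. D x *v v) ^ CARD('n) \<le> (K * a) ^ CARD('n)"
      by (intro power_mono onorm_pos_le matrix_vector_mul_bounded_linear)
    also have "\<dots> \<le> K ^ CARD('n) * det (D x)"
      using det_ge_power[OF a(1,3)] a(2) K by (simp add: power_mult_distrib mult_left_mono)
    finally have "onorm (\<lambda>v. D x *v v) ^ CARD('n) \<le> K ^ CARD('n) * det (D x)" .
    moreover have "det (D x) \<le> K ^ CARD('n) * (INF v\<in>sphere 0 1. norm (D x *v v)) ^ CARD('n)"
    proof -
      have "axis undefined 1 \<in> sphere (0::real^'n::_) 1" by simp
      then have "sphere (0::real^'n::_) 1 \<noteq> {}" by blast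
      then have "a \<le> (INF v\<in>sphere 0 1. norm (D x *v v))"
        by (rule cINF_greatest) (metis a(3) mem_sphere_0 mult.right_neutral)
      then have "a ^ CARD('n) \<le> (INF v\<in>sphere 0 1. norm (D x *v v)) ^ CARD('n)"
        using a(1) by (intro power_mono) auto
      then have "K ^ CARD('n) * a ^ CARD('n) \<le> K ^ CARD('n) * (INF v\<in>sphere 0 1. norm (D x *v v)) ^ CARD('n)"
        using K by (intro mult_left_mono) auto
      then show ?thesis using det_le_power[OF Ka a(4)] a(2) by (simp add: power_mult_distrib)
    qed
    ultimately show ?thesis by blast
  qed
  have "AE x in lebesgue_on U. onorm (\<lambda>v. D x *v v) ^ CARD('n) \<le> K ^ CARD('n) * det (D x)"
    using D(2) by (rule AE_mp) (use 1 in auto)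
  with D(1) show "outer_bound U f (K ^ CARD('n))" unfolding outer_bound_def by blast
  have "AE x in lebesgue_on U. det (D x) \<le> K ^ CARD('n) * (INF v\<in>sphere 0 1. norm (D x *v v)) ^ CARD('n)"
    using D(2) by (rule AE_mp) (use 1 in auto)
  with D(1) show "inner_bound U f (K ^ CARD('n))" unfolding inner_bound_def by blast
qed

lemma max_dilatation_le:
  assumes "1 \<le> K" "outer_bound U f K" "inner_bound U f K"
  shows "max_dilatation U f \<le> K"
proof -
  have "Inf {K. 1 \<le> K \<and> inner_bound U f K} \<le> K" "Inf {K. 1 \<le> K \<and> outer_bound U f K} \<le> K"
    using assms by (auto intro!: cInf_lower bdd_belowI[of _ 1])
  then show ?thesis by (simp add: max_dilatation_def inner_dilatation_def outer_dilatation_def)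
qed

section \<open>Reflections\<close>

lemma negligible_not_qc_compose:
  fixes f g :: "real^'n::finite \<Rightarrow> real^'n"
  assumes f: "negligible {x \<in> U. \<not> qc_at K f x}" and g: "negligible {y \<in> V. \<not> qc_at K' g y}"
    and UV: "\<And>x. x \<in> U \<Longrightarrow> f x \<in> V"
  shows "negligible {x \<in> U. \<not> qc_at (K * K') (\<lambda>x. g (f x)) x}"
proof -
  define S where "S = {x \<in> U. qc_at K f x}"
  have "\<forall>x. \<exists>A. x \<in> S \<longrightarrow> inj (\<lambda>v. A *v v) \<and> (f has_derivative (\<lambda>v. A *v v)) (at x)"
  proof (intro allI)
    fix x
    show "\<exists>A. x \<in> S \<longrightarrow> inj (\<lambda>v. A *v v) \<and> (f has_derivative (\<lambda>v. A *v v)) (at x)"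
    proof (cases "x \<in> S")
      case True
      then obtain A a where A: "(f has_derivative (\<lambda>v. A *v v)) (at x)" "0 < a" "0 < det A"
        "\<And>v. a * norm v \<le> norm (A *v v) \<and> norm (A *v v) \<le> K * a * norm v"
        unfolding S_def qc_at_def by blast
      have "inj (\<lambda>v. A *v v)" using A(3) invertible_det_nz[of A] inj_matrix_vector_mult by auto
      with A(1) show ?thesis by blast
    qed simp
  qed
  then obtain A where A: "\<And>x. x \<in> S \<Longrightarrow> inj (\<lambda>v. A x *v v)"
    "\<And>x. x \<in> S \<Longrightarrow> (f has_derivative (\<lambda>v. A x *v v)) (at x)" by metis
  have "negligible {x \<in> S. f x \<in> {y \<in> V. \<not> qc_at K' g y}}"
    by (rule negligible_differentiable_vimage[OF g A(1)]) (use A(2) has_derivative_at_withinI in blast)+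
  then have "negligible ({x \<in> S. f x \<in> {y \<in> V. \<not> qc_at K' g y}} \<union> {x \<in> U. \<not> qc_at K f x})"
    using f by simp
  then show ?thesis
    by (rule negligible_subset) (use UV in \<open>auto simp: S_def intro: qc_at_compose\<close>)
qed

lemma reflect_plane_nth [simp]:
  "reflect_plane i c x $ j = (if j = i then 2 * c - x $ i else x $ j)"
  by (simp add: reflect_plane_def)

lemma reflect_plane_reflect_plane [simp]: "reflect_plane i c (reflect_plane i c x) = x"
  by (simp add: vec_eq_iff)

lemma norm_sq_3: "(norm (x::real^3))\<^sup>2 = (x $ 1)\<^sup>2 + (x $ 2)\<^sup>2 + (x $ 3)\<^sup>2"
  unfolding power2_norm_eq_inner by (simp add: inner_vec_def sum_3 power2_eq_square)

lemma norm_sq_2: "(norm (x::real^2))\<^sup>2 = (x $ 1)\<^sup>2 + (x $ 2)\<^sup>2"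
  unfolding power2_norm_eq_inner by (simp add: inner_vec_def sum_2 power2_eq_square)

lemma norm_reflect_plane_diff [simp]:
  "norm (reflect_plane i c x - reflect_plane i c y) = norm (x - y)"
proof -
  have "(norm (reflect_plane i c x - reflect_plane i c y))\<^sup>2 = (norm (x - y))\<^sup>2"
    using exhaust_3[of i] unfolding norm_sq_3 by (auto simp: power2_commute)
  then show ?thesis by (simp add: power2_eq_iff_nonneg)
qed

lemma linear_reflect_plane_0: "linear (reflect_plane i 0)"
  by (rule linearI) (simp_all add: vec_eq_iff)

lemma reflect_plane_0_scaleR: "reflect_plane i 0 (t *\<^sub>R x) = t *\<^sub>R reflect_plane i 0 x"
  by (rule linear_scale[OF linear_reflect_plane_0])

lemma norm_reflect_plane_0 [simp]: "norm (reflect_plane i 0 x) = norm x"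
proof -
  have "norm (reflect_plane i 0 x - reflect_plane i 0 0) = norm x"
    by (subst norm_reflect_plane_diff) simp
  moreover have "reflect_plane i 0 0 = 0" by (simp add: vec_eq_iff)
  ultimately show ?thesis by simp
qed

lemma negligible_reflect_plane_0: "negligible S \<Longrightarrow> negligible {x. reflect_plane i 0 x \<in> S}"
proof -
  assume "negligible S"
  then have "negligible (reflect_plane i 0 ` S)"
    by (intro negligible_differentiable_image_negligible linear_imp_differentiable_on linear_reflect_plane_0) simp_all
  then show ?thesis
    by (rule negligible_subset) (force intro!: image_eqI[of _ _ "reflect_plane i 0 _"])
qed

text \<open>Conjugation uses the reflection twice, so orientation survives although a single
  reflection reverses it. The determinant of the reflection is never computed: that \<open>B\<close>
  is an involution gives \<open>det B * det B = 1\<close>.\<close>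

lemma qc_at_reflect:
  assumes "qc_at K f (reflect_plane i 0 x)"
  shows "qc_at K (\<lambda>x. reflect_plane i 0 (f (reflect_plane i 0 x))) x"
proof -
  let ?R = "reflect_plane i 0"
  define B where "B = matrix ?R"
  have RB: "?R v = B *v v" for v
    unfolding B_def by (simp add: matrix_works linear_reflect_plane_0)
  have "B ** B = mat 1"
    by (simp add: matrix_eq matrix_vector_mul_assoc[symmetric] RB[symmetric])
  then have detB: "det B * det B = 1" by (metis det_mul det_I)
  obtain A a where A: "(f has_derivative (\<lambda>v. A *v v)) (at (?R x))" "0 < a" "0 < det A"
    "\<And>v. a * norm v \<le> norm (A *v v)" "\<And>v. norm (A *v v) \<le> K * a * norm v"
    using assms unfolding qc_at_def by blast
  have dR: "(?R has_derivative ?R) F" for F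
    by (intro linear_imp_has_derivative linear_reflect_plane_0)
  have "((\<lambda>x. ?R (f (?R x))) has_derivative (\<lambda>v. ?R (A *v ?R v))) (at x)"
    by (rule has_derivative_compose[OF has_derivative_compose[OF dR A(1)] dR])
  moreover have mat: "?R (A *v ?R v) = (B ** A ** B) *v v" for v
    by (simp add: RB matrix_vector_mul_assoc matrix_mul_assoc)
  ultimately have D: "((\<lambda>x. ?R (f (?R x))) has_derivative (\<lambda>v. (B ** A ** B) *v v)) (at x)"
    by simp
  have "det (B ** A ** B) = det A" using detB by (simp add: det_mul)
  then have "0 < det (B ** A ** B)" using A(3) by simp
  moreover have "a * norm v \<le> norm ((B ** A ** B) *v v)"
    "norm ((B ** A ** B) *v v) \<le> K * a * norm v" for v
    using A(4,5)[of "?R v"] unfolding mat[symmetric] by simp_all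
  ultimately show ?thesis unfolding qc_at_def using D A(2) by blast
qed

text \<open>The plane of reflection belongs to the first branch. The branches fit together there
  only if \<open>F\<close> maps this plane to itself, which is what the flatness assumptions below
  provide.\<close>

definition reflect_extension :: "(real^3 \<Rightarrow> real^3) \<Rightarrow> real^3 \<Rightarrow> real^3" where
  "reflect_extension F w =
     (if 0 \<le> w $ 3 then F w else reflect_plane 3 0 (F (reflect_plane 3 0 w)))"

text \<open>Points on opposite sides are compared through the mirror image of the lower one, which
  is no farther from the upper one. The value at the mirror image and the reflection of that value
  differ by twice a third coordinate, which \<open>flat\<close> bounds by \<open>2 * C\<close> times
  the distance; with the \<open>C\<close> of the upper side this makes 3.\<close>

lemma reflect_extension_lipschitz:
  assumes C: "0 \<le> C"
    and lip: "\<And>v w. v \<in> V \<Longrightarrow> w \<in> V \<Longrightarrow> 0 \<le> v $ 3 \<Longrightarrow> 0 \<le> w $ 3 \<Longrightarrow> norm (F v - F w) \<le> C * norm (v - w)"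
    and flat: "\<And>v. v \<in> V \<Longrightarrow> 0 \<le> v $ 3 \<Longrightarrow> \<bar>F v $ 3\<bar> \<le> C * v $ 3"
    and V: "\<And>v. v \<in> V \<Longrightarrow> reflect_plane 3 0 v \<in> V"
    and vw: "v \<in> V" "w \<in> V"
  shows "norm (reflect_extension F v - reflect_extension F w) \<le> (3 * C) * norm (v - w)"
proof -
  let ?R = "reflect_plane 3 0"
  have mixed: "norm (F v - ?R (F (?R w))) \<le> (3 * C) * norm (v - w)"
    if vw: "v \<in> V" "w \<in> V" "0 \<le> v $ 3" "w $ 3 < 0" for v w
  proof -
    have wV: "?R w \<in> V" "0 \<le> ?R w $ 3" using V vw by auto
    have "(norm (v - ?R w))\<^sup>2 \<le> (norm (v - w))\<^sup>2"
      using vw(3,4) mult_nonneg_nonpos[of "v $ 3" "w $ 3"] unfolding norm_sq_3 by (simp add: power2_eq_square algebra_simps)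
    then have 1: "norm (v - ?R w) \<le> norm (v - w)" by (simp add: power2_le_iff_abs_le)
    have "F (?R w) - ?R (F (?R w)) = (2 * F (?R w) $ 3) *\<^sub>R axis 3 1"
      by (simp add: vec_eq_iff forall_3 axis_def)
    then have "norm (F (?R w) - ?R (F (?R w))) = 2 * \<bar>F (?R w) $ 3\<bar>"
      by (simp add: abs_mult)
    also have "\<dots> \<le> 2 * (C * \<bar>w $ 3\<bar>)" using flat[OF wV] vw(4) by simp
    also have "\<bar>w $ 3\<bar> \<le> norm (v - w)"
      using component_le_norm_cart[of "v - w" 3] vw(3,4) by simp
    then have "2 * (C * \<bar>w $ 3\<bar>) \<le> 2 * (C * norm (v - w))" using C by (simp add: mult_left_mono)
    finally have 2: "norm (F (?R w) - ?R (F (?R w))) \<le> 2 * (C * norm (v - w))" .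
    have "norm (F v - F (?R w)) \<le> C * norm (v - w)"
      using lip[OF vw(1) wV(1) vw(3) wV(2)] mult_left_mono[OF 1 C] by linarith
    then show ?thesis
      using 2 norm_triangle_ineq[of "F v - F (?R w)" "F (?R w) - ?R (F (?R w))"] by simp
  qed
  have C3: "C * norm (v - w) \<le> (3 * C) * norm (v - w)" using C by (intro mult_right_mono) auto
  consider "0 \<le> v $ 3" "0 \<le> w $ 3" | "0 \<le> v $ 3" "w $ 3 < 0" | "v $ 3 < 0" "0 \<le> w $ 3"
    | "v $ 3 < 0" "w $ 3 < 0" by linarith
  then show ?thesis
  proof cases
    case 1
    then show ?thesis using lip[of v w] vw C3 by (simp add: reflect_extension_def)
  next
    case 2
    then show ?thesis using mixed[of v w] vw by (simp add: reflect_extension_def)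
  next
    case 3
    then show ?thesis using mixed[of w v] vw by (simp add: reflect_extension_def norm_minus_commute)
  next
    case 4
    then show ?thesis using lip[of "?R v" "?R w"] V vw C3 by (simp add: reflect_extension_def)
  qed
qed

text \<open>Besides the bad set above the plane, only its mirror image and the plane itself can be
  bad, and all three are null.\<close>

lemma reflect_extension_not_qc:
  assumes neg: "negligible {w \<in> V. 0 < w $ 3 \<and> \<not> qc_at K F w}"
    and V: "\<And>v. v \<in> V \<Longrightarrow> reflect_plane 3 0 v \<in> V"
  shows "negligible {w \<in> V. \<not> qc_at K (reflect_extension F) w}"
proof -
  let ?R = "reflect_plane 3 0"
  let ?N = "{w \<in> V. 0 < w $ 3 \<and> \<not> qc_at K F w}"
  have op: "open {w::real^3. 0 < w $ 3}" "open {w::real^3. w $ 3 < 0}"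
    by (auto intro!: open_Collect_less continuous_intros)
  have 1: "qc_at K (reflect_extension F) w" if "qc_at K F w" "0 < w $ 3" for w
    by (rule qc_at_transform[OF that(1) op(1)]) (use that in \<open>auto simp: reflect_extension_def\<close>)
  have 2: "qc_at K (reflect_extension F) w" if "qc_at K F (?R w)" "w $ 3 < 0" for w
    by (rule qc_at_transform[OF qc_at_reflect[OF that(1)] op(2)])
       (use that in \<open>auto simp: reflect_extension_def\<close>)
  have "negligible (?N \<union> {x. ?R x \<in> ?N} \<union> {x. x $ 3 = 0})"
    by (intro negligible_Un neg negligible_reflect_plane_0 negligible_standard_hyperplane_cart)
  then show ?thesis
  proof (rule negligible_subset)
    show "{w \<in> V. \<not> qc_at K (reflect_extension F) w} \<subseteq> ?N \<union> {x. ?R x \<in> ?N} \<union> {x. x $ 3 = 0}"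
    proof
      fix w assume w: "w \<in> {w \<in> V. \<not> qc_at K (reflect_extension F) w}"
      show "w \<in> ?N \<union> {x. ?R x \<in> ?N} \<union> {x. x $ 3 = 0}"
        using w 1[of w] 2[of w] V[of w] by (cases "0 < w $ 3"; cases "w $ 3 < 0") auto
    qed
  qed
qed

lemma negligible_coordinate_hyperplane: "negligible {x::real^3. x $ i = c}"
proof -
  have "negligible {x::real^3. x \<bullet> axis i 1 = c}"
    by (rule negligible_standard_hyperplane) (auto simp: Basis_vec_def)
  then show ?thesis by (simp add: inner_axis)
qed

text \<open>Let 2k be an even integer nearest to \<open>t\<close>. If k is odd, reflection in k
  brings \<open>t\<close> into the interval. If k is even, a first reflection in 1 replaces k by the
  odd number 1 - k.\<close>

lemma odd_reflection_into_unit_interval: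
  fixes t :: real
  shows "(\<exists>n::int. odd n \<and> \<bar>2 * of_int n - t\<bar> \<le> 1) \<or>
    (\<exists>m n::int. odd m \<and> odd n \<and> \<bar>2 * of_int n - (2 * of_int m - t)\<bar> \<le> 1)"
proof -
  define k where "k = \<lfloor>(t + 1) / 2\<rfloor>"
  have k: "of_int k \<le> (t + 1) / 2" "(t + 1) / 2 < of_int k + 1" unfolding k_def by linarith+
  then have kt: "\<bar>2 * of_int k - t\<bar> \<le> 1" by (simp add: abs_le_iff field_simps)
  show ?thesis
  proof (cases "odd k")
    case False
    then have "odd (1 - k)" by simp
    moreover have "\<bar>2 * of_int (1 - k) - (2 * of_int 1 - t)\<bar> \<le> 1" using kt by simp
    ultimately show ?thesis using odd_one by blast
  qed (use kt in blast)
qed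

text \<open>At most two reflections in each of the first two coordinates bring a point into the
  prism. In this way facts about \<open>h\<close> on the square become facts about \<open>Z\<close>
  everywhere.\<close>

lemma prism_reflection_induct:
  fixes x :: "real^3"
  assumes refl: "\<And>x i n. i \<in> {1, 2} \<Longrightarrow> odd n \<Longrightarrow> P (reflect_plane i (real_of_int n) x) \<Longrightarrow> P x"
    and base: "\<And>x. \<bar>x $ 1\<bar> \<le> 1 \<Longrightarrow> \<bar>x $ 2\<bar> \<le> 1 \<Longrightarrow> P x"
  shows "P x"
proof -
  have step: "P x" if i: "i \<in> {1, 2}" and *: "\<And>y. \<bar>y $ i\<bar> \<le> 1 \<Longrightarrow> (\<And>j. j \<noteq> i \<Longrightarrow> y $ j = x $ j) \<Longrightarrow> P y" for i x
    using odd_reflection_into_unit_interval[of "x $ i"]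
  proof
    assume "\<exists>n::int. odd n \<and> \<bar>2 * of_int n - x $ i\<bar> \<le> 1"
    then show "P x" using refl[OF i, of _ x] * by auto
  next
    assume "\<exists>m n::int. odd m \<and> odd n \<and> \<bar>2 * of_int n - (2 * of_int m - x $ i)\<bar> \<le> 1"
    then obtain m n :: int where mn: "odd m" "odd n" "\<bar>2 * of_int n - (2 * of_int m - x $ i)\<bar> \<le> 1" by blast
    have "P (reflect_plane i n (reflect_plane i m x))" by (rule *) (use mn(3) in auto)
    then show "P x" using refl[OF i] mn(1,2) by blast
  qed
  show ?thesis
  proof (rule step[of 1])
    fix y :: "real^3" assume y: "\<bar>y $ 1\<bar> \<le> 1"
    show "P y"
    proof (rule step[of 2])
      fix z :: "real^3" assume z: "\<bar>z $ 2\<bar> \<le> 1" "\<And>j. j \<noteq> 2 \<Longrightarrow> z $ j = y $ j"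
      show "P z" by (rule base) (use y z(1) z(2)[of 1] in auto)
    qed simp
  qed simp
qed

section \<open>The Zorich map\<close>

abbreviation base_point :: "real^3 \<Rightarrow> real^2" where
  "base_point x \<equiv> vector [x $ 1, x $ 2]"

definition prism :: "(real^3) set" where
  "prism = {x. \<bar>x $ 1\<bar> \<le> 1 \<and> \<bar>x $ 2\<bar> \<le> 1}"

lemma base_point_in_square: "base_point x \<in> square \<longleftrightarrow> x \<in> prism"
  by (simp add: square_def prism_def)

lemma norm_base_point_diff_le_sum:
  "norm (base_point x - base_point y) \<le> \<bar>x $ 1 - y $ 1\<bar> + \<bar>x $ 2 - y $ 2\<bar>"
  using norm_le_l1_cart[of "base_point x - base_point y"] by (simp add: sum_2)

lemma norm_base_point_diff_le: "norm (base_point x - base_point y) \<le> norm (x - y)"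
proof -
  have "(norm (base_point x - base_point y))\<^sup>2 \<le> (norm (x - y))\<^sup>2"
    unfolding norm_sq_3 norm_sq_2 by simp
  then show ?thesis by (simp add: power2_le_iff_abs_le)
qed

lemma norm_le_base_point_plus: "norm (x - y) \<le> norm (base_point x - base_point y) + \<bar>x $ 3 - y $ 3\<bar>"
proof -
  have "(norm (x - y))\<^sup>2 \<le> (norm (base_point x - base_point y) + \<bar>x $ 3 - y $ 3\<bar>)\<^sup>2"
    unfolding power2_sum norm_sq_3 norm_sq_2 by simp
  then show ?thesis by (rule power2_le_imp_le) simp
qed

section \<open>Two-sided stretching estimates for the Zorich map\<close>

definition update :: "3 \<Rightarrow> real \<Rightarrow> real^3 \<Rightarrow> real^3" where
  "update i t x = (\<chi> j. if j = i then t else x $ j)"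

lemma update_nth [simp]: "update i t x $ j = (if j = i then t else x $ j)"
  by (simp add: update_def)

text \<open>The number 3 is an upper bound for exp 1, and 1/3 accordingly a lower bound for the
  exponential on this interval; so one constant serves both directions.\<close>

lemma abs_exp_minus_1_bounds:
  fixes t :: real
  assumes "\<bar>t\<bar> \<le> 1"
  shows "\<bar>t\<bar> \<le> 3 * \<bar>exp t - 1\<bar>" "\<bar>exp t - 1\<bar> \<le> 3 * \<bar>t\<bar>"
proof -
  have lower: "t \<le> exp t - 1" using exp_ge_add_one_self[of t] by linarith
  have "1 - t \<le> exp (- t)" using exp_ge_add_one_self[of "- t"] by linarith
  then have "(1 - t) * exp t \<le> exp (- t) * exp t" by (intro mult_right_mono) auto
  also have "\<dots> = 1" by (simp add: exp_add[symmetric])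
  finally have upper: "exp t - 1 \<le> t * exp t" by (simp add: left_diff_distrib)
  have t: "- 1 \<le> t" "t \<le> 1" using assms by linarith+
  have "exp t \<le> exp 1" using t(2) by (simp only: exp_le_cancel_iff)
  then have et: "exp t \<le> 3" using exp_le by (rule order_trans)
  have "exp (- t) \<le> exp 1" using t(1) by (simp only: exp_le_cancel_iff minus_le_iff)
  then have "exp (- t) \<le> 3" using exp_le by (rule order_trans)
  then have "exp (- t) * exp t \<le> 3 * exp t" by (intro mult_right_mono) auto
  then have exp_ge: "1 \<le> 3 * exp t" by (simp only: exp_add[symmetric]) simp
  have "\<bar>t\<bar> \<le> 3 * \<bar>exp t - 1\<bar> \<and> \<bar>exp t - 1\<bar> \<le> 3 * \<bar>t\<bar>"
  proof (cases "0 \<le> t")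
    case True
    have "t * exp t \<le> t * 3" using True et by (intro mult_left_mono)
    moreover have "\<bar>exp t - 1\<bar> = exp t - 1" by (rule abs_of_nonneg) (use lower True in argo)
    moreover have "\<bar>t\<bar> = t" using True by (rule abs_of_nonneg)
    ultimately show ?thesis using lower upper True by argo
  next
    case False
    have "- t * 1 \<le> - t * (3 * exp t)" using False exp_ge by (intro mult_left_mono) auto
    moreover have "- t * (3 * exp t) = - 3 * (t * exp t)" by (simp only: mult_ac mult_minus_left mult_minus_right)
    moreover have "t * exp t \<le> 0" using False by (intro mult_nonpos_nonneg) auto
    moreover have "\<bar>exp t - 1\<bar> = - (exp t - 1)"
      by (rule abs_of_nonpos) (use \<open>t * exp t \<le> 0\<close> upper in argo)
    moreover have "\<bar>t\<bar> = - t" using False by (intro abs_of_nonpos) auto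
    ultimately show ?thesis using lower upper False by argo
  qed
  then show "\<bar>t\<bar> \<le> 3 * \<bar>exp t - 1\<bar>" "\<bar>exp t - 1\<bar> \<le> 3 * \<bar>t\<bar>" by blast+
qed

text \<open>The bi-Lipschitz constant of \<open>h\<close> is a parameter, so that the distortion
  constants below become expressions in \<open>L\<close>, the same for every
  \<open>d\<close>.\<close>

locale zorich =
  fixes h :: "real^2 \<Rightarrow> real^3" and Z :: "real^3 \<Rightarrow> real^3" and L :: real
  assumes L: "1 \<le> L"
    and h_lipschitz: "\<And>a b. a \<in> square \<Longrightarrow> b \<in> square \<Longrightarrow> norm (h a - h b) \<le> L * norm (a - b)"
    and h_expanding: "\<And>a b. a \<in> square \<Longrightarrow> b \<in> square \<Longrightarrow> norm (a - b) \<le> L * norm (h a - h b)"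
    and h_image: "h ` square = upper_hemisphere"
    and Z: "zorich_map h Z"
    and Z_orientation: "orientation_preserving Z"
begin

lemma h_inj: "inj_on h square"
  using h_expanding by (force intro!: inj_onI)

lemma norm_h: "a \<in> square \<Longrightarrow> norm (h a) = 1"
  using h_image by (force simp: upper_hemisphere_def)

lemma h_3_nonneg: "a \<in> square \<Longrightarrow> 0 \<le> h a $ 3"
  using h_image by (force simp: upper_hemisphere_def)

lemma Z_prism: "x \<in> prism \<Longrightarrow> Z x = exp (x $ 3) *\<^sub>R h (base_point x)"
  using Z by (simp add: zorich_map_def base_point_in_square)

lemma Z_reflect:
  "i \<in> {1, 2} \<Longrightarrow> odd n \<Longrightarrow> Z (reflect_plane i (real_of_int n) x) = reflect_plane 3 0 (Z x)"
  using Z unfolding zorich_map_def by blast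

lemma norm_Z: "norm (Z x) = exp (x $ 3)"
proof (rule prism_reflection_induct[of _ x])
  fix x :: "real^3" and i :: 3 and n :: int
  assume "i \<in> {1, 2}" "odd n"
    and eq: "norm (Z (reflect_plane i n x)) = exp (reflect_plane i n x $ 3)"
  then have "i \<noteq> 3" by auto
  then show "norm (Z x) = exp (x $ 3)" using eq Z_reflect[OF \<open>i \<in> {1, 2}\<close> \<open>odd n\<close>] by simp
next
  fix x :: "real^3" assume "\<bar>x $ 1\<bar> \<le> 1" "\<bar>x $ 2\<bar> \<le> 1"
  then have "x \<in> prism" by (simp add: prism_def)
  then show "norm (Z x) = exp (x $ 3)" by (simp add: Z_prism norm_h base_point_in_square)
qed

lemma Z_nonzero: "Z x \<noteq> 0"
  using norm_Z[of x] by auto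

lemma Z_update_3: "Z (update 3 s x) = exp (s - x $ 3) *\<^sub>R Z x"
proof (rule prism_reflection_induct[of _ x])
  fix x :: "real^3" and i :: 3 and n :: int
  assume i: "i \<in> {1, 2}" and n: "odd n"
    and eq: "Z (update 3 s (reflect_plane i n x)) = exp (s - reflect_plane i n x $ 3) *\<^sub>R Z (reflect_plane i n x)"
  have "i \<noteq> 3" using i by auto
  then have "update 3 s (reflect_plane i n x) = reflect_plane i n (update 3 s x)"
    by (simp add: vec_eq_iff)
  then have "reflect_plane 3 0 (Z (update 3 s x)) = reflect_plane 3 0 (exp (s - x $ 3) *\<^sub>R Z x)"
    using eq Z_reflect[OF i n] \<open>i \<noteq> 3\<close> by (simp add: reflect_plane_0_scaleR)
  then show "Z (update 3 s x) = exp (s - x $ 3) *\<^sub>R Z x"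
    by (metis reflect_plane_reflect_plane)
next
  fix x :: "real^3" assume "\<bar>x $ 1\<bar> \<le> 1" "\<bar>x $ 2\<bar> \<le> 1"
  then have "x \<in> prism" "update 3 s x \<in> prism" by (simp_all add: prism_def)
  then show "Z (update 3 s x) = exp (s - x $ 3) *\<^sub>R Z x"
    by (simp add: Z_prism exp_diff)
qed

text \<open>A cell is an interval of length 2 centred at an even integer; over it \<open>Z\<close>
  is a reflected copy of its restriction to the prism. \<open>k\<close> and \<open>t\<close> are
  quantified inside the induction because a reflection moves both of them.\<close>

lemma Z_cell_lipschitz:
  assumes i: "i \<in> {1, 2}"
    and k: "\<bar>x $ i - 2 * real_of_int k\<bar> \<le> 1" "\<bar>t - 2 * real_of_int k\<bar> \<le> 1"
  shows "norm (Z x - Z (update i t x)) \<le> exp (x $ 3) * L * \<bar>x $ i - t\<bar>"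
proof -
  have *: "\<forall>k t. \<bar>x $ i - 2 * real_of_int k\<bar> \<le> 1 \<longrightarrow> \<bar>t - 2 * real_of_int k\<bar> \<le> 1 \<longrightarrow>
    norm (Z x - Z (update i t x)) \<le> exp (x $ 3) * L * \<bar>x $ i - t\<bar>"
  proof (rule prism_reflection_induct[of _ x])
    fix x :: "real^3" and j :: 3 and n :: int
    assume j: "j \<in> {1, 2}" and n: "odd n"
      and IH: "\<forall>k t. \<bar>reflect_plane j n x $ i - 2 * real_of_int k\<bar> \<le> 1 \<longrightarrow> \<bar>t - 2 * real_of_int k\<bar> \<le> 1 \<longrightarrow>
        norm (Z (reflect_plane j n x) - Z (update i t (reflect_plane j n x))) \<le>
          exp (reflect_plane j n x $ 3) * L * \<bar>reflect_plane j n x $ i - t\<bar>"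
    have j3: "j \<noteq> 3" using j by auto
    show "\<forall>k t. \<bar>x $ i - 2 * real_of_int k\<bar> \<le> 1 \<longrightarrow> \<bar>t - 2 * real_of_int k\<bar> \<le> 1 \<longrightarrow>
      norm (Z x - Z (update i t x)) \<le> exp (x $ 3) * L * \<bar>x $ i - t\<bar>"
    proof (intro allI impI)
      fix k :: int and t :: real
      assume k: "\<bar>x $ i - 2 * real_of_int k\<bar> \<le> 1" "\<bar>t - 2 * real_of_int k\<bar> \<le> 1"
      define t' where "t' = (if j = i then 2 * n - t else t)"
      \<comment> \<open>Reflection in \<open>n\<close> sends the centre 2k of a cell to 2(n -
        k).\<close>
      define k' where "k' = (if j = i then n - k else k)"
      have 1: "\<bar>reflect_plane j n x $ i - 2 * real_of_int k'\<bar> \<le> 1" "\<bar>t' - 2 * real_of_int k'\<bar> \<le> 1"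
        using k by (auto simp: t'_def k'_def)
      have 2: "update i t' (reflect_plane j n x) = reflect_plane j n (update i t x)"
        by (auto simp: vec_eq_iff t'_def)
      have 3: "\<bar>reflect_plane j n x $ i - t'\<bar> = \<bar>x $ i - t\<bar>" by (auto simp: t'_def)
      show "norm (Z x - Z (update i t x)) \<le> exp (x $ 3) * L * \<bar>x $ i - t\<bar>"
        using IH[rule_format, OF 1] j3 unfolding 2 3 Z_reflect[OF j n] by simp
    qed
  next
    fix x :: "real^3" assume x: "\<bar>x $ 1\<bar> \<le> 1" "\<bar>x $ 2\<bar> \<le> 1"
    have base: "norm (Z x - Z (update i t x)) \<le> exp (x $ 3) * L * \<bar>x $ i - t\<bar>" if t: "\<bar>t\<bar> \<le> 1" for t
    proof -
      have pr: "x \<in> prism" "update i t x \<in> prism" using x t i by (auto simp: prism_def)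
      have "i \<noteq> 3" using i by auto
      then have x3: "update i t x $ 3 = x $ 3" by simp
      have "Z x - Z (update i t x) = exp (x $ 3) *\<^sub>R (h (base_point x) - h (base_point (update i t x)))"
        unfolding Z_prism[OF pr(1)] Z_prism[OF pr(2)] x3 by (rule scaleR_diff_right[symmetric])
      then have "norm (Z x - Z (update i t x)) = exp (x $ 3) * norm (h (base_point x) - h (base_point (update i t x)))"
        by simp
      also have "norm (h (base_point x) - h (base_point (update i t x))) \<le>
          L * norm (base_point x - base_point (update i t x))"
        by (rule h_lipschitz) (use pr base_point_in_square in blast)+
      also have "norm (base_point x - base_point (update i t x)) \<le> \<bar>x $ i - t\<bar>"
        using norm_base_point_diff_le_sum[of x "update i t x"] i by auto
      finally show ?thesis using L by (simp add: mult_left_mono mult.assoc)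
    qed
    show "\<forall>k t. \<bar>x $ i - 2 * real_of_int k\<bar> \<le> 1 \<longrightarrow> \<bar>t - 2 * real_of_int k\<bar> \<le> 1 \<longrightarrow>
      norm (Z x - Z (update i t x)) \<le> exp (x $ 3) * L * \<bar>x $ i - t\<bar>"
    proof (intro allI impI)
      fix k :: int and t :: real
      assume k: "\<bar>x $ i - 2 * real_of_int k\<bar> \<le> 1" "\<bar>t - 2 * real_of_int k\<bar> \<le> 1"
      have xi: "\<bar>x $ i\<bar> \<le> 1" using x i by auto
      have "\<bar>real_of_int k\<bar> \<le> 1" using k(1) xi by linarith
      then have "\<bar>k\<bar> \<le> 1" by linarith
      show "norm (Z x - Z (update i t x)) \<le> exp (x $ 3) * L * \<bar>x $ i - t\<bar>"
      proof (cases "k = 0")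
        case True
        then show ?thesis using base[of t] k by simp
      next
        case False
        \<comment> \<open>Then \<open>x\<close> lies on the wall between the two cells, so reflecting in it fixes \<open>x\<close>.\<close>
        then have k1: "k = 1 \<or> k = -1" using \<open>\<bar>k\<bar> \<le> 1\<close> by linarith
        then have odd: "odd k" by auto
        have xk: "x $ i = real_of_int k" using k1 k(1) xi by auto
        have fx: "reflect_plane i k x = x" using xk by (auto simp: vec_eq_iff)
        have ft: "reflect_plane i k (update i t x) = update i (2 * k - t) x" by (simp add: vec_eq_iff)
        have "norm (Z x - Z (update i t x)) = norm (Z x - Z (update i (2 * k - t) x))"
          using Z_reflect[OF i odd, of x] Z_reflect[OF i odd, of "update i t x"]
            norm_reflect_plane_diff[of 3 0 "Z x" "Z (update i t x)"] by (simp add: fx ft)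
        also have "\<dots> \<le> exp (x $ 3) * L * \<bar>x $ i - (2 * k - t)\<bar>"
          by (rule base) (use k(2) in linarith)
        finally show ?thesis using xk by (simp add: abs_minus_commute)
      qed
    qed
  qed
  show ?thesis using * k by blast
qed

text \<open>The segment is cut at the walls into finitely many intervals with a common Lipschitz
  constant. Gluing them costs nothing, however many cells the segment crosses.\<close>

lemma Z_coordinate_lipschitz:
  assumes i: "i \<in> {1, 2}"
  shows "norm (Z x - Z (update i t x)) \<le> exp (x $ 3) * L * \<bar>x $ i - t\<bar>"
proof -
  define f where "f s = Z (update i s x)" for s
  define C where "C = exp (x $ 3) * L"
  have C: "0 \<le> C" using L by (simp add: C_def)
  have i3: "i \<noteq> 3" using i by auto
  define cell where "cell k = {2 * real_of_int k - 1 .. 2 * real_of_int k + 1}" for k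
  have lip: "C-lipschitz_on (cell k) f" for k
  proof (rule lipschitz_onI[OF _ C])
    fix s r assume "s \<in> cell k" "r \<in> cell k"
    then have "norm (Z (update i s x) - Z (update i r (update i s x))) \<le>
        exp (update i s x $ 3) * L * \<bar>update i s x $ i - r\<bar>"
      by (intro Z_cell_lipschitz[OF i, where k = k]) (auto simp: cell_def)
    moreover have "update i r (update i s x) = update i r x" by (simp add: vec_eq_iff)
    ultimately show "dist (f s) (f r) \<le> C * dist s r"
      using i3 by (simp add: f_def C_def dist_norm)
  qed
  have "C-lipschitz_on {u..v} f" for u v
  proof (rule lipschitz_on_closed_Union[where I = "{\<lfloor>(u + 1) / 2\<rfloor>..\<lfloor>(v + 1) / 2\<rfloor>}" and U = cell])
    show "{u..v} \<subseteq> \<Union> (cell ` {\<lfloor>(u + 1) / 2\<rfloor>..\<lfloor>(v + 1) / 2\<rfloor>})"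
    proof
      fix s assume s: "s \<in> {u..v}"
      have "s \<in> cell \<lfloor>(s + 1) / 2\<rfloor>"
        unfolding cell_def using floor_correct[of "(s + 1) / 2"] by (simp add: field_simps)
      moreover have "\<lfloor>(s + 1) / 2\<rfloor> \<in> {\<lfloor>(u + 1) / 2\<rfloor>..\<lfloor>(v + 1) / 2\<rfloor>}"
        using s by (auto intro!: floor_mono)
      ultimately show "s \<in> \<Union> (cell ` {\<lfloor>(u + 1) / 2\<rfloor>..\<lfloor>(v + 1) / 2\<rfloor>})" by blast
    qed
  qed (use lip C in \<open>auto simp: cell_def\<close>)
  then have "dist (f (x $ i)) (f t) \<le> C * dist (x $ i) t"
    by (rule lipschitz_onD[where X = "{min (x $ i) t..max (x $ i) t}"]) auto
  moreover have "update i (x $ i) x = x" by (simp add: vec_eq_iff)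
  ultimately show ?thesis by (simp add: f_def C_def dist_norm)
qed

text \<open>The coordinates are changed one at a time, the third one last. Both lateral moves then
  happen at the height of \<open>x\<close>, which produces the factor \<open>exp (x $ 3)\<close>,
  and the vertical move is an exact dilation by \<open>Z_update_3\<close>.\<close>

lemma Z_increment:
  "norm (Z x - Z y) \<le> \<bar>exp (x $ 3) - exp (y $ 3)\<bar> + exp (x $ 3) * L * (\<bar>x $ 1 - y $ 1\<bar> + \<bar>x $ 2 - y $ 2\<bar>)"
proof -
  define x1 where "x1 = update 1 (y $ 1) x"
  define x2 where "x2 = update 2 (y $ 2) x1"
  have y: "y = update 3 (y $ 3) x2" by (simp add: x2_def x1_def vec_eq_iff forall_3)
  have 1: "norm (Z x - Z x1) \<le> exp (x $ 3) * L * \<bar>x $ 1 - y $ 1\<bar>"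
    unfolding x1_def by (rule Z_coordinate_lipschitz) simp
  have "norm (Z x1 - Z x2) \<le> exp (x1 $ 3) * L * \<bar>x1 $ 2 - y $ 2\<bar>"
    unfolding x2_def by (rule Z_coordinate_lipschitz) simp
  then have 2: "norm (Z x1 - Z x2) \<le> exp (x $ 3) * L * \<bar>x $ 2 - y $ 2\<bar>" by (simp add: x1_def)
  have "x2 $ 3 = x $ 3" by (simp add: x2_def x1_def)
  then have "Z y = exp (y $ 3 - x $ 3) *\<^sub>R Z x2" using y Z_update_3[of "y $ 3" x2] by simp
  then have "Z x2 - Z y = (1 - exp (y $ 3 - x $ 3)) *\<^sub>R Z x2" by (simp add: scaleR_diff_left)
  then have "norm (Z x2 - Z y) = \<bar>1 - exp (y $ 3 - x $ 3)\<bar> * exp (x $ 3)"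
    using norm_Z[of x2] \<open>x2 $ 3 = x $ 3\<close> by simp
  also have "\<dots> = \<bar>(1 - exp (y $ 3 - x $ 3)) * exp (x $ 3)\<bar>" by (simp add: abs_mult)
  also have "(1 - exp (y $ 3 - x $ 3)) * exp (x $ 3) = exp (x $ 3) - exp (y $ 3)"
    by (simp add: exp_diff left_diff_distrib)
  finally have 3: "norm (Z x2 - Z y) = \<bar>exp (x $ 3) - exp (y $ 3)\<bar>" .
  have "norm (Z x - Z y) \<le> norm (Z x - Z x1) + norm (Z x1 - Z x2) + norm (Z x2 - Z y)"
    using norm_triangle_ineq[of "Z x - Z x1" "Z x1 - Z x2"] norm_triangle_ineq[of "Z x - Z x2" "Z x2 - Z y"]
    by simp
  then show ?thesis using 1 2 3 by (simp add: distrib_left)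
qed


text \<open>Relative to the scale \<open>exp (x $ 3)\<close>, the stretching away from the walls
  lies between 1 / (3 + 2 * L) and 3 + 2 * L; this is the ratio of the two. In the upper bound, 3
  comes from the exponential and 2 * L from the two lateral directions.\<close>

definition "Z_distortion = (3 + 2 * L)\<^sup>2"

lemma Z_upper_bound:
  assumes "\<bar>x $ 3 - y $ 3\<bar> \<le> 1"
  shows "norm (Z y - Z x) \<le> (3 + 2 * L) * exp (x $ 3) * norm (y - x)"
proof -
  have "exp (y $ 3) - exp (x $ 3) = exp (x $ 3) * (exp (y $ 3 - x $ 3) - 1)"
    by (simp add: exp_diff right_diff_distrib)
  then have "\<bar>exp (x $ 3) - exp (y $ 3)\<bar> = exp (x $ 3) * \<bar>exp (y $ 3 - x $ 3) - 1\<bar>"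
    by (metis abs_exp_cancel abs_minus_commute abs_mult)
  also have "\<dots> \<le> exp (x $ 3) * (3 * \<bar>y $ 3 - x $ 3\<bar>)"
    using assms by (intro mult_left_mono abs_exp_minus_1_bounds) auto
  finally have 1: "\<bar>exp (x $ 3) - exp (y $ 3)\<bar> \<le> exp (x $ 3) * (3 * \<bar>y $ 3 - x $ 3\<bar>)" .
  have c: "\<bar>x $ i - y $ i\<bar> \<le> norm (y - x)" for i
    using component_le_norm_cart[of "y - x" i] by (simp add: abs_minus_commute)
  have "exp (x $ 3) * (3 * \<bar>y $ 3 - x $ 3\<bar>) \<le> exp (x $ 3) * (3 * norm (y - x))"
    using c[of 3] by (simp add: abs_minus_commute)
  moreover have "exp (x $ 3) * L * (\<bar>x $ 1 - y $ 1\<bar> + \<bar>x $ 2 - y $ 2\<bar>) \<le> exp (x $ 3) * L * (2 * norm (y - x))"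
    using c[of 1] c[of 2] L by (intro mult_left_mono) auto
  moreover have "(3 + 2 * L) * exp (x $ 3) * norm (y - x) =
      exp (x $ 3) * (3 * norm (y - x)) + exp (x $ 3) * L * (2 * norm (y - x))"
    by (simp add: algebra_simps)
  ultimately show ?thesis using 1 Z_increment[of x y] norm_minus_commute[of "Z x" "Z y"] by argo
qed

lemma Z_radial_expanding: "\<bar>exp (x $ 3) - exp (y $ 3)\<bar> \<le> norm (Z x - Z y)"
  using norm_triangle_ineq3[of "Z x" "Z y"] by (simp add: norm_Z)

text \<open>Moving \<open>Z y\<close> radially onto the sphere through \<open>Z x\<close> leaves a
  pure difference of values of \<open>h\<close>. The radial move costs at most
  \<open>norm (Z x - Z y)\<close> once more, hence the factor 2.\<close>

lemma Z_prism_expanding: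
  assumes "x \<in> prism" "y \<in> prism"
  shows "exp (x $ 3) * norm (base_point x - base_point y) \<le> 2 * L * norm (Z x - Z y)"
proof -
  let ?a = "base_point x" and ?b = "base_point y"
  have sq: "?a \<in> square" "?b \<in> square" using assms by (simp_all add: base_point_in_square)
  have "exp (x $ 3) *\<^sub>R (h ?a - h ?b) = (Z x - Z y) - (exp (x $ 3) - exp (y $ 3)) *\<^sub>R h ?b"
    using assms by (simp add: Z_prism algebra_simps)
  then have "exp (x $ 3) * norm (h ?a - h ?b) = norm ((Z x - Z y) - (exp (x $ 3) - exp (y $ 3)) *\<^sub>R h ?b)"
    by (metis abs_exp_cancel norm_scaleR)
  also have "\<dots> \<le> norm (Z x - Z y) + \<bar>exp (x $ 3) - exp (y $ 3)\<bar>"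
    by (rule order_trans[OF norm_triangle_ineq4]) (simp add: norm_h sq)
  also have "\<dots> \<le> 2 * norm (Z x - Z y)" using Z_radial_expanding[of x y] by simp
  finally have "exp (x $ 3) * norm (h ?a - h ?b) \<le> 2 * norm (Z x - Z y)" .
  then have 1: "L * (exp (x $ 3) * norm (h ?a - h ?b)) \<le> L * (2 * norm (Z x - Z y))"
    using L by (intro mult_left_mono) auto
  have "exp (x $ 3) * norm (?a - ?b) \<le> exp (x $ 3) * (L * norm (h ?a - h ?b))"
    by (intro mult_left_mono h_expanding sq) auto
  also have "\<dots> = L * (exp (x $ 3) * norm (h ?a - h ?b))" by (rule mult.left_commute)
  also note 1
  finally show ?thesis by (simp only: mult_ac)
qed

text \<open>Within one prism the radial and the lateral expansion add up. For this the ball must not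
  cross a wall, hence the excluded odd integers and a \<open>\<delta>\<close> that depends on the
  point.\<close>

lemma Z_lower_bound:
  assumes "\<And>i n. i \<in> {1, 2} \<Longrightarrow> odd n \<Longrightarrow> x $ i \<noteq> real_of_int n"
  shows "\<exists>\<delta>>0. \<forall>y\<in>ball x \<delta>. exp (x $ 3) * norm (y - x) \<le> (3 + 2 * L) * norm (Z y - Z x)"
proof -
  have "(\<forall>i\<in>{1, 2}. \<forall>n. odd n \<longrightarrow> x $ i \<noteq> real_of_int n) \<longrightarrow>
    (\<exists>\<delta>>0. \<forall>y\<in>ball x \<delta>. exp (x $ 3) * norm (y - x) \<le> (3 + 2 * L) * norm (Z y - Z x))"
  proof (rule prism_reflection_induct[of _ x])
    fix x :: "real^3" and i :: 3 and n :: int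
    assume i: "i \<in> {1, 2}" and n: "odd n"
      and IH: "(\<forall>j\<in>{1, 2}. \<forall>m. odd m \<longrightarrow> reflect_plane i n x $ j \<noteq> real_of_int m) \<longrightarrow>
        (\<exists>\<delta>>0. \<forall>y\<in>ball (reflect_plane i n x) \<delta>. exp (reflect_plane i n x $ 3) * norm (y - reflect_plane i n x) \<le>
            (3 + 2 * L) * norm (Z y - Z (reflect_plane i n x)))"
    show "(\<forall>i\<in>{1, 2}. \<forall>n. odd n \<longrightarrow> x $ i \<noteq> real_of_int n) \<longrightarrow>
      (\<exists>\<delta>>0. \<forall>y\<in>ball x \<delta>. exp (x $ 3) * norm (y - x) \<le> (3 + 2 * L) * norm (Z y - Z x))"
    proof
      assume nw: "\<forall>i\<in>{1, 2}. \<forall>n. odd n \<longrightarrow> x $ i \<noteq> real_of_int n"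
      have "\<forall>j\<in>{1, 2}. \<forall>m. odd m \<longrightarrow> reflect_plane i n x $ j \<noteq> real_of_int m"
      proof (intro ballI allI impI)
        fix j :: 3 and m :: int assume j: "j \<in> {1, 2}" "odd m"
        have "odd (2 * n - m)" using j by simp
        then have "x $ i \<noteq> real_of_int (2 * n - m)" using nw i by blast
        then show "reflect_plane i n x $ j \<noteq> real_of_int m" using nw j by auto
      qed
      then obtain \<delta> where \<delta>: "\<delta> > 0" "\<And>y. y \<in> ball (reflect_plane i n x) \<delta> \<Longrightarrow>
          exp (reflect_plane i n x $ 3) * norm (y - reflect_plane i n x) \<le> (3 + 2 * L) * norm (Z y - Z (reflect_plane i n x))"
        using IH by blast
      have "exp (x $ 3) * norm (y - x) \<le> (3 + 2 * L) * norm (Z y - Z x)" if "y \<in> ball x \<delta>" for y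
      proof -
        have "reflect_plane i n y \<in> ball (reflect_plane i n x) \<delta>" using that by (simp add: dist_norm)
        from \<delta>(2)[OF this] show ?thesis
          using i unfolding Z_reflect[OF i n] norm_reflect_plane_diff by auto
      qed
      with \<delta>(1) show "\<exists>\<delta>>0. \<forall>y\<in>ball x \<delta>. exp (x $ 3) * norm (y - x) \<le> (3 + 2 * L) * norm (Z y - Z x)" by blast
    qed
  next
    fix x :: "real^3" assume x: "\<bar>x $ 1\<bar> \<le> 1" "\<bar>x $ 2\<bar> \<le> 1"
    show "(\<forall>i\<in>{1, 2}. \<forall>n. odd n \<longrightarrow> x $ i \<noteq> real_of_int n) \<longrightarrow>
      (\<exists>\<delta>>0. \<forall>y\<in>ball x \<delta>. exp (x $ 3) * norm (y - x) \<le> (3 + 2 * L) * norm (Z y - Z x))"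
    proof
      assume nw: "\<forall>i\<in>{1, 2}. \<forall>n. odd n \<longrightarrow> x $ i \<noteq> real_of_int n"
      have "\<bar>x $ i\<bar> \<noteq> 1" if "i \<in> {1, 2}" for i
        using nw[rule_format, OF that, of 1] nw[rule_format, OF that, of "-1"] by auto
      then have x1: "\<bar>x $ 1\<bar> < 1" "\<bar>x $ 2\<bar> < 1" using x by (metis insertCI order_le_less)+
      define \<delta> where "\<delta> = min 1 (min (1 - \<bar>x $ 1\<bar>) (1 - \<bar>x $ 2\<bar>))"
      have \<delta>: "0 < \<delta>" using x1 by (simp add: \<delta>_def)
      have "exp (x $ 3) * norm (y - x) \<le> (3 + 2 * L) * norm (Z y - Z x)" if "y \<in> ball x \<delta>" for y
      proof -
        have c: "\<bar>x $ i - y $ i\<bar> < \<delta>" for i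
          using component_le_norm_cart[of "x - y" i] that by (simp add: dist_norm)
        have "\<delta> \<le> 1 - \<bar>x $ 1\<bar>" "\<delta> \<le> 1 - \<bar>x $ 2\<bar>" by (simp_all add: \<delta>_def)
        then have "\<bar>y $ 1\<bar> \<le> 1" "\<bar>y $ 2\<bar> \<le> 1" using c[of 1] c[of 2] by linarith+
        then have pr: "x \<in> prism" "y \<in> prism" using x by (simp_all add: prism_def)
        have t: "\<bar>y $ 3 - x $ 3\<bar> \<le> 1" proof -
          have "\<delta> \<le> 1" by (simp add: \<delta>_def)
          then show ?thesis using c[of 3] by linarith
        qed
        have "exp (y $ 3) - exp (x $ 3) = exp (x $ 3) * (exp (y $ 3 - x $ 3) - 1)"
          by (simp add: exp_diff right_diff_distrib)
        then have "\<bar>exp (x $ 3) - exp (y $ 3)\<bar> = exp (x $ 3) * \<bar>exp (y $ 3 - x $ 3) - 1\<bar>"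
          by (metis abs_exp_cancel abs_minus_commute abs_mult)
        moreover have "exp (x $ 3) * \<bar>y $ 3 - x $ 3\<bar> \<le> exp (x $ 3) * (3 * \<bar>exp (y $ 3 - x $ 3) - 1\<bar>)"
          by (intro mult_left_mono abs_exp_minus_1_bounds t) auto
        moreover have "exp (x $ 3) * (3 * \<bar>exp (y $ 3 - x $ 3) - 1\<bar>) = 3 * (exp (x $ 3) * \<bar>exp (y $ 3 - x $ 3) - 1\<bar>)"
          by (rule mult.left_commute)
        ultimately have 1: "exp (x $ 3) * \<bar>x $ 3 - y $ 3\<bar> \<le> 3 * norm (Z x - Z y)"
          using Z_radial_expanding[of x y] unfolding abs_minus_commute[of "x $ 3" "y $ 3"] by linarith
        have "exp (x $ 3) * norm (x - y) \<le> exp (x $ 3) * (norm (base_point x - base_point y) + \<bar>x $ 3 - y $ 3\<bar>)"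
          by (intro mult_left_mono norm_le_base_point_plus) auto
        then show ?thesis using 1 Z_prism_expanding[OF pr]
          by (simp add: norm_minus_commute algebra_simps)
      qed
      with \<delta> show "\<exists>\<delta>>0. \<forall>y\<in>ball x \<delta>. exp (x $ 3) * norm (y - x) \<le> (3 + 2 * L) * norm (Z y - Z x)" by blast
    qed
  qed
  then show ?thesis using assms by blast
qed

text \<open>Off the countably many walls the metric bounds hold locally, and orientation supplies
  differentiability and the sign of the Jacobian almost everywhere.\<close>

lemma Z_not_qc: "negligible {x. \<not> qc_at Z_distortion Z x}"
proof -
  let ?D = "{x. \<not> (Z differentiable (at x) \<and> 0 < det (matrix (frechet_derivative Z (at x))))}"
  define W where "W n = {x::real^3. x $ 1 = real_of_int n} \<union> {x. x $ 2 = real_of_int n}" for n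
  have "?D \<in> null_sets lebesgue"
    using Z_orientation unfolding orientation_preserving_def completion.AE_iff_null_sets by simp
  then have D: "negligible ?D" by (simp add: negligible_iff_null_sets)
  have "negligible (\<Union> (range W))"
  proof (rule negligible_countable_Union)
    fix S assume "S \<in> range W"
    then obtain n where "S = W n" by blast
    then show "negligible S"
      by (simp only: W_def) (intro negligible_Un negligible_coordinate_hyperplane)
  qed simp
  then have "negligible (?D \<union> \<Union> (range W))" using D by (rule negligible_Un[rotated])
  then show ?thesis
  proof (rule negligible_subset)
    show "{x. \<not> qc_at Z_distortion Z x} \<subseteq> ?D \<union> \<Union> (range W)"
    proof (intro subsetI, rule ccontr)
      fix x assume x: "x \<in> {x. \<not> qc_at Z_distortion Z x}" and nx: "x \<notin> ?D \<union> \<Union> (range W)"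
      have "x $ i \<noteq> real_of_int n" if "i \<in> {1, 2}" for i n
        using nx that by (auto simp: W_def)
      then obtain \<delta> where \<delta>: "\<delta> > 0" "\<And>y. y \<in> ball x \<delta> \<Longrightarrow> exp (x $ 3) * norm (y - x) \<le> (3 + 2 * L) * norm (Z y - Z x)"
        using Z_lower_bound[of x] by blast
      have c: "0 < 3 + 2 * L" using L by simp
      have "qc_at Z_distortion Z x"
      proof (rule qc_at_of_local_bounds[where a = "exp (x $ 3) / (3 + 2 * L)" and \<delta> = "min 1 \<delta>"])
        fix y assume y: "y \<in> ball x (min 1 \<delta>)"
        then have "\<bar>x $ 3 - y $ 3\<bar> \<le> 1"
          using component_le_norm_cart[of "x - y" 3] by (simp add: dist_norm)
        then have "norm (Z y - Z x) \<le> (3 + 2 * L) * exp (x $ 3) * norm (y - x)" by (rule Z_upper_bound)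
        moreover have "Z_distortion * (exp (x $ 3) / (3 + 2 * L)) = (3 + 2 * L) * exp (x $ 3)"
          using c by (simp add: Z_distortion_def power2_eq_square)
        moreover have "exp (x $ 3) / (3 + 2 * L) * norm (y - x) \<le> norm (Z y - Z x)"
          using \<delta>(2)[of y] y c by (simp add: pos_divide_le_eq mult.commute)
        ultimately show "exp (x $ 3) / (3 + 2 * L) * norm (y - x) \<le> norm (Z y - Z x) \<and>
          norm (Z y - Z x) \<le> Z_distortion * (exp (x $ 3) / (3 + 2 * L)) * norm (y - x)" by presburger
      qed (use nx \<delta>(1) c in auto)
      then show False using x by simp
    qed
  qed
qed

section \<open>Walls, the equator and the inverse branch over the upper half space\<close>

lemma Z_wall:
  assumes "i \<in> {1, 2}" "\<bar>x $ i\<bar> = 1"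
  shows "Z x $ 3 = 0"
proof -
  obtain n :: int where n: "odd n" "x $ i = real_of_int n"
  proof (cases "x $ i = 1")
    case True
    then show ?thesis using that[of 1] by simp
  next
    case False
    then show ?thesis using that[of "-1"] assms(2) by auto
  qed
  then have "reflect_plane i (real_of_int n) x = x" by (auto simp: vec_eq_iff)
  then have "Z x = reflect_plane 3 0 (Z x)" using Z_reflect[OF assms(1) n(1), of x] by simp
  then have "Z x $ 3 = reflect_plane 3 0 (Z x) $ 3" by simp
  then show ?thesis by simp
qed

text \<open>Projected to the equatorial plane, \<open>h\<close> stays injective, because a
  nonnegative third coordinate is determined by the other two and the norm 1. By invariance of
  domain the image of the open square is open; contained in the closed disc, it lies in the open
  disc, so the equator is not reached. Hence the equator comes from the walls only.\<close>

lemma h_interior_3_pos: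
  assumes a: "\<bar>a $ 1\<bar> < 1" "\<bar>a $ 2\<bar> < 1"
  shows "0 < h a $ 3"
proof -
  define S where "S = {a::real^2. \<bar>a $ 1\<bar> < 1 \<and> \<bar>a $ 2\<bar> < 1}"
  have Ssq: "S \<subseteq> square" by (auto simp: S_def square_def)
  have opS: "open S"
    unfolding S_def by (intro open_Collect_conj open_Collect_less continuous_intros)
  define k where "k a = base_point (h a)" for a
  have nk: "(norm (k a))\<^sup>2 + (h a $ 3)\<^sup>2 = 1" if "a \<in> square" for a
    using norm_h[OF that] norm_sq_3[of "h a"] by (simp add: k_def norm_sq_2)
  have inj: "inj_on k S"
  proof (rule inj_onI)
    fix a b assume ab: "a \<in> S" "b \<in> S" "k a = k b"
    have sq: "a \<in> square" "b \<in> square" using ab Ssq by auto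
    have "(h a $ 3)\<^sup>2 = (h b $ 3)\<^sup>2" using nk[OF sq(1)] nk[OF sq(2)] ab(3) by simp
    then have "h a $ 3 = h b $ 3" using h_3_nonneg sq by (simp add: power2_eq_iff_nonneg)
    moreover have "h a $ 1 = h b $ 1" "h a $ 2 = h b $ 2"
      using ab(3) by (metis k_def vector_2)+
    ultimately have "h a = h b" by (simp add: vec_eq_iff forall_3)
    then show "a = b" using h_inj sq by (simp add: inj_on_eq_iff)
  qed
  have cont: "continuous_on S k"
  proof (rule lipschitz_on_continuous_on, rule lipschitz_onI)
    fix a b assume "a \<in> S" "b \<in> S"
    then show "dist (k a) (k b) \<le> L * dist a b"
      using order_trans[OF norm_base_point_diff_le[of "h a" "h b"] h_lipschitz[of a b]] Ssq
      by (auto simp: k_def dist_norm)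
  qed (use L in simp)
  have op: "open (k ` S)" by (rule invariance_of_domain[OF cont opS inj])
  have "norm (k a) \<le> 1" if "a \<in> S" for a
  proof -
    have "(norm (k a))\<^sup>2 + (h a $ 3)\<^sup>2 = 1" by (rule nk) (use that Ssq in blast)
    moreover have "0 \<le> (h a $ 3)\<^sup>2" by simp
    ultimately have "(norm (k a))\<^sup>2 \<le> 1\<^sup>2" unfolding one_power2 by linarith
    then show ?thesis by (rule power2_le_imp_le) simp
  qed
  then have "k ` S \<subseteq> cball 0 1" by auto
  then have "k ` S \<subseteq> interior (cball 0 1)" using op by (rule interior_maximal)
  moreover have aS: "a \<in> S" using a by (simp add: S_def)
  ultimately have "norm (k a) < 1" by (auto simp: interior_cball)
  then have "(norm (k a))\<^sup>2 < 1" by (simp add: abs_square_less_1)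
  then have "h a $ 3 \<noteq> 0" using nk[of a] aS Ssq by auto
  moreover have "0 \<le> h a $ 3" using h_3_nonneg aS Ssq by blast
  ultimately show ?thesis by simp
qed

text \<open>The inverse branch of \<open>Z\<close> with values in the prism. It is meaningful for
  nonzero \<open>w\<close> with nonnegative third coordinate; elsewhere \<open>inv_into\<close>
  returns an arbitrary value.\<close>

definition zinv :: "real^3 \<Rightarrow> real^3" where
  "zinv w = (let a = inv_into square h (w /\<^sub>R norm w) in vector [a $ 1, a $ 2, ln (norm w)])"

lemma zinv_3 [simp]: "zinv w $ 3 = ln (norm w)"
  by (simp add: zinv_def Let_def)

lemma zinv:
  assumes "w \<noteq> 0" "0 \<le> w $ 3"
  shows "zinv w \<in> prism" "Z (zinv w) = w"
proof -
  have "w /\<^sub>R norm w \<in> h ` square"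
    using assms by (simp add: h_image upper_hemisphere_def)
  then have a: "inv_into square h (w /\<^sub>R norm w) \<in> square"
    "h (inv_into square h (w /\<^sub>R norm w)) = w /\<^sub>R norm w"
    by (auto intro: inv_into_into f_inv_into_f)
  have b: "base_point (zinv w) = inv_into square h (w /\<^sub>R norm w)"
    by (simp add: zinv_def Let_def vec_eq_iff forall_2)
  show pr: "zinv w \<in> prism" using a(1) by (simp add: base_point_in_square[symmetric] b)
  show "Z (zinv w) = w" using assms(1) by (simp add: Z_prism[OF pr] b a(2))
qed

lemma Z_inj_prism:
  assumes "x \<in> prism" "y \<in> prism" "Z x = Z y"
  shows "x = y"
proof -
  have "x $ 3 = y $ 3" using assms(3) norm_Z[of x] norm_Z[of y] by simp
  moreover have "exp (x $ 3) * norm (base_point x - base_point y) \<le> 0"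
    using Z_prism_expanding[OF assms(1,2)] assms(3) by simp
  then have "norm (base_point x - base_point y) \<le> 0" by (simp add: mult_le_0_iff)
  ultimately have "norm (x - y) \<le> 0" using norm_le_base_point_plus[of x y] by simp
  then show ?thesis by simp
qed

lemma Z_3_nonneg: "x \<in> prism \<Longrightarrow> 0 \<le> Z x $ 3"
  by (simp add: Z_prism h_3_nonneg base_point_in_square)

lemma zinv_Z: "x \<in> prism \<Longrightarrow> zinv (Z x) = x"
  by (rule Z_inj_prism) (auto simp: zinv Z_nonzero Z_3_nonneg)

lemma zinv_base_point_lipschitz:
  assumes "v \<noteq> 0" "0 \<le> v $ 3" "w \<noteq> 0" "0 \<le> w $ 3"
  shows "norm v * norm (base_point (zinv v) - base_point (zinv w)) \<le> 2 * L * norm (v - w)"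
  using Z_prism_expanding[OF zinv(1) zinv(1), of v w] assms by (simp add: zinv)

lemma zinv_equator:
  assumes "w \<noteq> 0" "w $ 3 = 0"
  shows "\<bar>zinv w $ 1\<bar> = 1 \<or> \<bar>zinv w $ 2\<bar> = 1"
proof (rule ccontr)
  assume *: "\<not> ?thesis"
  have w: "w \<noteq> 0" "0 \<le> w $ 3" using assms by auto
  then have "0 < h (base_point (zinv w)) $ 3"
    using zinv(1)[OF w] * by (intro h_interior_3_pos) (auto simp: prism_def order_le_less)
  then have "0 < Z (zinv w) $ 3" by (simp add: Z_prism zinv(1)[OF w])
  then show False using zinv(2)[OF w] assms by simp
qed

text \<open>This is the continuity from which \<open>qc_at_inverse\<close> obtains differentiability
  of the branch. The lateral coordinates are controlled by \<open>zinv_base_point_lipschitz\<close>,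
  and the third one is a logarithm.\<close>

lemma isCont_zinv:
  assumes w: "0 < w $ 3"
  shows "isCont zinv w"
proof -
  have w0: "w \<noteq> 0" using w by auto
  have "\<forall>\<^sub>F v in at w. 0 < v $ 3"
    using w by (intro order_tendstoD(1)[of "\<lambda>v. v $ 3" "w $ 3"] tendsto_intros) auto
  then have ev: "\<forall>\<^sub>F v in at w. norm (zinv v - zinv w) \<le> 2 * L * norm (w - v) / norm w + \<bar>ln (norm v) - ln (norm w)\<bar>"
  proof eventually_elim
    case (elim v)
    then have v: "v \<noteq> 0" "0 \<le> v $ 3" by auto
    have "norm w * norm (base_point (zinv w) - base_point (zinv v)) \<le> 2 * L * norm (w - v)"
      by (rule zinv_base_point_lipschitz[OF w0 _ v]) (use w in simp)
    then have "norm (base_point (zinv w) - base_point (zinv v)) \<le> 2 * L * norm (w - v) / norm w"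
      using w0 by (simp add: pos_le_divide_eq mult.commute[of "norm w"])
    then show ?case
      using norm_le_base_point_plus[of "zinv v" "zinv w"]
        norm_minus_commute[of "base_point (zinv w)" "base_point (zinv v)"] by simp
  qed
  have "((\<lambda>v. 2 * L * norm (w - v) / norm w + \<bar>ln (norm v) - ln (norm w)\<bar>) \<longlongrightarrow>
      2 * L * norm (w - w) / norm w + \<bar>ln (norm w) - ln (norm w)\<bar>) (at w)"
    by (intro tendsto_intros) (use w0 in simp_all)
  then have "((\<lambda>v. 2 * L * norm (w - v) / norm w + \<bar>ln (norm v) - ln (norm w)\<bar>) \<longlongrightarrow> 0) (at w)"
    by simp
  with ev have "((\<lambda>v. zinv v - zinv w) \<longlongrightarrow> 0) (at w)" by (rule Lim_null_comparison)
  then show ?thesis unfolding isCont_def by (rule LIM_zero_cancel)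
qed

section \<open>Maps induced through the Zorich map\<close>


text \<open>Factors \<open>T\<close> through \<open>Z\<close> on the prism, with \<open>zinv\<close>
  as a section over the upper half space and a reflection for the lower one. The origin, which
  \<open>Z\<close> omits, gets the value that the power maps have there.\<close>

definition descend :: "(real^3 \<Rightarrow> real^3) \<Rightarrow> real^3 \<Rightarrow> real^3" where
  "descend T w = (if w = 0 then 0 else reflect_extension (\<lambda>v. T (zinv v)) w)"

lemma descend_Z: "x \<in> prism \<Longrightarrow> descend T (Z x) = T x"
  by (simp add: descend_def reflect_extension_def Z_nonzero Z_3_nonneg zinv_Z)

lemma descend_upper: "w \<noteq> 0 \<Longrightarrow> 0 \<le> w $ 3 \<Longrightarrow> descend T w = T (zinv w)"
  by (simp add: descend_def reflect_extension_def)

lemma reflect_plane_0_eq_0_iff [simp]: "reflect_plane i 0 w = 0 \<longleftrightarrow> w = 0"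
  using norm_reflect_plane_0[of i w] by (metis norm_eq_zero)

lemma descend_lower:
  "w \<noteq> 0 \<Longrightarrow> w $ 3 < 0 \<Longrightarrow> descend T w = reflect_plane 3 0 (T (zinv (reflect_plane 3 0 w)))"
  by (simp add: descend_def reflect_extension_def)

text \<open>The nearby point of the plane must keep the norm of \<open>v\<close>, since the
  estimates to which it is applied hold in a spherical shell only; orthogonal projection could leave
  the shell. The horizontal and the vertical displacement are each at most
  \<open>v $ 3\<close>.\<close>

lemma equatorial_projection:
  fixes v :: "real^3"
  assumes "v \<noteq> 0" "0 \<le> v $ 3"
  obtains u where "u $ 3 = 0" "norm u = norm v" "norm (v - u) \<le> 2 * v $ 3"
proof -
  define \<rho> where "\<rho> = norm (base_point v)"
  have \<rho>2: "\<rho>\<^sup>2 = (v $ 1)\<^sup>2 + (v $ 2)\<^sup>2" by (simp add: \<rho>_def norm_sq_2)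
  have nv: "(norm v)\<^sup>2 = \<rho>\<^sup>2 + (v $ 3)\<^sup>2" by (simp add: \<rho>2 norm_sq_3)
  have \<rho>0: "0 \<le> \<rho>" by (simp add: \<rho>_def)
  show ?thesis
  proof (cases "\<rho> = 0")
    case True
    then have v12: "v $ 1 = 0" "v $ 2 = 0" using \<rho>2 by (simp_all add: sum_power2_eq_zero_iff)
    define u :: "real^3" where "u = vector [v $ 3, 0, 0]"
    have u: "u $ 1 = v $ 3" "u $ 2 = 0" "u $ 3 = 0" by (simp_all add: u_def)
    have "(norm u)\<^sup>2 = (norm v)\<^sup>2" unfolding norm_sq_3 by (simp add: u v12)
    then have "norm u = norm v" by (simp add: power2_eq_iff_nonneg)
    moreover have "(norm (v - u))\<^sup>2 \<le> (2 * v $ 3)\<^sup>2"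
      unfolding norm_sq_3 by (simp add: u v12 power2_eq_square)
    then have "norm (v - u) \<le> 2 * v $ 3" by (rule power2_le_imp_le) (use assms in simp)
    ultimately show ?thesis using u that by blast
  next
    case False
    then have \<rho>: "0 < \<rho>" using \<rho>0 by simp
    define c where "c = norm v / \<rho>"
    define u :: "real^3" where "u = vector [c * v $ 1, c * v $ 2, 0]"
    have u: "u $ 1 = c * v $ 1" "u $ 2 = c * v $ 2" "u $ 3 = 0" by (simp_all add: u_def)
    have "(norm u)\<^sup>2 = c\<^sup>2 * \<rho>\<^sup>2" unfolding norm_sq_3 \<rho>2 by (simp add: u power_mult_distrib distrib_left)
    also have "\<dots> = (norm v)\<^sup>2" using \<rho> by (simp add: c_def power_divide)
    finally have "norm u = norm v" by (simp add: power2_eq_iff_nonneg)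
    moreover have "norm (v - u) \<le> 2 * v $ 3"
    proof (rule power2_le_imp_le)
      have "norm v \<le> \<rho> + v $ 3"
      proof (rule power2_le_imp_le)
        show "(norm v)\<^sup>2 \<le> (\<rho> + v $ 3)\<^sup>2" using \<rho> assms(2) unfolding nv power2_sum by simp
      qed (use \<rho> assms in simp)
      moreover have "\<rho> \<le> norm v" by (rule power2_le_imp_le) (simp_all add: nv)
      ultimately have "(norm v - \<rho>)\<^sup>2 \<le> (v $ 3)\<^sup>2" by (intro power_mono) auto
      have "(norm (v - u))\<^sup>2 = (1 - c)\<^sup>2 * \<rho>\<^sup>2 + (v $ 3)\<^sup>2"
        unfolding norm_sq_3 \<rho>2 by (simp add: u algebra_simps power2_eq_square)
      also have "(1 - c)\<^sup>2 * \<rho>\<^sup>2 = (norm v - \<rho>)\<^sup>2"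
        using \<rho> by (simp add: c_def power_mult_distrib[symmetric] left_diff_distrib power2_commute)
      also have "\<dots> \<le> (v $ 3)\<^sup>2" by fact
      finally have "(norm (v - u))\<^sup>2 \<le> (v $ 3)\<^sup>2 + (v $ 3)\<^sup>2" by simp
      also have "\<dots> \<le> (2 * v $ 3)\<^sup>2" by (simp add: power2_eq_square)
      finally show "(norm (v - u))\<^sup>2 \<le> (2 * v $ 3)\<^sup>2" .
    qed (use assms in simp)
    ultimately show ?thesis using u that by blast
  qed
qed

text \<open>The form of \<open>est\<close> comes from \<open>exp (x $ 3)\<close> being the norm of
  \<open>Z x\<close>: the difference of exponentials is a radial distance, and the weighted lateral
  term is bounded through \<open>zinv_base_point_lipschitz\<close>; together they give
  \<open>1 + 4 * L\<close>. Moving to the equator, where the image is flat, costs a factor 2 and the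
  reflection a factor 3; hence 6.\<close>

lemma descend_lipschitz:
  assumes C: "0 \<le> C"
    and est: "\<And>x y. x \<in> prism \<Longrightarrow> y \<in> prism \<Longrightarrow> x $ 3 \<in> I \<Longrightarrow> y $ 3 \<in> I \<Longrightarrow>
      norm (T x - T y) \<le> C * (\<bar>exp (x $ 3) - exp (y $ 3)\<bar> +
        exp (x $ 3) * (\<bar>x $ 1 - y $ 1\<bar> + \<bar>x $ 2 - y $ 2\<bar>))"
    and flat: "\<And>x. x \<in> prism \<Longrightarrow> x $ 3 \<in> I \<Longrightarrow> \<bar>x $ 1\<bar> = 1 \<or> \<bar>x $ 2\<bar> = 1 \<Longrightarrow> T x $ 3 = 0"
    and vw: "v \<noteq> 0" "ln (norm v) \<in> I" "w \<noteq> 0" "ln (norm w) \<in> I"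
  shows "norm (descend T v - descend T w) \<le> 6 * C * (1 + 4 * L) * norm (v - w)"
proof -
  define V where "V = {w::real^3. w \<noteq> 0 \<and> ln (norm w) \<in> I}"
  define C' where "C' = C * (1 + 4 * L)"
  have C': "0 \<le> C'" using C L by (simp add: C'_def)
  have lip: "norm (T (zinv v) - T (zinv w)) \<le> C' * norm (v - w)"
    if "v \<in> V" "w \<in> V" "0 \<le> v $ 3" "0 \<le> w $ 3" for v w
  proof -
    have v: "v \<noteq> 0" "ln (norm v) \<in> I" and w: "w \<noteq> 0" "ln (norm w) \<in> I" using that by (auto simp: V_def)
    define x where "x = zinv v"
    define y where "y = zinv w"
    have x: "x \<in> prism" "x $ 3 = ln (norm v)" "exp (x $ 3) = norm v" using v that by (auto simp: x_def zinv)
    have y: "y \<in> prism" "y $ 3 = ln (norm w)" "exp (y $ 3) = norm w" using w that by (auto simp: y_def zinv)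
    have c: "\<bar>x $ i - y $ i\<bar> \<le> norm (base_point x - base_point y)" if "i \<in> {1, 2}" for i
      using that component_le_norm_cart[of "base_point x - base_point y" 1]
        component_le_norm_cart[of "base_point x - base_point y" 2] by auto
    have "exp (x $ 3) * (\<bar>x $ 1 - y $ 1\<bar> + \<bar>x $ 2 - y $ 2\<bar>) \<le> exp (x $ 3) * (2 * norm (base_point x - base_point y))"
      using c[of 1] c[of 2] by (intro mult_left_mono) auto
    also have "\<dots> = 2 * (norm v * norm (base_point x - base_point y))" unfolding x(3) by (rule mult.left_commute)
    also have "\<dots> \<le> 2 * (2 * L * norm (v - w))"
      unfolding x_def y_def using v w that by (intro mult_left_mono zinv_base_point_lipschitz) auto
    finally have 1: "exp (x $ 3) * (\<bar>x $ 1 - y $ 1\<bar> + \<bar>x $ 2 - y $ 2\<bar>) \<le> 4 * L * norm (v - w)" by simp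
    have 2: "\<bar>exp (x $ 3) - exp (y $ 3)\<bar> \<le> norm (v - w)"
      unfolding x(3) y(3) by (rule norm_triangle_ineq3)
    have "norm (T x - T y) \<le> C * (\<bar>exp (x $ 3) - exp (y $ 3)\<bar> +
        exp (x $ 3) * (\<bar>x $ 1 - y $ 1\<bar> + \<bar>x $ 2 - y $ 2\<bar>))"
      by (rule est) (use x y v w in simp_all)
    also have "\<dots> \<le> C * (norm (v - w) + 4 * L * norm (v - w))"
      using 1 2 C by (intro mult_left_mono add_mono) auto
    finally show ?thesis by (simp add: x_def y_def C'_def algebra_simps)
  qed
  have "norm (reflect_extension (\<lambda>v. T (zinv v)) v - reflect_extension (\<lambda>v. T (zinv v)) w) \<le>
      (3 * (2 * C')) * norm (v - w)"
  proof (rule reflect_extension_lipschitz[where V = V])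
    fix v w assume "v \<in> V" "w \<in> V" "0 \<le> v $ 3" "0 \<le> w $ 3"
    then have "norm (T (zinv v) - T (zinv w)) \<le> C' * norm (v - w)" by (rule lip)
    also have "\<dots> \<le> 2 * C' * norm (v - w)" using C' by (intro mult_right_mono) auto
    finally show "norm (T (zinv v) - T (zinv w)) \<le> 2 * C' * norm (v - w)" .
  next
    fix v assume v: "v \<in> V" "0 \<le> v $ 3"
    then have v0: "v \<noteq> 0" by (simp add: V_def)
    obtain u where u: "u $ 3 = 0" "norm u = norm v" "norm (v - u) \<le> 2 * v $ 3"
      using equatorial_projection[OF v0 v(2)] by blast
    have u0: "u \<noteq> 0" using u(2) v0 by auto
    then have uV: "u \<in> V" using u v by (simp add: V_def)
    have "T (zinv u) $ 3 = 0"
      using uV u(1) by (intro flat zinv_equator zinv) (auto simp: V_def)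
    then have "\<bar>T (zinv v) $ 3\<bar> \<le> norm (T (zinv v) - T (zinv u))"
      using component_le_norm_cart[of "T (zinv v) - T (zinv u)" 3] by simp
    also have "\<dots> \<le> C' * norm (v - u)" using lip[OF v(1) uV v(2)] u(1) by simp
    also have "\<dots> \<le> C' * (2 * v $ 3)" using u(3) C' by (intro mult_left_mono)
    finally show "\<bar>T (zinv v) $ 3\<bar> \<le> 2 * C' * v $ 3" by simp
  qed (use vw C' in \<open>auto simp: V_def\<close>)
  then show ?thesis using vw by (simp add: descend_def C'_def mult_ac)
qed

lemma zinv_qc:
  assumes "0 < w $ 3" "qc_at K Z (zinv w)"
  shows "qc_at K zinv w"
proof (rule qc_at_inverse[where f = Z and T = "{z. 0 < z $ 3}"])
  show "open {z::real^3. 0 < z $ 3}" by (intro open_Collect_less continuous_intros)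
  fix z :: "real^3" assume "z \<in> {z. 0 < z $ 3}"
  then show "Z (zinv z) = z" by (intro zinv) auto
qed (use assms isCont_zinv in auto)

text \<open>In the open upper half space a bad point is the image under \<open>Z\<close> of a bad
  point of \<open>Z\<close> or of \<open>T\<close>, and \<open>Z\<close>, being locally Lipschitz,
  maps null sets to null sets. The lower half follows by reflection.\<close>

lemma descend_not_qc:
  assumes T: "negligible {x \<in> prism. x $ 3 \<in> I \<and> \<not> qc_at K T x}"
  shows "negligible {w. w \<noteq> 0 \<and> ln (norm w) \<in> I \<and> \<not> qc_at (Z_distortion * K) (descend T) w}"
proof -
  define V where "V = {w::real^3. w \<noteq> 0 \<and> ln (norm w) \<in> I}"
  define B where "B = {x. \<not> qc_at Z_distortion Z x} \<union> {x \<in> prism. x $ 3 \<in> I \<and> \<not> qc_at K T x}"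
  have "negligible B" unfolding B_def by (intro negligible_Un Z_not_qc T)
  then have ZB: "negligible (Z ` B)"
  proof (rule negligible_locally_Lipschitz_image[OF order_refl])
    fix x assume "x \<in> B"
    have "norm (Z y - Z x) \<le> (3 + 2 * L) * exp (x $ 3) * norm (y - x)" if "y \<in> B \<inter> ball x 1" for y
    proof (rule Z_upper_bound)
      show "\<bar>x $ 3 - y $ 3\<bar> \<le> 1"
        using that component_le_norm_cart[of "x - y" 3] by (simp add: dist_norm)
    qed
    then show "\<exists>T Ba. open T \<and> x \<in> T \<and> (\<forall>y\<in>B \<inter> T. norm (Z y - Z x) \<le> Ba * norm (y - x))"
      by (intro exI[of _ "ball x 1"] exI[of _ "(3 + 2 * L) * exp (x $ 3)"]) auto
  qed
  have "{w \<in> V. 0 < w $ 3 \<and> \<not> qc_at (Z_distortion * K) (\<lambda>v. T (zinv v)) w} \<subseteq> Z ` B"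
  proof
    fix w assume w: "w \<in> {w \<in> V. 0 < w $ 3 \<and> \<not> qc_at (Z_distortion * K) (\<lambda>v. T (zinv v)) w}"
    then have w0: "w \<noteq> 0" "0 \<le> w $ 3" by (auto simp: V_def)
    have "zinv w \<in> B"
    proof (rule ccontr)
      assume "zinv w \<notin> B"
      then have "qc_at Z_distortion Z (zinv w)" "qc_at K T (zinv w)"
        using zinv(1)[OF w0] w by (auto simp: B_def V_def)
      then have "qc_at (Z_distortion * K) (\<lambda>v. T (zinv v)) w"
        using w by (intro qc_at_compose zinv_qc) auto
      then show False using w by simp
    qed
    then show "w \<in> Z ` B" using zinv(2)[OF w0] by (metis imageI)
  qed
  then have "negligible {w \<in> V. 0 < w $ 3 \<and> \<not> qc_at (Z_distortion * K) (\<lambda>v. T (zinv v)) w}"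
    using ZB negligible_subset by blast
  then have neg: "negligible {w \<in> V. \<not> qc_at (Z_distortion * K) (reflect_extension (\<lambda>v. T (zinv v))) w}"
    by (rule reflect_extension_not_qc) (simp add: V_def)
  show ?thesis
  proof (rule negligible_subset[OF neg])
    have "qc_at (Z_distortion * K) (descend T) w"
      if "qc_at (Z_distortion * K) (reflect_extension (\<lambda>v. T (zinv v))) w" "w \<noteq> 0" for w
      by (rule qc_at_transform[OF that(1), of "- {0}"]) (use that(2) in \<open>auto simp: descend_def open_Compl\<close>)
    then show "{w. w \<noteq> 0 \<and> ln (norm w) \<in> I \<and> \<not> qc_at (Z_distortion * K) (descend T) w} \<subseteq>
        {w \<in> V. \<not> qc_at (Z_distortion * K) (reflect_extension (\<lambda>v. T (zinv v))) w}"
      by (auto simp: V_def)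
  qed
qed

end

section \<open>Power maps\<close>

lemma abs_power_diff_le:
  fixes u v m :: real
  assumes "0 \<le> u" "u \<le> m" "0 \<le> v" "v \<le> m" "1 \<le> m"
  shows "\<bar>u ^ n - v ^ n\<bar> \<le> real n * m ^ n * \<bar>u - v\<bar>"
proof (induction n)
  case (Suc n)
  have "u ^ Suc n - v ^ Suc n = u * (u ^ n - v ^ n) + (u - v) * v ^ n" by (simp add: algebra_simps)
  then have "\<bar>u ^ Suc n - v ^ Suc n\<bar> \<le> u * \<bar>u ^ n - v ^ n\<bar> + \<bar>u - v\<bar> * v ^ n"
    using abs_triangle_ineq[of "u * (u ^ n - v ^ n)" "(u - v) * v ^ n"] assms by (simp add: abs_mult)
  also have "\<dots> \<le> m * (real n * m ^ n * \<bar>u - v\<bar>) + \<bar>u - v\<bar> * m ^ Suc n"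
  proof (intro add_mono mult_mono Suc.IH)
    have "v ^ n \<le> m ^ n" using assms by (intro power_mono) auto
    also have "\<dots> \<le> m ^ Suc n" using assms by (intro power_increasing) auto
    finally show "v ^ n \<le> m ^ Suc n" .
  qed (use assms in auto)
  also have "\<dots> = real (Suc n) * m ^ Suc n * \<bar>u - v\<bar>" by (simp add: algebra_simps)
  finally show ?case .
qed simp

lemma qc_at_scaleR:
  assumes "0 < (c::real)"
  shows "qc_at 1 (\<lambda>x::real^'n::finite. c *\<^sub>R x) x"
proof -
  define A where "A = matrix (\<lambda>x::real^'n. c *\<^sub>R x)"
  have lin: "linear (\<lambda>x::real^'n. c *\<^sub>R x)" by (rule linear_scaleR)
  have A: "A *v v = c *\<^sub>R v" for v unfolding A_def using lin by (simp add: matrix_works)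
  have "((\<lambda>x::real^'n. c *\<^sub>R x) has_derivative (\<lambda>v. A *v v)) (at x)"
    unfolding A by (rule linear_imp_has_derivative[OF lin])
  moreover have "0 < det A" using assms by (simp add: A_def det_matrix_scaleR)
  moreover have "c * norm v \<le> norm (A *v v) \<and> norm (A *v v) \<le> 1 * c * norm v" for v
    using assms by (simp add: A)
  ultimately show ?thesis unfolding qc_at_def using assms by blast
qed

section \<open>The power maps as maps induced through the Zorich map\<close>

context zorich
begin

lemma Z_odd_wall:
  assumes "i \<in> {1, 2}" "odd n" "x $ i = real_of_int n"
  shows "Z x $ 3 = 0"
proof -
  have "reflect_plane i (real_of_int n) x = x" using assms(3) by (auto simp: vec_eq_iff)
  then have "Z x = reflect_plane 3 0 (Z x)" using Z_reflect[OF assms(1,2), of x] by simp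
  then have "Z x $ 3 = reflect_plane 3 0 (Z x) $ 3" by simp
  then show ?thesis by simp
qed

text \<open>Only the equator needs an argument: it is fixed by the reflection, and its image is
  fixed too because \<open>T\<close> is flat on the walls.\<close>

lemma descend_reflect:
  assumes flat: "\<And>x. x \<in> prism \<Longrightarrow> \<bar>x $ 1\<bar> = 1 \<or> \<bar>x $ 2\<bar> = 1 \<Longrightarrow> T x $ 3 = 0"
  shows "descend T (reflect_plane 3 0 w) = reflect_plane 3 0 (descend T w)"
proof -
  consider "w = 0" | "w \<noteq> 0" "w $ 3 = 0" | "w \<noteq> 0" "0 < w $ 3" | "w \<noteq> 0" "w $ 3 < 0" by linarith
  then show ?thesis
  proof cases
    case 2
    then have "reflect_plane 3 0 w = w" by (simp add: vec_eq_iff)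
    moreover have "T (zinv w) $ 3 = 0" using 2 by (intro flat zinv zinv_equator) auto
    then have "reflect_plane 3 0 (T (zinv w)) = T (zinv w)" by (simp add: vec_eq_iff)
    ultimately show ?thesis using 2 by (simp add: descend_upper)
  qed (simp_all add: descend_upper descend_lower, simp add: descend_def vec_eq_iff)
qed

lemma Z_surj:
  assumes "w \<noteq> 0"
  obtains x where "Z x = w"
proof (cases "0 \<le> w $ 3")
  case True
  then show ?thesis using that zinv(2)[OF assms] by blast
next
  case False
  then have "Z (zinv (reflect_plane 3 0 w)) = reflect_plane 3 0 w" using assms by (intro zinv) auto
  then have "Z (reflect_plane 1 (real_of_int 1) (zinv (reflect_plane 3 0 w))) = w"
    by (subst Z_reflect) auto
  then show ?thesis using that by blast
qed

text \<open>A concrete candidate for p_d; \<open>power_map_eq\<close> identifies it with the map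
  given by definite description.\<close>

definition zpower :: "nat \<Rightarrow> real^3 \<Rightarrow> real^3" where
  "zpower d = descend (\<lambda>x. Z (real d *\<^sub>R x))"

lemma zpower_flat:
  assumes "odd d" "x \<in> prism" "\<bar>x $ 1\<bar> = 1 \<or> \<bar>x $ 2\<bar> = 1"
  shows "Z (real d *\<^sub>R x) $ 3 = 0"
proof -
  obtain i :: 3 where i: "i \<in> {1, 2}" "\<bar>x $ i\<bar> = 1" using assms(3) by blast
  show ?thesis
  proof (cases "x $ i = 1")
    case True
    then show ?thesis using Z_odd_wall[OF i(1), of "int d" "real d *\<^sub>R x"] assms(1) by simp
  next
    case False
    then have "x $ i = -1" using i(2) by linarith
    then show ?thesis using Z_odd_wall[OF i(1), of "- int d" "real d *\<^sub>R x"] assms(1) by simp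
  qed
qed

text \<open>Scaling by \<open>d\<close> turns the reflection in an odd \<open>n\<close> into the one
  in \<open>d * n\<close>, which is again odd; here the parity of \<open>d\<close> enters.\<close>

lemma zpower_Z:
  assumes d: "odd d"
  shows "zpower d (Z x) = Z (real d *\<^sub>R x)"
proof (rule prism_reflection_induct[of _ x])
  fix x :: "real^3" and i :: 3 and n :: int
  assume i: "i \<in> {1, 2}" and n: "odd n"
    and IH: "zpower d (Z (reflect_plane i n x)) = Z (real d *\<^sub>R reflect_plane i n x)"
  have dn: "odd (int d * n)" using d n by simp
  have "real d *\<^sub>R reflect_plane i n x = reflect_plane i (real_of_int (int d * n)) (real d *\<^sub>R x)"
    by (simp add: vec_eq_iff algebra_simps)
  then have "reflect_plane 3 0 (zpower d (Z x)) = reflect_plane 3 0 (Z (real d *\<^sub>R x))"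
    using IH Z_reflect[OF i n] Z_reflect[OF i dn, of "real d *\<^sub>R x"]
    by (simp add: zpower_def descend_reflect zpower_flat[OF d])
  then show "zpower d (Z x) = Z (real d *\<^sub>R x)" by (metis reflect_plane_reflect_plane)
next
  fix x :: "real^3" assume "\<bar>x $ 1\<bar> \<le> 1" "\<bar>x $ 2\<bar> \<le> 1"
  then show "zpower d (Z x) = Z (real d *\<^sub>R x)" unfolding zpower_def by (intro descend_Z) (simp add: prism_def)
qed

lemma norm_zpower:
  assumes "odd d"
  shows "norm (zpower d w) = norm w ^ d"
proof (cases "w = 0")
  case True
  then show ?thesis using assms by (auto simp: zpower_def descend_def odd_pos)
next
  case False
  then obtain x where x: "Z x = w" using Z_surj by blast
  then show ?thesis using zpower_Z[OF assms, of x] norm_Z[of x] norm_Z[of "real d *\<^sub>R x"] by (simp add: exp_of_nat_mult)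
qed

text \<open>The constant grows with \<open>d\<close>, which is harmless because it only supplies
  regularity. The origin is treated apart through \<open>norm_zpower\<close>, as \<open>zinv\<close>
  has no meaning there.\<close>

lemma zpower_lipschitz:
  assumes d: "odd d" and m: "1 \<le> m"
  shows "\<exists>B. B-lipschitz_on (cball 0 m) (zpower d)"
proof -
  define C where "C = real d * m ^ d * L"
  have d1: "1 \<le> d" using d by (cases d) auto
  have mC: "m ^ d \<le> C"
  proof -
    have "1 * m ^ d * 1 \<le> real d * m ^ d * L" using d1 L m by (intro mult_mono) auto
    then show ?thesis by (simp add: C_def)
  qed
  have C: "0 \<le> C" using mC m by (smt (verit) zero_le_power)
  have est: "norm (Z (real d *\<^sub>R x) - Z (real d *\<^sub>R y)) \<le> C * (\<bar>exp (x $ 3) - exp (y $ 3)\<bar> +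
        exp (x $ 3) * (\<bar>x $ 1 - y $ 1\<bar> + \<bar>x $ 2 - y $ 2\<bar>))"
    if "x $ 3 \<le> ln m" "y $ 3 \<le> ln m" for x y :: "real^3"
  proof -
    define u where "u = exp (x $ 3)"
    define v where "v = exp (y $ 3)"
    define s where "s = \<bar>x $ 1 - y $ 1\<bar> + \<bar>x $ 2 - y $ 2\<bar>"
    have u: "0 \<le> u" "u \<le> m" and v: "0 \<le> v" "v \<le> m"
      using that m by (auto simp: u_def v_def ln_ge_iff)
    have s: "0 \<le> s" by (simp add: s_def)
    have "norm (Z (real d *\<^sub>R x) - Z (real d *\<^sub>R y)) \<le> \<bar>u ^ d - v ^ d\<bar> + u ^ d * L * (real d * s)"
      using Z_increment[of "real d *\<^sub>R x" "real d *\<^sub>R y"]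
      by (simp add: u_def v_def s_def exp_of_nat_mult distrib_left right_diff_distrib[symmetric] abs_mult)
    also have "\<bar>u ^ d - v ^ d\<bar> \<le> C * \<bar>u - v\<bar>"
    proof -
      have "\<bar>u ^ d - v ^ d\<bar> \<le> real d * m ^ d * \<bar>u - v\<bar>" by (rule abs_power_diff_le[OF u v m])
      also have "\<dots> \<le> C * \<bar>u - v\<bar>"
      proof (rule mult_right_mono)
        have "0 \<le> real d * m ^ d" using m by simp
        then show "real d * m ^ d \<le> C" unfolding C_def using L by (simp add: mult_le_cancel_left1)
      qed simp
      finally show ?thesis .
    qed
    also have "u ^ d * L * (real d * s) \<le> C * (u * s)"
    proof -
      \<comment> \<open>One factor \<open>u\<close> is kept, since the target estimate carries the
        weight \<open>exp (x $ 3)\<close>.\<close>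
      have "u ^ d = u * u ^ (d - 1)" using d1 by (simp add: power_eq_if)
      also have "\<dots> \<le> u * m ^ d"
      proof (rule mult_left_mono[OF _ u(1)])
        have "u ^ (d - 1) \<le> m ^ (d - 1)" using u by (intro power_mono) auto
        also have "\<dots> \<le> m ^ d" using m by (intro power_increasing) auto
        finally show "u ^ (d - 1) \<le> m ^ d" .
      qed
      finally have "u ^ d * (L * (real d * s)) \<le> (u * m ^ d) * (L * (real d * s))"
        using L s by (intro mult_right_mono) auto
      then show ?thesis by (simp add: C_def mult_ac)
    qed
    finally show ?thesis by (simp add: u_def v_def s_def distrib_left)
  qed
  define B where "B = 6 * C * (1 + 4 * L)"
  have CB: "C \<le> B"
  proof -
    have "1 * C \<le> (6 * (1 + 4 * L)) * C" using C L by (intro mult_right_mono) auto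
    then show ?thesis by (simp add: B_def mult_ac)
  qed
  have zero: "norm (zpower d w) \<le> B * norm w" if "norm w \<le> m" for w
  proof -
    have "norm w ^ d = norm w ^ (d - 1) * norm w" using d1 by (simp add: power_eq_if)
    also have "\<dots> \<le> B * norm w"
    proof (rule mult_right_mono)
      have "norm w ^ (d - 1) \<le> m ^ (d - 1)" using that by (intro power_mono) auto
      also have "\<dots> \<le> m ^ d" using m by (intro power_increasing) auto
      finally show "norm w ^ (d - 1) \<le> B" using mC CB by linarith
    qed simp
    finally show ?thesis by (simp add: norm_zpower[OF d])
  qed
  have zpower_0: "zpower d 0 = 0" by (simp add: zpower_def descend_def)
  have "B-lipschitz_on (cball 0 m) (zpower d)"
  proof (rule lipschitz_onI)
    fix v w :: "real^3" assume vw: "v \<in> cball 0 m" "w \<in> cball 0 m"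
    have "norm (zpower d v - zpower d w) \<le> B * norm (v - w)"
    proof (cases "v = 0 \<or> w = 0")
      case True
      then show ?thesis using zero[of v] zero[of w] vw zpower_0 by auto
    next
      case False
      then have lns: "ln (norm v) \<le> ln m" "ln (norm w) \<le> ln m"
        using vw m by (simp_all add: ln_le_cancel_iff)
      have "norm (descend (\<lambda>x. Z (real d *\<^sub>R x)) v - descend (\<lambda>x. Z (real d *\<^sub>R x)) w) \<le> 6 * C * (1 + 4 * L) * norm (v - w)"
        by (rule descend_lipschitz[where I = "{..ln m}"])
           (use C est zpower_flat[OF d] False lns in auto)
      then show ?thesis by (simp add: zpower_def B_def)
    qed
    then show "dist (zpower d v) (zpower d w) \<le> B * dist v w" by (simp add: dist_norm)
  qed (use CB C in linarith)
  then show ?thesis by blast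
qed

lemma zpower_not_qc:
  assumes d: "odd d"
  shows "negligible {w. \<not> qc_at (Z_distortion * Z_distortion) (zpower d) w}"
proof -
  have d0: "0 < real d" using d by (simp add: odd_pos)
  have "negligible {x \<in> UNIV. \<not> qc_at (1 * Z_distortion) (\<lambda>x. Z (real d *\<^sub>R x)) x}"
  proof (rule negligible_not_qc_compose[where V = UNIV and g = Z and f = "\<lambda>x. real d *\<^sub>R x"])
    have "{x \<in> UNIV. \<not> qc_at 1 (\<lambda>x::real^3. real d *\<^sub>R x) x} = {}" using qc_at_scaleR[OF d0] by blast
    then show "negligible {x \<in> UNIV. \<not> qc_at 1 (\<lambda>x::real^3. real d *\<^sub>R x) x}" by (simp only: negligible_empty)
  qed (use Z_not_qc in simp_all)
  then have "negligible {x \<in> prism. x $ 3 \<in> UNIV \<and> \<not> qc_at Z_distortion (\<lambda>x. Z (real d *\<^sub>R x)) x}"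
    by (rule negligible_subset) auto
  then have "negligible {w. w \<noteq> 0 \<and> ln (norm w) \<in> UNIV \<and> \<not> qc_at (Z_distortion * Z_distortion) (zpower d) w}"
    unfolding zpower_def by (rule descend_not_qc)
  then have "negligible ({w. w \<noteq> 0 \<and> ln (norm w) \<in> UNIV \<and> \<not> qc_at (Z_distortion * Z_distortion) (zpower d) w} \<union> {0})"
    by (intro negligible_Un negligible_sing)
  then show ?thesis by (rule negligible_subset) auto
qed

lemma Z_distortion_ge_1: "1 \<le> Z_distortion"
proof -
  have "1\<^sup>2 \<le> (3 + 2 * L)\<^sup>2" using L by (intro power_mono) auto
  then show ?thesis by (simp add: Z_distortion_def)
qed

lemma zpower_quasiregular:
  assumes d: "odd d"
  shows "quasiregular_on UNIV (zpower d)"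
proof -
  have lip: "\<exists>B. B-lipschitz_on C (zpower d)" if "compact C" for C :: "(real^3) set"
  proof -
    have "bounded C" using that by (rule compact_imp_bounded)
    then obtain m where "\<forall>x\<in>C. norm x \<le> m" unfolding bounded_iff by blast
    then have sub: "C \<subseteq> cball 0 (max 1 m)" by (auto simp: le_max_iff_disj)
    obtain B where "B-lipschitz_on (cball 0 (max 1 m)) (zpower d)" using zpower_lipschitz[OF d, of "max 1 m"] by auto
    then show ?thesis using sub lipschitz_on_subset by blast
  qed
  have "continuous_on UNIV (zpower d)"
  proof (rule continuous_at_imp_continuous_on, rule ballI)
    fix x :: "real^3"
    obtain B where "B-lipschitz_on (cball x 1) (zpower d)" using lip[of "cball x 1"] by auto
    then have "continuous_on (cball x 1) (zpower d)" by (rule lipschitz_on_continuous_on)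
    then have "continuous_on (ball x 1) (zpower d)" by (rule continuous_on_subset) auto
    then show "isCont (zpower d) x" by (simp add: continuous_on_eq_continuous_at)
  qed
  moreover have "outer_bound UNIV (zpower d) ((Z_distortion * Z_distortion) ^ CARD(3))"
    by (rule ae_qc_dilatation_bounds) (use lip zpower_not_qc[OF d] Z_distortion_ge_1 in auto)
  moreover have "1 \<le> (Z_distortion * Z_distortion) ^ CARD(3)" using Z_distortion_ge_1 by (intro one_le_power) (metis mult_1 mult_mono zero_le_one order_trans)
  ultimately show ?thesis unfolding quasiregular_on_def by blast
qed

text \<open>Any competitor is continuous and is prescribed on the image of \<open>Z\<close>, which
  is the complement of the origin and hence dense.\<close>

lemma power_map_eq:
  assumes d: "odd d"
  shows "power_map Z d = zpower d"
  unfolding power_map_def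
proof (rule the_equality)
  show "quasiregular_on UNIV (zpower d) \<and> (\<forall>x. zpower d (Z x) = Z (real d *\<^sub>R x))"
    using zpower_quasiregular[OF d] zpower_Z[OF d] by blast
next
  fix p assume p: "quasiregular_on UNIV p \<and> (\<forall>x. p (Z x) = Z (real d *\<^sub>R x))"
  have "continuous_on UNIV p" "continuous_on UNIV (zpower d)"
    using p zpower_quasiregular[OF d] by (auto simp: quasiregular_on_def)
  then have cl: "closed {w. p w = zpower d w}" by (rule closed_Collect_eq)
  have "- {0} \<subseteq> {w. p w = zpower d w}"
  proof
    fix w :: "real^3" assume "w \<in> - {0}"
    then obtain x where "Z x = w" using Z_surj by blast
    then show "w \<in> {w. p w = zpower d w}" using p zpower_Z[OF d, of x] by auto
  qed
  then have "closure (- {0}) \<subseteq> {w. p w = zpower d w}" using cl by (rule closure_minimal)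
  moreover have "closure (- {0::real^3}) = UNIV" by (simp add: closure_complement interior_singleton)
  ultimately show "p = zpower d" by auto
qed

end

section \<open>The bipyramid model of the Zorich map\<close>

lemma has_derivative_vec:
  fixes f :: "'a::real_normed_vector \<Rightarrow> real^'n"
  assumes "\<And>i. ((\<lambda>x. f x $ i) has_derivative (\<lambda>v. f' v $ i)) (at x within S)"
  shows "(f has_derivative f') (at x within S)"
  unfolding has_derivative_componentwise_within[of f]
  using assms by (auto simp: Basis_vec_def inner_axis)

text \<open>Cramer's rule. The entries are at most \<open>C * t\<close>, so those of the adjugate
  are at most \<open>2 * (C * t)\<^sup>2\<close>. Summing nine entries each, the matrix stretches by
  at most \<open>9 * C * t\<close> and by at least \<open>c * t / (18 * C\<^sup>2)\<close>. The
  scale \<open>t\<close> drops out of the quotient.\<close>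

lemma qc_at_of_partials:
  fixes f :: "real^3 \<Rightarrow> real^3"
  assumes d1: "((\<lambda>x. f x $ 1) has_derivative (\<lambda>v. a11 * v $ 1 + a12 * v $ 2 + a13 * v $ 3)) (at x)"
    and d2: "((\<lambda>x. f x $ 2) has_derivative (\<lambda>v. a21 * v $ 1 + a22 * v $ 2 + a23 * v $ 3)) (at x)"
    and d3: "((\<lambda>x. f x $ 3) has_derivative (\<lambda>v. a31 * v $ 1 + a32 * v $ 2 + a33 * v $ 3)) (at x)"
    and bd: "\<bar>a11\<bar> \<le> C * t" "\<bar>a12\<bar> \<le> C * t" "\<bar>a13\<bar> \<le> C * t" "\<bar>a21\<bar> \<le> C * t" "\<bar>a22\<bar> \<le> C * t"
      "\<bar>a23\<bar> \<le> C * t" "\<bar>a31\<bar> \<le> C * t" "\<bar>a32\<bar> \<le> C * t" "\<bar>a33\<bar> \<le> C * t"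
    and det: "c * t ^ 3 \<le> a11 * (a22 * a33 - a23 * a32) - a12 * (a21 * a33 - a23 * a31) + a13 * (a21 * a32 - a22 * a31)"
    and pos: "0 < t" "0 < c" "0 < C"
  shows "qc_at (162 * C ^ 3 / c) f x"
proof -
  define A :: "real^3^3" where "A = vector [vector [a11, a12, a13], vector [a21, a22, a23], vector [a31, a32, a33]]"
  define D where "D = a11 * (a22 * a33 - a23 * a32) - a12 * (a21 * a33 - a23 * a31) + a13 * (a21 * a32 - a22 * a31)"
  have Av: "(A *v v) $ 1 = a11 * v $ 1 + a12 * v $ 2 + a13 * v $ 3"
    "(A *v v) $ 2 = a21 * v $ 1 + a22 * v $ 2 + a23 * v $ 3"
    "(A *v v) $ 3 = a31 * v $ 1 + a32 * v $ 2 + a33 * v $ 3" for v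
    by (simp_all add: matrix_vector_mult_def A_def sum_3)
  have "((\<lambda>x. f x $ i) has_derivative (\<lambda>v. (A *v v) $ i)) (at x)" for i
    using exhaust_3[of i] d1 d2 d3 by (auto simp: Av)
  then have "(f has_derivative (\<lambda>v. A *v v)) (at x)" by (rule has_derivative_vec)
  moreover have detA: "det A = D"
    unfolding det_3 D_def by (simp add: A_def algebra_simps)
  have D: "c * t ^ 3 \<le> D" using det by (simp add: D_def)
  have D0: "0 < D" using D pos by (smt (verit) mult_pos_pos zero_less_power)
  have nn: "0 \<le> C * t" using pos by simp
  have two: "\<bar>p * q - r * s\<bar> \<le> 2 * (C * t)\<^sup>2"
    if "\<bar>p\<bar> \<le> C * t" "\<bar>q\<bar> \<le> C * t" "\<bar>r\<bar> \<le> C * t" "\<bar>s\<bar> \<le> C * t" for p q r s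
  proof -
    have "\<bar>p * q\<bar> \<le> (C * t) * (C * t)" "\<bar>r * s\<bar> \<le> (C * t) * (C * t)"
      unfolding abs_mult using that nn by (auto intro!: mult_mono)
    then show ?thesis unfolding power2_eq_square by linarith
  qed
  have three: "\<bar>p * w1 + q * w2 + r * w3\<bar> \<le> (\<bar>p\<bar> + \<bar>q\<bar> + \<bar>r\<bar>) * n"
    if "\<bar>w1\<bar> \<le> n" "\<bar>w2\<bar> \<le> n" "\<bar>w3\<bar> \<le> n" for p q r w1 w2 w3 n :: real
  proof -
    have "\<bar>p * w1\<bar> \<le> \<bar>p\<bar> * n" "\<bar>q * w2\<bar> \<le> \<bar>q\<bar> * n" "\<bar>r * w3\<bar> \<le> \<bar>r\<bar> * n"
      unfolding abs_mult using that by (auto intro!: mult_left_mono)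
    then show ?thesis unfolding distrib_right by linarith
  qed
  have l1: "norm v \<le> \<bar>v $ 1\<bar> + \<bar>v $ 2\<bar> + \<bar>v $ 3\<bar>" for v :: "real^3"
    using norm_le_l1_cart[of v] by (simp add: sum_3)
  have upper: "norm (A *v v) \<le> 9 * C * t * norm v" for v
  proof -
    have row: "\<bar>p * v $ 1 + q * v $ 2 + r * v $ 3\<bar> \<le> (C * t + C * t + C * t) * norm v"
      if "\<bar>p\<bar> \<le> C * t" "\<bar>q\<bar> \<le> C * t" "\<bar>r\<bar> \<le> C * t" for p q r
      by (rule order_trans[OF three mult_right_mono])
        (intro component_le_norm_cart add_mono that norm_ge_zero)+
    have "\<bar>(A *v v) $ 1\<bar> \<le> (C * t + C * t + C * t) * norm v"
      "\<bar>(A *v v) $ 2\<bar> \<le> (C * t + C * t + C * t) * norm v"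
      "\<bar>(A *v v) $ 3\<bar> \<le> (C * t + C * t + C * t) * norm v"
      unfolding Av by (rule row bd)+
    then show ?thesis using l1[of "A *v v"] by (simp add: algebra_simps)
  qed
  have lower: "D * norm v \<le> 18 * (C * t)\<^sup>2 * norm (A *v v)" for v
  proof -
    let ?w = "A *v v"
    \<comment> \<open>The adjugate applied to \<open>A *v v\<close>, row by row.\<close>
    have e1: "D * v $ 1 = (a22 * a33 - a23 * a32) * ?w $ 1 + (a13 * a32 - a12 * a33) * ?w $ 2 + (a12 * a23 - a13 * a22) * ?w $ 3"
      unfolding Av D_def by algebra
    have e2: "D * v $ 2 = (a23 * a31 - a21 * a33) * ?w $ 1 + (a11 * a33 - a13 * a31) * ?w $ 2 + (a13 * a21 - a11 * a23) * ?w $ 3"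
      unfolding Av D_def by algebra
    have e3: "D * v $ 3 = (a21 * a32 - a22 * a31) * ?w $ 1 + (a12 * a31 - a11 * a32) * ?w $ 2 + (a11 * a22 - a12 * a21) * ?w $ 3"
      unfolding Av D_def by algebra
    have "\<bar>D * v $ 1\<bar> \<le> (2 * (C * t)\<^sup>2 + 2 * (C * t)\<^sup>2 + 2 * (C * t)\<^sup>2) * norm ?w"
      unfolding e1 by (rule order_trans[OF three mult_right_mono])
        (intro component_le_norm_cart add_mono two bd norm_ge_zero)+
    moreover have "\<bar>D * v $ 2\<bar> \<le> (2 * (C * t)\<^sup>2 + 2 * (C * t)\<^sup>2 + 2 * (C * t)\<^sup>2) * norm ?w"
      unfolding e2 by (rule order_trans[OF three mult_right_mono])
        (intro component_le_norm_cart add_mono two bd norm_ge_zero)+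
    moreover have "\<bar>D * v $ 3\<bar> \<le> (2 * (C * t)\<^sup>2 + 2 * (C * t)\<^sup>2 + 2 * (C * t)\<^sup>2) * norm ?w"
      unfolding e3 by (rule order_trans[OF three mult_right_mono])
        (intro component_le_norm_cart add_mono two bd norm_ge_zero)+
    moreover have "D * norm v \<le> \<bar>D * v $ 1\<bar> + \<bar>D * v $ 2\<bar> + \<bar>D * v $ 3\<bar>"
      using mult_left_mono[OF l1[of v], of D] D0 by (simp add: abs_mult distrib_left)
    ultimately show ?thesis by (simp add: algebra_simps)
  qed
  define a where "a = c * t / (18 * C\<^sup>2)"
  have a0: "0 < a" using pos by (simp add: a_def)
  have "a * norm v \<le> norm (A *v v)" for v
  proof -
    have "c * t ^ 3 * norm v \<le> D * norm v" using D by (intro mult_right_mono) auto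
    also note lower[of v]
    finally have "(c * t * norm v) * t\<^sup>2 \<le> (18 * C\<^sup>2 * norm (A *v v)) * t\<^sup>2"
      by (simp add: power2_eq_square power3_eq_cube mult_ac)
    then have "c * t * norm v \<le> 18 * C\<^sup>2 * norm (A *v v)" using pos by (simp add: mult_le_cancel_right)
    then show ?thesis using pos by (simp add: a_def divide_le_eq mult_ac)
  qed
  moreover have "162 * C ^ 3 / c * a = 9 * C * t"
    using pos by (simp add: a_def power2_eq_square power3_eq_cube)
  ultimately show ?thesis
    unfolding qc_at_def using upper a0 D0 detA
    by (intro exI[of _ A] exI[of _ a]) simp
qed

text \<open>The gauge function of the solid bipyramid over the square.\<close>

definition bip_norm :: "real^3 \<Rightarrow> real" where
  "bip_norm y = max \<bar>y $ 1\<bar> \<bar>y $ 2\<bar> + \<bar>y $ 3\<bar>"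

lemma bip_norm_nonneg: "0 \<le> bip_norm y"
  by (simp add: bip_norm_def)

lemma bip_norm_eq_0: "bip_norm y = 0 \<longleftrightarrow> y = 0"
proof
  assume "bip_norm y = 0"
  then have "\<bar>y $ 1\<bar> \<le> 0" "\<bar>y $ 2\<bar> \<le> 0" "\<bar>y $ 3\<bar> \<le> 0"
    unfolding bip_norm_def using max.cobounded1[of "\<bar>y $ 1\<bar>" "\<bar>y $ 2\<bar>"] max.cobounded2[of "\<bar>y $ 2\<bar>" "\<bar>y $ 1\<bar>"]
    by linarith+
  then show "y = 0" by (simp add: vec_eq_iff forall_3)
qed (simp add: bip_norm_def)

lemma bip_norm_diff_le: "\<bar>bip_norm x - bip_norm y\<bar> \<le> 2 * norm (x - y)"
proof -
  have c: "\<bar>x $ i - y $ i\<bar> \<le> norm (x - y)" for i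
    using component_le_norm_cart[of "x - y" i] by simp
  have a: "\<bar>\<bar>x $ i\<bar> - \<bar>y $ i\<bar>\<bar> \<le> norm (x - y)" for i
    using abs_triangle_ineq3[of "x $ i" "y $ i"] c[of i] by (rule order_trans)
  have m: "\<bar>max p q - max r s\<bar> \<le> e" if "\<bar>p - r\<bar> \<le> e" "\<bar>q - s\<bar> \<le> e" for p q r s e :: real
  proof -
    have "p \<le> max r s + e" "q \<le> max r s + e" "r \<le> max p q + e" "s \<le> max p q + e"
      using that max.cobounded1[of r s] max.cobounded2[of s r] max.cobounded1[of p q] max.cobounded2[of q p]
      by argo+
    then have "max p q \<le> max r s + e" "max r s \<le> max p q + e" by (simp_all only: max.bounded_iff)
    then show ?thesis by argo
  qed
  have "\<bar>max \<bar>x $ 1\<bar> \<bar>x $ 2\<bar> - max \<bar>y $ 1\<bar> \<bar>y $ 2\<bar>\<bar> \<le> norm (x - y)" by (rule m[OF a a])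
  then show ?thesis using a[of 3] unfolding bip_norm_def abs_le_iff by argo
qed

text \<open>Logarithmic polar coordinates for this gauge: \<open>y\<close> is scaled to the
  bipyramid and projected vertically to the square, and the logarithm of its gauge becomes the
  height in the prism.\<close>

definition bip_chart :: "real^3 \<Rightarrow> real^3" where
  "bip_chart y = vector [y $ 1 / bip_norm y, y $ 2 / bip_norm y, ln (bip_norm y)]"

lemma bip_chart_nth [simp]:
  "bip_chart y $ 1 = y $ 1 / bip_norm y" "bip_chart y $ 2 = y $ 2 / bip_norm y"
  "bip_chart y $ 3 = ln (bip_norm y)"
  by (simp_all add: bip_chart_def)

lemma bip_chart_prism: "bip_chart y \<in> prism"
proof -
  have *: "\<bar>t / bip_norm y\<bar> \<le> 1" if "\<bar>t\<bar> \<le> bip_norm y" for t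
    using that bip_norm_nonneg[of y] by (cases "bip_norm y = 0") (simp_all add: abs_divide)
  have "\<bar>y $ 1\<bar> \<le> max \<bar>y $ 1\<bar> \<bar>y $ 2\<bar>" "\<bar>y $ 2\<bar> \<le> max \<bar>y $ 1\<bar> \<bar>y $ 2\<bar>" by simp_all
  then have "\<bar>y $ 1\<bar> \<le> bip_norm y" "\<bar>y $ 2\<bar> \<le> bip_norm y"
    unfolding bip_norm_def using abs_ge_zero[of "y $ 3"] by linarith+
  then have "\<bar>y $ 1 / bip_norm y\<bar> \<le> 1 \<and> \<bar>y $ 2 / bip_norm y\<bar> \<le> 1" using * by blast
  then show ?thesis unfolding prism_def mem_Collect_eq bip_chart_nth .
qed

text \<open>Above the base plane, where one of the first two coordinates dominates with a fixed
  sign, \<open>bip_norm\<close> is linear; \<open>e1\<close> and \<open>e2\<close> encode that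
  region. Relative to the scale \<open>1 / n\<close> the determinant is exactly 1: adding
  \<open>p\<close> and \<open>q\<close> times the third row to the first two rows turns these into
  unit vectors.\<close>

lemma bip_chart_qc_linear:
  fixes e1 e2 :: real
  assumes e: "\<bar>e1\<bar> \<le> 1" "\<bar>e2\<bar> \<le> 1"
    and S: "open S" "y \<in> S" "\<And>z. z \<in> S \<Longrightarrow> bip_norm z = e1 * z $ 1 + e2 * z $ 2 + z $ 3"
    and y: "y \<noteq> 0"
  shows "qc_at (162 * 2 ^ 3 / 1) bip_chart y"
proof -
  define N where "N z = e1 * z $ 1 + e2 * z $ 2 + z $ 3" for z :: "real^3"
  define n where "n = N y"
  have n: "n = bip_norm y" using S(2,3) by (simp add: n_def N_def)
  have n0: "0 < n" using y bip_norm_eq_0[of y] bip_norm_nonneg[of y] by (simp add: n)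
  have yi: "\<bar>y $ 1 / n\<bar> \<le> 1" "\<bar>y $ 2 / n\<bar> \<le> 1"
    using bip_chart_prism[of y] by (simp_all add: prism_def n)
  define p where "p = y $ 1 / n"
  define q where "q = y $ 2 / n"
  have pq: "\<bar>p\<bar> \<le> 1" "\<bar>q\<bar> \<le> 1" using yi by (simp_all add: p_def q_def)
  have bb: "\<bar>a * b\<bar> \<le> 1" if "\<bar>a\<bar> \<le> 1" "\<bar>b\<bar> \<le> 1" for a b :: real
    using that by (simp add: abs_mult mult_le_one)
  have sc: "\<bar>a * (1 / n)\<bar> \<le> 2 * (1 / n)" if "\<bar>a\<bar> \<le> 2" for a
    using that n0 by (simp add: abs_mult divide_right_mono)
  let ?g = "\<lambda>z::real^3. vector [z $ 1 / N z, z $ 2 / N z, ln (N z)] :: real^3"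
  have dc: "((\<lambda>z. z $ i) has_derivative (\<lambda>v. v $ i)) (at y)" for i
    by (intro bounded_linear_imp_has_derivative bounded_linear_vec_nth)
  have dN: "(N has_derivative (\<lambda>v. e1 * v $ 1 + e2 * v $ 2 + v $ 3)) (at y)"
    unfolding N_def by (intro has_derivative_add has_derivative_mult_right dc)
  have "qc_at (162 * 2 ^ 3 / 1) ?g y"
  proof (rule qc_at_of_partials[where t = "1 / n"])
    define l where "l v = e1 * v $ 1 + e2 * v $ 2 + v $ 3" for v :: "real^3"
    have quot: "((\<lambda>z. z $ i / N z) has_derivative (\<lambda>v. (v $ i - y $ i / n * l v) * (1 / n))) (at y)" for i
    proof -
      have "((\<lambda>z. z $ i / N z) has_derivative (\<lambda>v. (v $ i * N y - y $ i * l v) / (N y * N y))) (at y)"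
        by (rule has_derivative_divide'[OF dc dN[folded l_def]]) (use n0 in \<open>simp add: n_def\<close>)
      moreover have "(\<lambda>v. (v $ i * N y - y $ i * l v) / (N y * N y)) = (\<lambda>v. (v $ i - y $ i / n * l v) * (1 / n))"
        unfolding n_def[symmetric] using n0 by (simp add: fun_eq_iff divide_simps)
      ultimately show ?thesis by metis
    qed
    have "(\<lambda>v. (v $ 1 - y $ 1 / n * l v) * (1 / n)) =
        (\<lambda>v. ((1 - e1 * p) * (1 / n)) * v $ 1 + ((- (e2 * p)) * (1 / n)) * v $ 2 + ((- p) * (1 / n)) * v $ 3)"
      unfolding p_def[symmetric] l_def by (rule ext) algebra
    then show "((\<lambda>z. ?g z $ 1) has_derivative
        (\<lambda>v. ((1 - e1 * p) * (1 / n)) * v $ 1 + ((- (e2 * p)) * (1 / n)) * v $ 2 + ((- p) * (1 / n)) * v $ 3)) (at y)"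
      using quot[of 1] by (simp only: vector_3)
    have "(\<lambda>v. (v $ 2 - y $ 2 / n * l v) * (1 / n)) =
        (\<lambda>v. ((- (e1 * q)) * (1 / n)) * v $ 1 + ((1 - e2 * q) * (1 / n)) * v $ 2 + ((- q) * (1 / n)) * v $ 3)"
      unfolding q_def[symmetric] l_def by (rule ext) algebra
    then show "((\<lambda>z. ?g z $ 2) has_derivative
        (\<lambda>v. ((- (e1 * q)) * (1 / n)) * v $ 1 + ((1 - e2 * q) * (1 / n)) * v $ 2 + ((- q) * (1 / n)) * v $ 3)) (at y)"
      using quot[of 2] by (simp only: vector_3)
    have "((\<lambda>z. ln (N z)) has_derivative (\<lambda>v. l v * inverse (N y))) (at y)"
      using has_derivative_ln[OF _ dN[folded l_def]] n0 by (simp add: n_def mult.commute)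
    moreover have "(\<lambda>v. l v * inverse (N y)) = (\<lambda>v. (e1 * (1 / n)) * v $ 1 + (e2 * (1 / n)) * v $ 2 + (1 * (1 / n)) * v $ 3)"
      unfolding n_def[symmetric] l_def inverse_eq_divide by (rule ext) algebra
    ultimately show "((\<lambda>z. ?g z $ 3) has_derivative
        (\<lambda>v. (e1 * (1 / n)) * v $ 1 + (e2 * (1 / n)) * v $ 2 + (1 * (1 / n)) * v $ 3)) (at y)"
      by (simp only: vector_3)
    have "e1 * p \<le> 1" "- 1 \<le> e1 * p" "e2 * q \<le> 1" "- 1 \<le> e2 * q"
      using bb[OF e(1) pq(1)] bb[OF e(2) pq(2)] by linarith+
    then have "\<bar>1 - e1 * p\<bar> \<le> 2" "\<bar>1 - e2 * q\<bar> \<le> 2" by linarith+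
    from sc[OF this(1)] sc[OF this(2)]
    show "\<bar>(1 - e1 * p) * (1 / n)\<bar> \<le> 2 * (1 / n)" "\<bar>(1 - e2 * q) * (1 / n)\<bar> \<le> 2 * (1 / n)" .
    have "\<bar>- (e2 * p)\<bar> \<le> 2" "\<bar>- (e1 * q)\<bar> \<le> 2" "\<bar>- p\<bar> \<le> 2" "\<bar>- q\<bar> \<le> 2" "\<bar>e1\<bar> \<le> 2" "\<bar>e2\<bar> \<le> 2"
      using bb[OF e(2) pq(1)] bb[OF e(1) pq(2)] e pq by linarith+
    from this[THEN sc]
    show "\<bar>(- (e2 * p)) * (1 / n)\<bar> \<le> 2 * (1 / n)" "\<bar>(- (e1 * q)) * (1 / n)\<bar> \<le> 2 * (1 / n)"
      "\<bar>(- p) * (1 / n)\<bar> \<le> 2 * (1 / n)" "\<bar>(- q) * (1 / n)\<bar> \<le> 2 * (1 / n)"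
      "\<bar>e1 * (1 / n)\<bar> \<le> 2 * (1 / n)" "\<bar>e2 * (1 / n)\<bar> \<le> 2 * (1 / n)" .
    show "\<bar>1 * (1 / n)\<bar> \<le> 2 * (1 / n)" by (rule sc) simp
    show "1 * (1 / n) ^ 3 \<le> (1 - e1 * p) * (1 / n) * ((1 - e2 * q) * (1 / n) * (1 * (1 / n)) - (- q) * (1 / n) * (e2 * (1 / n))) -
       (- (e2 * p)) * (1 / n) * ((- (e1 * q)) * (1 / n) * (1 * (1 / n)) - (- q) * (1 / n) * (e1 * (1 / n))) +
       (- p) * (1 / n) * ((- (e1 * q)) * (1 / n) * (e2 * (1 / n)) - (1 - e2 * q) * (1 / n) * (e1 * (1 / n)))"
      by (simp add: power3_eq_cube algebra_simps)
  qed (use n0 in auto)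
  then show ?thesis
    by (rule qc_at_transform[OF _ S(1,2)]) (use S(3) in \<open>simp add: bip_chart_def N_def\<close>)
qed

lemma bip_chart_qc:
  assumes "0 < y $ 3" "\<bar>y $ 1\<bar> \<noteq> \<bar>y $ 2\<bar>"
  shows "qc_at (162 * 2 ^ 3 / 1) bip_chart y"
proof -
  have y0: "y \<noteq> 0" using assms by auto
  have 1: "open {z::real^3. 0 < z $ 3 \<and> \<bar>z $ 2\<bar> < \<bar>z $ 1\<bar> \<and> 0 < z $ 1}"
    "open {z::real^3. 0 < z $ 3 \<and> \<bar>z $ 2\<bar> < \<bar>z $ 1\<bar> \<and> z $ 1 < 0}"
    "open {z::real^3. 0 < z $ 3 \<and> \<bar>z $ 1\<bar> < \<bar>z $ 2\<bar> \<and> 0 < z $ 2}"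
    "open {z::real^3. 0 < z $ 3 \<and> \<bar>z $ 1\<bar> < \<bar>z $ 2\<bar> \<and> z $ 2 < 0}"
    by (intro open_Collect_conj open_Collect_less continuous_intros)+
  consider "\<bar>y $ 2\<bar> < \<bar>y $ 1\<bar>" "0 < y $ 1" | "\<bar>y $ 2\<bar> < \<bar>y $ 1\<bar>" "y $ 1 < 0"
    | "\<bar>y $ 1\<bar> < \<bar>y $ 2\<bar>" "0 < y $ 2" | "\<bar>y $ 1\<bar> < \<bar>y $ 2\<bar>" "y $ 2 < 0"
    using assms(2) by linarith
  then show ?thesis
  proof cases
    case 1
    then show ?thesis using assms(1)
      by (intro bip_chart_qc_linear[OF _ _ \<open>open {z::real^3. 0 < z $ 3 \<and> \<bar>z $ 2\<bar> < \<bar>z $ 1\<bar> \<and> 0 < z $ 1}\<close>, of 1 0])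
        (auto simp: bip_norm_def y0)
  next
    case 2
    then show ?thesis using assms(1)
      by (intro bip_chart_qc_linear[OF _ _ \<open>open {z::real^3. 0 < z $ 3 \<and> \<bar>z $ 2\<bar> < \<bar>z $ 1\<bar> \<and> z $ 1 < 0}\<close>, of "-1" 0])
        (auto simp: bip_norm_def y0)
  next
    case 3
    then show ?thesis using assms(1)
      by (intro bip_chart_qc_linear[OF _ _ \<open>open {z::real^3. 0 < z $ 3 \<and> \<bar>z $ 1\<bar> < \<bar>z $ 2\<bar> \<and> 0 < z $ 2}\<close>, of 0 1])
        (auto simp: bip_norm_def y0)
  next
    case 4
    then show ?thesis using assms(1)
      by (intro bip_chart_qc_linear[OF _ _ \<open>open {z::real^3. 0 < z $ 3 \<and> \<bar>z $ 1\<bar> < \<bar>z $ 2\<bar> \<and> z $ 2 < 0}\<close>, of 0 "-1"])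
        (auto simp: bip_norm_def y0)
  qed
qed

lemma negligible_abs_eq: "negligible {y::real^3. \<bar>y $ 1\<bar> = \<bar>y $ 2\<bar>}"
proof -
  have h: "negligible {y::real^3. (axis 1 1 + s *\<^sub>R axis 2 1) \<bullet> y = 0}" for s
  proof (rule negligible_hyperplane, rule disjI1)
    have "(axis 1 1 + s *\<^sub>R axis 2 1 :: real^3) $ 1 = 1" by (simp add: axis_def)
    then show "axis 1 1 + s *\<^sub>R axis 2 1 \<noteq> (0::real^3)" by (metis zero_index zero_neq_one)
  qed
  have "negligible ({y::real^3. (axis 1 1 + 1 *\<^sub>R axis 2 1) \<bullet> y = 0} \<union> {y. (axis 1 1 + (-1) *\<^sub>R axis 2 1) \<bullet> y = 0})"
    by (intro negligible_Un h)
  then show ?thesis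
    by (rule negligible_subset) (auto simp: inner_add_left inner_axis' abs_eq_iff inner_diff_left)
qed

section \<open>Radial extension of h from the bipyramid to the sphere\<close>

context zorich
begin

text \<open>Agrees with \<open>Z (bip_chart y)\<close> away from the origin, but avoids the
  logarithm, so that it also takes the right value 0 at the origin.\<close>

definition bip_extension_upper :: "real^3 \<Rightarrow> real^3" where
  "bip_extension_upper y = bip_norm y *\<^sub>R h (base_point (bip_chart y))"

text \<open>This is Psi of the overview.\<close>

definition bip_extension :: "real^3 \<Rightarrow> real^3" where
  "bip_extension = reflect_extension bip_extension_upper"

definition bip_distortion :: real where "bip_distortion = 162 * 2 ^ 3 / 1 * Z_distortion"

lemma base_point_bip_chart: "base_point (bip_chart y) \<in> square"
  by (simp only: base_point_in_square bip_chart_prism)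

lemma h_boundary:
  assumes "a \<in> square" "\<bar>a $ 1\<bar> = 1 \<or> \<bar>a $ 2\<bar> = 1"
  shows "h a $ 3 = 0"
proof -
  define x :: "real^3" where "x = vector [a $ 1, a $ 2, 0]"
  have b: "base_point x = a" by (simp add: x_def vec_eq_iff forall_2)
  then have "x \<in> prism" using assms(1) by (metis base_point_in_square)
  then have "Z x = h a" by (simp add: Z_prism b) (simp add: x_def)
  moreover have "Z x $ 3 = 0"
    using assms(2) Z_wall[of 1 x] Z_wall[of 2 x] by (auto simp: x_def)
  ultimately show ?thesis by simp
qed

lemma norm_bip_extension: "norm (bip_extension y) = bip_norm y"
proof -
  have 1: "norm (bip_extension_upper y) = bip_norm y" for y
    using bip_norm_nonneg[of y] norm_h[OF base_point_bip_chart[of y]] by (simp add: bip_extension_upper_def)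
  have "bip_norm (reflect_plane 3 0 y) = bip_norm y" by (simp add: bip_norm_def)
  then show ?thesis by (simp add: bip_extension_def reflect_extension_def 1)
qed

text \<open>Radial and lateral parts are separated. The radial part contributes the 2 from
  \<open>bip_norm_diff_le\<close>; each of the two lateral coordinates contributes 3, multiplied by
  \<open>L\<close> through \<open>h\<close>.\<close>

lemma bip_extension_upper_lipschitz: "norm (bip_extension_upper x - bip_extension_upper y) \<le> (2 + 6 * L) * norm (x - y)"
proof -
  let ?a = "base_point (bip_chart x)" and ?b = "base_point (bip_chart y)"
  define N where "N = bip_norm x"
  define M where "M = bip_norm y"
  have N: "0 \<le> N" and M: "0 \<le> M" by (simp_all add: N_def M_def bip_norm_nonneg)
  have NM: "\<bar>N - M\<bar> \<le> 2 * norm (x - y)" unfolding N_def M_def by (rule bip_norm_diff_le)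
  have comp: "\<bar>M * (x $ i / N - y $ i / M)\<bar> \<le> 3 * norm (x - y)" if i: "i \<in> {1, 2}" for i
  proof -
    have c: "\<bar>x $ i - y $ i\<bar> \<le> norm (x - y)" using component_le_norm_cart[of "x - y" i] by simp
    have x0: "x $ i = 0" if "N = 0" using that by (simp add: N_def bip_norm_eq_0)
    have y0: "y $ i = 0" if "M = 0" using that by (simp add: M_def bip_norm_eq_0)
    have "\<bar>x $ i / N\<bar> \<le> 1" using bip_chart_prism[of x] i by (auto simp: prism_def N_def)
    then have "\<bar>M - N\<bar> * \<bar>x $ i / N\<bar> \<le> \<bar>M - N\<bar> * 1" by (intro mult_left_mono) auto
    then have "\<bar>(M - N) * (x $ i / N)\<bar> \<le> \<bar>N - M\<bar>"
      unfolding abs_mult[of "M - N"] abs_minus_commute[of N M] by simp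
    \<comment> \<open>Also true if \<open>N\<close> or \<open>M\<close> is 0: the coordinate itself
      is then 0, and division by 0 yields 0.\<close>
    moreover have "M * (x $ i / N - y $ i / M) = (M - N) * (x $ i / N) + (x $ i - y $ i)"
      using x0 y0 by (cases "N = 0"; cases "M = 0") (simp_all add: field_simps)
    ultimately show ?thesis
      using c NM abs_triangle_ineq[of "(M - N) * (x $ i / N)" "x $ i - y $ i"] by linarith
  qed
  have "bip_extension_upper x - bip_extension_upper y = (N - M) *\<^sub>R h ?a + M *\<^sub>R (h ?a - h ?b)"
    by (simp add: bip_extension_upper_def N_def M_def algebra_simps)
  then have "norm (bip_extension_upper x - bip_extension_upper y) \<le> \<bar>N - M\<bar> * norm (h ?a) + M * norm (h ?a - h ?b)"
    using norm_triangle_ineq[of "(N - M) *\<^sub>R h ?a" "M *\<^sub>R (h ?a - h ?b)"] M by simp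
  also have "norm (h ?a) = 1" by (rule norm_h[OF base_point_bip_chart])
  also have "M * norm (h ?a - h ?b) \<le> M * (L * norm (?a - ?b))"
    by (intro mult_left_mono h_lipschitz base_point_bip_chart M)
  also have "M * (L * norm (?a - ?b)) = L * (M * norm (?a - ?b))" by (rule mult.left_commute)
  also have "M * norm (?a - ?b) \<le> M * (\<bar>x $ 1 / N - y $ 1 / M\<bar> + \<bar>x $ 2 / N - y $ 2 / M\<bar>)"
    using norm_base_point_diff_le_sum[of "bip_chart x" "bip_chart y"] M
    by (intro mult_left_mono) (simp_all add: N_def M_def)
  also have "\<dots> = \<bar>M * (x $ 1 / N - y $ 1 / M)\<bar> + \<bar>M * (x $ 2 / N - y $ 2 / M)\<bar>"
    using M by (simp add: abs_mult distrib_left)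
  also have "\<dots> \<le> 3 * norm (x - y) + 3 * norm (x - y)" by (intro add_mono comp) auto
  finally have "norm (bip_extension_upper x - bip_extension_upper y) \<le> \<bar>N - M\<bar> * 1 + L * (3 * norm (x - y) + 3 * norm (x - y))"
    using L by simp
  then show ?thesis using NM by (simp add: algebra_simps)
qed

lemma bip_extension_upper_flat:
  assumes "y $ 3 = 0"
  shows "bip_extension_upper y $ 3 = 0"
proof (cases "y = 0")
  case True
  then show ?thesis by (simp add: bip_extension_upper_def bip_norm_def)
next
  case False
  have N: "bip_norm y = max \<bar>y $ 1\<bar> \<bar>y $ 2\<bar>" "0 < bip_norm y"
    using assms False bip_norm_nonneg[of y] bip_norm_eq_0[of y] by (simp_all add: bip_norm_def)
  then have "\<bar>y $ 1 / bip_norm y\<bar> = 1 \<or> \<bar>y $ 2 / bip_norm y\<bar> = 1"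
    by (auto simp: abs_divide max_def split: if_splits)
  then have "h (base_point (bip_chart y)) $ 3 = 0"
    by (intro h_boundary base_point_bip_chart) simp
  then show ?thesis by (simp add: bip_extension_upper_def)
qed

lemma bip_extension_lipschitz: "norm (bip_extension x - bip_extension y) \<le> 3 * (2 + 6 * L) * norm (x - y)"
  unfolding bip_extension_def
proof (rule reflect_extension_lipschitz[where V = UNIV])
  fix v :: "real^3" assume v: "0 \<le> v $ 3"
  have "\<bar>bip_extension_upper v $ 3\<bar> = \<bar>(bip_extension_upper v - bip_extension_upper (update 3 0 v)) $ 3\<bar>"
    using bip_extension_upper_flat[of "update 3 0 v"] by simp
  also have "\<dots> \<le> norm (bip_extension_upper v - bip_extension_upper (update 3 0 v))" by (rule component_le_norm_cart)
  also have "\<dots> \<le> (2 + 6 * L) * norm (v - update 3 0 v)" by (rule bip_extension_upper_lipschitz)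
  also have "v - update 3 0 v = v $ 3 *\<^sub>R axis 3 1" by (simp add: vec_eq_iff axis_def)
  also have "norm (v $ 3 *\<^sub>R axis 3 1 :: real^3) = v $ 3" using v by simp
  finally show "\<bar>bip_extension_upper v $ 3\<bar> \<le> (2 + 6 * L) * v $ 3" .
qed (use L bip_extension_upper_lipschitz in auto)

lemma bip_extension_flat: "y $ 3 = 0 \<Longrightarrow> bip_extension y $ 3 = 0"
  by (simp add: bip_extension_def reflect_extension_def bip_extension_upper_flat)

lemma bip_extension_reflect: "bip_extension (reflect_plane 3 0 y) = reflect_plane 3 0 (bip_extension y)"
proof (cases "y $ 3 = 0")
  case True
  then have "reflect_plane 3 0 y = y" by (simp add: vec_eq_iff)
  moreover have "reflect_plane 3 0 (bip_extension y) = bip_extension y" using bip_extension_flat[OF True] by (simp add: vec_eq_iff)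
  ultimately show ?thesis by simp
qed (auto simp: bip_extension_def reflect_extension_def)

lemma bip_extension_not_qc: "negligible {y. \<not> qc_at bip_distortion bip_extension y}"
proof -
  define U where "U = {y::real^3. 0 < y $ 3 \<and> \<bar>y $ 1\<bar> \<noteq> \<bar>y $ 2\<bar>}"
  have "{y \<in> U. \<not> qc_at (162 * 2 ^ 3 / 1) bip_chart y} = {}" using bip_chart_qc by (auto simp: U_def)
  then have "negligible {y \<in> U. \<not> qc_at (162 * 2 ^ 3 / 1) bip_chart y}" by (simp only: negligible_empty)
  then have neg: "negligible {y \<in> U. \<not> qc_at (162 * 2 ^ 3 / 1 * Z_distortion) (\<lambda>y. Z (bip_chart y)) y}"
    by (rule negligible_not_qc_compose[where V = UNIV and g = Z]) (use Z_not_qc in simp_all)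
  have up: "bip_extension_upper y = Z (bip_chart y)" if "0 < y $ 3" for y
  proof -
    have "y \<noteq> 0" using that by auto
    then have "0 < bip_norm y" using bip_norm_nonneg[of y] bip_norm_eq_0[of y] by simp
    then show ?thesis by (simp add: Z_prism[OF bip_chart_prism] bip_extension_upper_def)
  qed
  have op: "open {y::real^3. 0 < y $ 3}" by (intro open_Collect_less continuous_intros)
  have "negligible ({y \<in> U. \<not> qc_at (162 * 2 ^ 3 / 1 * Z_distortion) (\<lambda>y. Z (bip_chart y)) y} \<union> {y. \<bar>y $ 1\<bar> = \<bar>y $ 2\<bar>})"
    by (intro negligible_Un neg negligible_abs_eq)
  then have "negligible {y \<in> UNIV. 0 < y $ 3 \<and> \<not> qc_at bip_distortion bip_extension_upper y}"
  proof (rule negligible_subset)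
    have "qc_at bip_distortion bip_extension_upper y" if "qc_at (162 * 2 ^ 3 / 1 * Z_distortion) (\<lambda>y. Z (bip_chart y)) y" "0 < y $ 3" for y
      unfolding bip_distortion_def by (rule qc_at_transform[OF that(1) op]) (use that(2) up in auto)
    then show "{y \<in> UNIV. 0 < y $ 3 \<and> \<not> qc_at bip_distortion bip_extension_upper y} \<subseteq>
        {y \<in> U. \<not> qc_at (162 * 2 ^ 3 / 1 * Z_distortion) (\<lambda>y. Z (bip_chart y)) y} \<union> {y. \<bar>y $ 1\<bar> = \<bar>y $ 2\<bar>}"
      unfolding U_def by blast
  qed
  then have "negligible {y \<in> UNIV. \<not> qc_at bip_distortion bip_extension y}"
    unfolding bip_extension_def by (rule reflect_extension_not_qc) simp
  then show ?thesis by simp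
qed

end

section \<open>Interpolation in the model\<close>

lemma has_derivative_abs_nonzero:
  fixes g :: "'a::real_normed_vector \<Rightarrow> real"
  assumes g: "(g has_derivative g') (at x)" and "g x \<noteq> 0"
  shows "((\<lambda>x. \<bar>g x\<bar>) has_derivative (\<lambda>v. g' v * sgn (g x))) (at x)"
proof -
  have "(abs has_real_derivative sgn (g x)) (at (g x))"
  proof (cases "0 < g x")
    case True
    have "(abs has_real_derivative 1) (at (g x))"
      by (rule has_field_derivative_transform_within_open[OF DERIV_ident, where S = "{0<..}"]) (use True in auto)
    then show ?thesis using True by simp
  next
    case False
    then have neg: "g x < 0" using assms(2) by simp
    have "(abs has_real_derivative - 1) (at (g x))"
      by (rule has_field_derivative_transform_within_open[OF DERIV_minus[OF DERIV_ident], where S = "{..<0}"])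
         (use neg in auto)
    then show ?thesis using neg by simp
  qed
  then show ?thesis using g by (rule DERIV_compose_FDERIV)
qed

lemma negligible_coordinate_plane:
  assumes "i \<noteq> (3::3)" "p \<noteq> 0"
  shows "negligible {x::real^3. p * x $ i + q * x $ 3 = b}"
proof -
  have "(p *\<^sub>R axis i 1 + q *\<^sub>R axis 3 1 :: real^3) $ i = p" using assms by (simp add: axis_def)
  then have "p *\<^sub>R axis i 1 + q *\<^sub>R axis 3 1 \<noteq> (0::real^3)" using assms(2) by force
  then have "negligible {x::real^3. (p *\<^sub>R axis i 1 + q *\<^sub>R axis 3 1) \<bullet> x = b}"
    by (intro negligible_hyperplane disjI1)
  then show ?thesis by (simp add: inner_add_left inner_axis')
qed

text \<open>The slice of the model map at height \<open>s\<close> consists of the inner part \<open>\<bar>a\<bar> \<le> width s\<close>, a copy of the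
  bipyramid of radius \<open>height s\<close>, and of an outer part which grows from the wall \<open>\<bar>a\<bar> = 1\<close> and is folded at
  height 1. The pair of \<open>lateral\<close> and \<open>axial\<close> solves the interpolation problem in the plane; the
  third coordinate of the spatial map combines the two values of \<open>axial\<close>.\<close>

definition radius :: real where "radius = exp 3"
definition width :: "real \<Rightarrow> real" where "width s = 1 - 2 / 3 * s"
definition height :: "real \<Rightarrow> real" where "height s = 1 + (radius - 1) * s"
definition slope :: "real \<Rightarrow> real" where "slope s = height s / width s"
definition clamp :: "real \<Rightarrow> real \<Rightarrow> real" where "clamp a s = max (- width s) (min (width s) a)"
text \<open>The slope \<open>3 * radius\<close> of the outer part is dictated by height 1, where the
  absolute value of the argument runs over an interval of length 2/3 while the value goes from
  \<open>radius\<close> to \<open>- radius\<close>; it is kept at all heights. \<open>clamp\<close>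
  joins both parts in one formula, which makes the Lipschitz estimates direct.\<close>

definition lateral :: "real \<Rightarrow> real \<Rightarrow> real" where
  "lateral a s = slope s * clamp a s - 3 * radius * (a - clamp a s)"
definition axial :: "real \<Rightarrow> real \<Rightarrow> real" where
  "axial a s = slope s * (width s - \<bar>clamp a s\<bar>) - 3 * radius * max 0 (min (\<bar>a\<bar> - width s) (1 - \<bar>a\<bar>))"
text \<open>The product of the two signs with the smaller absolute value, in a form that is visibly
  Lipschitz. The sign rule mirrors the fact that two reflections of \<open>Z\<close>, one in each
  direction, cancel.\<close>

definition signed_min :: "real \<Rightarrow> real \<Rightarrow> real" where
  "signed_min p q = (\<bar>p + q\<bar> - \<bar>p - q\<bar>) / 2"
text \<open>This is Q of the overview; it is used for heights between 0 and 1.\<close>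

definition model_map :: "real^3 \<Rightarrow> real^3" where
  "model_map x = vector [lateral (x $ 1) (x $ 3), lateral (x $ 2) (x $ 3), signed_min (axial (x $ 1) (x $ 3)) (axial (x $ 2) (x $ 3))]"

lemma model_map_nth [simp]:
  "model_map x $ 1 = lateral (x $ 1) (x $ 3)" "model_map x $ 2 = lateral (x $ 2) (x $ 3)"
  "model_map x $ 3 = signed_min (axial (x $ 1) (x $ 3)) (axial (x $ 2) (x $ 3))"
  by (simp_all add: model_map_def)

section \<open>Range and boundary values of the model map\<close>

lemma radius_ge: "4 \<le> radius"
  unfolding radius_def using exp_ge_add_one_self[of "3::real"] by linarith

lemma width_bounds: "0 \<le> s \<Longrightarrow> s \<le> 1 \<Longrightarrow> 1 / 3 \<le> width s \<and> width s \<le> 1"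
  unfolding width_def by argo

lemma height_bounds:
  assumes "0 \<le> s" "s \<le> 1"
  shows "1 \<le> height s" "height s \<le> radius"
proof -
  have "0 \<le> (radius - 1) * s" using radius_ge assms by simp
  then show "1 \<le> height s" by (simp add: height_def)
  have "(radius - 1) * s \<le> (radius - 1) * 1" using radius_ge assms by (intro mult_left_mono) auto
  then show "height s \<le> radius" by (simp add: height_def)
qed

lemma slope_bounds:
  assumes "0 \<le> s" "s \<le> 1"
  shows "1 \<le> slope s" "slope s \<le> 3 * radius"
proof -
  have w: "1 / 3 \<le> width s" "width s \<le> 1" using width_bounds assms by auto
  have w0: "0 < width s" using w(1) by argo
  have "width s \<le> height s" using w(2) height_bounds(1)[OF assms] by argo
  then show "1 \<le> slope s" unfolding slope_def by (subst le_divide_eq_1_pos[OF w0])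
  have "height s \<le> radius" by (rule height_bounds[OF assms])
  moreover have "radius * 1 \<le> radius * (3 * width s)" using w radius_ge by (intro mult_left_mono) auto
  moreover have "radius * (3 * width s) = 3 * radius * width s" by simp
  ultimately have "height s \<le> 3 * radius * width s" by argo
  then show "slope s \<le> 3 * radius" unfolding slope_def by (subst pos_divide_le_eq[OF w0])
qed

lemma slope_width: "0 \<le> s \<Longrightarrow> s \<le> 1 \<Longrightarrow> slope s * width s = height s"
  using width_bounds[of s] by (simp add: slope_def)

lemma profile_inner:
  assumes "\<bar>a\<bar> \<le> width s" "width s \<le> 1"
  shows "lateral a s = slope s * a" "axial a s = slope s * (width s - \<bar>a\<bar>)"
proof -
  have "clamp a s = a" using assms by (simp add: clamp_def)
  moreover have "max 0 (min (\<bar>a\<bar> - width s) (1 - \<bar>a\<bar>)) = 0" using assms by simp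
  ultimately show "lateral a s = slope s * a" "axial a s = slope s * (width s - \<bar>a\<bar>)" by (simp_all add: lateral_def axial_def)
qed

lemma profile_outer:
  assumes "width s \<le> \<bar>a\<bar>" "\<bar>a\<bar> \<le> 1" "0 \<le> width s"
  shows "lateral a s = sgn a * (slope s * width s - 3 * radius * (\<bar>a\<bar> - width s))"
    "axial a s = - (3 * radius * min (\<bar>a\<bar> - width s) (1 - \<bar>a\<bar>))"
proof -
  have c: "clamp a s = sgn a * width s" using assms by (auto simp: clamp_def sgn_if)
  have "a = sgn a * \<bar>a\<bar>" by (rule sgn_mult_abs[symmetric])
  then have "a - sgn a * width s = sgn a * (\<bar>a\<bar> - width s)" by (simp add: right_diff_distrib)
  then show "lateral a s = sgn a * (slope s * width s - 3 * radius * (\<bar>a\<bar> - width s))"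
    by (simp add: lateral_def c algebra_simps)
  have "\<bar>clamp a s\<bar> = width s" using assms by (auto simp: c abs_mult abs_sgn_eq)
  moreover have "max 0 (min (\<bar>a\<bar> - width s) (1 - \<bar>a\<bar>)) = min (\<bar>a\<bar> - width s) (1 - \<bar>a\<bar>)" using assms by simp
  ultimately show "axial a s = - (3 * radius * min (\<bar>a\<bar> - width s) (1 - \<bar>a\<bar>))" by (simp add: axial_def)
qed

lemma axial_boundary: "\<bar>a\<bar> = 1 \<Longrightarrow> 0 \<le> s \<Longrightarrow> s \<le> 1 \<Longrightarrow> axial a s = 0"
  using profile_outer[of s a] width_bounds[of s] by simp

lemma signed_min_0 [simp]: "signed_min 0 q = 0" "signed_min p 0 = 0"
  by (simp_all add: signed_min_def)

lemma model_map_flat: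
  assumes "\<bar>x $ 1\<bar> = 1 \<or> \<bar>x $ 2\<bar> = 1" "0 \<le> x $ 3" "x $ 3 \<le> 1"
  shows "model_map x $ 3 = 0"
  using assms by (auto simp: axial_boundary)

lemma abs_signed_min: "\<bar>signed_min p q\<bar> = min \<bar>p\<bar> \<bar>q\<bar>"
  unfolding signed_min_def min_def abs_if by (simp split: if_splits) 

text \<open>On the inner part and on the first half of the fold the sum is exactly
  \<open>height s\<close>. On the second half \<open>lateral\<close> may change sign, and the bound
  is checked for both signs. This confines the model to the bipyramid of radius
  \<open>exp 3\<close>, and thus the final map to the ball.\<close>

lemma profile_bound:
  assumes a: "\<bar>a\<bar> \<le> 1" and s: "0 \<le> s" "s \<le> 1"
  shows "\<bar>lateral a s\<bar> + \<bar>axial a s\<bar> \<le> radius"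
proof (cases "\<bar>a\<bar> \<le> width s")
  case True
  have w: "width s \<le> 1" using width_bounds s by auto
  have k: "0 \<le> slope s" using slope_bounds[OF s] by simp
  have "\<bar>lateral a s\<bar> + \<bar>axial a s\<bar> = slope s * \<bar>a\<bar> + slope s * (width s - \<bar>a\<bar>)"
    using True k by (simp add: profile_inner[OF True w] abs_mult)
  also have "\<dots> = height s" by (simp add: slope_width[OF s, symmetric] right_diff_distrib)
  finally show ?thesis using height_bounds[OF s] by simp
next
  case False
  have w: "1 / 3 \<le> width s" using width_bounds s by auto
  have wa: "width s \<le> \<bar>a\<bar>" using False by simp
  have "a \<noteq> 0" using wa w by auto
  define u where "u = radius * \<bar>a\<bar>"
  define v where "v = radius * width s"
  have uv: "v \<le> u" "u \<le> radius" using wa a radius_ge by (simp_all add: u_def v_def)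
  have lateral: "\<bar>lateral a s\<bar> = \<bar>height s - (3 * u - 3 * v)\<bar>"
  proof -
    have *: "3 * radius * (\<bar>a\<bar> - width s) = 3 * u - 3 * v" by (simp add: u_def v_def right_diff_distrib)
    have "0 \<le> width s" using w by argo
    from profile_outer(1)[OF wa a this] have "lateral a s = sgn a * (height s - (3 * u - 3 * v))"
      by (simp only: slope_width[OF s] *)
    then show ?thesis using \<open>a \<noteq> 0\<close> by (simp only: abs_mult abs_sgn_eq) simp
  qed
  have r: "height s \<le> radius" "1 \<le> height s" using height_bounds[OF s] by auto
  have v: "3 * v = 3 * radius - 2 * radius * s" by (simp add: v_def width_def algebra_simps)
  have rs: "height s = 1 + radius * s - s" by (simp add: height_def algebra_simps)
  show ?thesis
  proof (cases "\<bar>a\<bar> - width s \<le> 1 - \<bar>a\<bar>")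
    case True
    then have "axial a s = - (3 * u - 3 * v)"
      using profile_outer(2)[OF wa a] w by (simp add: u_def v_def right_diff_distrib)
    then have "\<bar>axial a s\<bar> = 3 * u - 3 * v" using uv(1) by simp
    \<comment> \<open>So \<open>lateral\<close> has not changed sign yet, and the two absolute
      values add up to \<open>height s\<close>.\<close>
    moreover have "3 * u - 3 * v \<le> height s"
    proof -
      have "radius * (2 * \<bar>a\<bar>) \<le> radius * (1 + width s)" using True radius_ge by (intro mult_left_mono) auto
      then have "2 * u \<le> radius + v" by (simp add: u_def v_def algebra_simps)
      then show ?thesis using v rs s radius_ge by argo
    qed
    ultimately show ?thesis using lateral r by simp
  next
    case False
    then have "axial a s = - (3 * radius - 3 * u)"
      using profile_outer(2)[OF wa a] w by (simp add: u_def right_diff_distrib)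
    then have axial: "\<bar>axial a s\<bar> = 3 * radius - 3 * u" using uv(2) by simp
    have "radius * (1 + width s) \<le> radius * (2 * \<bar>a\<bar>)" using False radius_ge by (intro mult_left_mono) auto
    then have "radius + v \<le> 2 * u" by (simp add: u_def v_def algebra_simps)
    moreover have "radius * s \<le> radius" using s radius_ge by (simp add: mult_left_le)
    ultimately have "height s - (3 * u - 3 * v) + (3 * radius - 3 * u) \<le> radius" "- (height s - (3 * u - 3 * v)) + (3 * radius - 3 * u) \<le> radius"
      using v rs s r radius_ge by argo+
    then show ?thesis unfolding lateral axial by linarith
  qed
qed

text \<open>Whichever coordinate attains the maximum of the \<open>lateral\<close> values, the
  absolute value of its own \<open>axial\<close> is at least the minimum, so the plane bound for
  that coordinate suffices.\<close>

lemma bip_norm_model_map: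
  assumes "x \<in> prism" "0 \<le> x $ 3" "x $ 3 \<le> 1"
  shows "bip_norm (model_map x) \<le> radius"
  using profile_bound[of "x $ 1" "x $ 3"] profile_bound[of "x $ 2" "x $ 3"] assms
  by (auto simp: bip_norm_def abs_signed_min prism_def max_def min_def)

lemma model_map_bottom:
  assumes "x \<in> prism" "x $ 3 = 0"
  shows "model_map x = vector [x $ 1, x $ 2, 1 - max \<bar>x $ 1\<bar> \<bar>x $ 2\<bar>]"
proof -
  have "lateral a 0 = a" "axial a 0 = 1 - \<bar>a\<bar>" if "\<bar>a\<bar> \<le> 1" for a
    using profile_inner[of a 0] that by (simp_all add: width_def height_def slope_def)
  moreover have "signed_min p q = min p q" if "0 \<le> p" "0 \<le> q" for p q
    using that by (simp add: signed_min_def min_def)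
  ultimately show ?thesis using assms
    by (simp add: vec_eq_iff forall_3 prism_def min_def max_def)
qed

text \<open>In the outer thirds \<open>2 * sgn a - 3 * a\<close> is the reflection of
  \<open>3 * a\<close> in the wall \<open>sgn a\<close>. So the profile at the top is a single tent
  composed with this folding, and a reflection shows up as the sign of \<open>axial\<close>.\<close>

lemma profile_top:
  shows "\<bar>a\<bar> \<le> 1 / 3 \<Longrightarrow> lateral a 1 = radius * (3 * a)" "\<bar>a\<bar> \<le> 1 / 3 \<Longrightarrow> axial a 1 = radius * (1 - \<bar>3 * a\<bar>)"
    "1 / 3 \<le> \<bar>a\<bar> \<Longrightarrow> \<bar>a\<bar> \<le> 1 \<Longrightarrow> lateral a 1 = radius * (2 * sgn a - 3 * a)"
    "1 / 3 \<le> \<bar>a\<bar> \<Longrightarrow> \<bar>a\<bar> \<le> 1 \<Longrightarrow> axial a 1 = - (radius * (1 - \<bar>2 * sgn a - 3 * a\<bar>))"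
proof -
  have w: "width 1 = 1 / 3" and r: "height 1 = radius" and k: "slope 1 = 3 * radius" by (simp_all add: width_def height_def slope_def)
  show "lateral a 1 = radius * (3 * a)" "axial a 1 = radius * (1 - \<bar>3 * a\<bar>)" if "\<bar>a\<bar> \<le> 1 / 3"
    using profile_inner[of a 1] that by (simp_all add: w k abs_mult algebra_simps)
  assume a: "1 / 3 \<le> \<bar>a\<bar>" "\<bar>a\<bar> \<le> 1"
  then have "a \<noteq> 0" by auto
  have *: "2 * sgn a - 3 * a = sgn a * (2 - 3 * \<bar>a\<bar>)" by (simp add: right_diff_distrib sgn_mult_abs)
  show "lateral a 1 = radius * (2 * sgn a - 3 * a)"
    unfolding * using profile_outer(1)[of 1 a] a by (simp add: w k algebra_simps)
  have "\<bar>2 * sgn a - 3 * a\<bar> = \<bar>2 - 3 * \<bar>a\<bar>\<bar>" unfolding * using \<open>a \<noteq> 0\<close> by (simp add: abs_mult abs_sgn_eq)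
  moreover have "3 * min (\<bar>a\<bar> - 1 / 3) (1 - \<bar>a\<bar>) = 1 - \<bar>2 - 3 * \<bar>a\<bar>\<bar>" by (simp add: min_def abs_if)
  moreover have "axial a 1 = - (radius * (3 * min (\<bar>a\<bar> - 1 / 3) (1 - \<bar>a\<bar>)))"
    using profile_outer(2)[of 1 a] a by (simp add: w)
  ultimately show "axial a 1 = - (radius * (1 - \<bar>2 * sgn a - 3 * a\<bar>))" by simp
qed

section \<open>Lipschitz estimates for the model map\<close>

lemma abs_max_min_diff_le:
  fixes a b c d e :: real
  assumes "\<bar>a - c\<bar> \<le> e" "\<bar>b - d\<bar> \<le> e"
  shows "\<bar>max a b - max c d\<bar> \<le> e" "\<bar>min a b - min c d\<bar> \<le> e"
proof -
  have *: "\<bar>max a b - max c d\<bar> \<le> e" if "\<bar>a - c\<bar> \<le> e" "\<bar>b - d\<bar> \<le> e" for a b c d :: real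
  proof -
    have "a \<le> max c d + e" "b \<le> max c d + e" "c \<le> max a b + e" "d \<le> max a b + e"
      using that max.cobounded1[of c d] max.cobounded2[of d c] max.cobounded1[of a b] max.cobounded2[of b a]
      by argo+
    then have "max a b \<le> max c d + e" "max c d \<le> max a b + e" by (simp_all only: max.bounded_iff)
    then show ?thesis by argo
  qed
  then show "\<bar>max a b - max c d\<bar> \<le> e" using assms by blast
  have "\<bar>(- a) - (- c)\<bar> \<le> e" "\<bar>(- b) - (- d)\<bar> \<le> e" using assms by argo+
  then have "\<bar>max (- a) (- b) - max (- c) (- d)\<bar> \<le> e" by (rule *)
  moreover have "max (- a) (- b) = - min a b" "max (- c) (- d) = - min c d" by (simp_all add: minus_min_eq_max)
  ultimately show "\<bar>min a b - min c d\<bar> \<le> e" by argo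
qed

lemma abs_mult_diff_le:
  fixes p q p' q' :: real
  assumes "\<bar>p - p'\<bar> \<le> A" "\<bar>q\<bar> \<le> B" "\<bar>p'\<bar> \<le> C" "\<bar>q - q'\<bar> \<le> D"
  shows "\<bar>p * q - p' * q'\<bar> \<le> A * B + C * D"
proof -
  have "p * q - p' * q' = (p - p') * q + p' * (q - q')" by (simp add: algebra_simps)
  also have "\<bar>\<dots>\<bar> \<le> \<bar>(p - p') * q\<bar> + \<bar>p' * (q - q')\<bar>" by (rule abs_triangle_ineq)
  also have "\<dots> \<le> A * B + C * D"
    unfolding abs_mult
    by (intro add_mono mult_mono assms abs_ge_zero order_trans[OF abs_ge_zero assms(1)] order_trans[OF abs_ge_zero assms(3)])
  finally show ?thesis .
qed

lemma slope_diff_le: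
  assumes s: "0 \<le> s" "s \<le> 1" and t: "0 \<le> t" "t \<le> 1"
  shows "\<bar>slope s - slope t\<bar> \<le> 9 * radius * \<bar>s - t\<bar>"
proof -
  have w: "1 / 3 \<le> width s" "1 / 3 \<le> width t" using width_bounds s t by auto
  have "1 / 3 * (1 / 3) \<le> width s * width t" using w by (intro mult_mono) auto
  then have w9: "1 \<le> 9 * (width s * width t)" by argo
  then have ww: "0 < width s * width t" by argo
  have "slope s - slope t = (height s * width t - height t * width s) / (width s * width t)"
    using w by (simp add: slope_def diff_frac_eq)
  also have "height s * width t - height t * width s = (radius - 1 / 3) * (s - t)"
    unfolding height_def width_def by algebra
  finally have "\<bar>slope s - slope t\<bar> = \<bar>(radius - 1 / 3) * (s - t)\<bar> / (width s * width t)"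
    by (simp only: abs_divide abs_of_pos[OF ww])
  also have "\<bar>(radius - 1 / 3) * (s - t)\<bar> = (radius - 1 / 3) * \<bar>s - t\<bar>" using radius_ge by (simp add: abs_mult)
  finally have "\<bar>slope s - slope t\<bar> = (radius - 1 / 3) * \<bar>s - t\<bar> / (width s * width t)" .
  also have "\<dots> \<le> radius * \<bar>s - t\<bar> * 9"
  proof (subst pos_divide_le_eq[OF ww])
    have "(radius - 1 / 3) * \<bar>s - t\<bar> \<le> radius * \<bar>s - t\<bar>" by (intro mult_right_mono) auto
    moreover have "radius * \<bar>s - t\<bar> * 1 \<le> radius * \<bar>s - t\<bar> * (9 * (width s * width t))"
      using radius_ge by (intro mult_left_mono w9) simp
    ultimately show "(radius - 1 / 3) * \<bar>s - t\<bar> \<le> radius * \<bar>s - t\<bar> * 9 * (width s * width t)"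
      by (simp only: mult.assoc mult_1_right) 
  qed
  finally show ?thesis by (simp only: mult_ac)
qed

text \<open>The factor 30 leaves slack: the contributions add up to 18 for \<open>lateral\<close>
  and to 21 for \<open>axial\<close>. They involve only \<open>radius\<close>, because
  \<open>width\<close> never drops below 1/3.\<close>

lemma profile_lipschitz:
  assumes a: "\<bar>a\<bar> \<le> 1" "\<bar>b\<bar> \<le> 1" and s: "0 \<le> s" "s \<le> 1" "0 \<le> t" "t \<le> 1"
    and \<delta>: "\<bar>a - b\<bar> \<le> \<delta>" "\<bar>s - t\<bar> \<le> \<delta>"
  shows "\<bar>lateral a s - lateral b t\<bar> \<le> 30 * radius * \<delta>" "\<bar>axial a s - axial b t\<bar> \<le> 30 * radius * \<delta>"
proof -
  have \<delta>0: "0 \<le> \<delta>" using \<delta>(1) abs_ge_zero order_trans by blast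
  have w: "1 / 3 \<le> width s" "1 / 3 \<le> width t" "width s \<le> 1" "width t \<le> 1" using width_bounds s by auto
  have wst: "\<bar>width s - width t\<bar> \<le> \<delta>" using \<delta>(2) unfolding width_def by argo
  have k: "\<bar>slope s - slope t\<bar> \<le> 9 * radius * \<delta>"
    by (rule order_trans[OF slope_diff_le[OF s] mult_left_mono[OF \<delta>(2)]]) (use radius_ge in simp)
  have kt: "\<bar>slope t\<bar> \<le> 3 * radius" using slope_bounds[OF s(3,4)] by simp
  let ?c = "clamp a s" and ?d = "clamp b t"
  have cd: "\<bar>?c - ?d\<bar> \<le> \<delta>"
    unfolding clamp_def by (intro abs_max_min_diff_le \<delta>(1) wst) (use wst in argo)
  have cw: "\<bar>?c\<bar> \<le> width s" using w by (auto simp: clamp_def)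
  then have c1: "\<bar>?c\<bar> \<le> 1" "\<bar>width s - \<bar>?c\<bar>\<bar> \<le> 1" using w abs_ge_zero[of ?c] by argo+
  have acd: "\<bar>\<bar>?c\<bar> - \<bar>?d\<bar>\<bar> \<le> \<delta>" using abs_triangle_ineq3 cd by (rule order_trans)
  have aab: "\<bar>\<bar>a\<bar> - \<bar>b\<bar>\<bar> \<le> \<delta>" using abs_triangle_ineq3 \<delta>(1) by (rule order_trans)
  have M3: "\<bar>3 * radius * x - 3 * radius * y\<bar> \<le> 6 * radius * \<delta>" if "\<bar>x - y\<bar> \<le> 2 * \<delta>" for x y
  proof -
    have "3 * radius * x - 3 * radius * y = (3 * radius) * (x - y)" by (simp add: algebra_simps)
    then have "\<bar>3 * radius * x - 3 * radius * y\<bar> = (3 * radius) * \<bar>x - y\<bar>" using radius_ge by (simp add: abs_mult)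
    also have "\<dots> \<le> (3 * radius) * (2 * \<delta>)" using that radius_ge by (intro mult_left_mono) auto
    finally show ?thesis by simp
  qed
  have "\<bar>slope s * ?c - slope t * ?d\<bar> \<le> 9 * radius * \<delta> * 1 + 3 * radius * \<delta>"
    by (rule abs_mult_diff_le[OF k c1(1) kt cd])
  moreover have "\<bar>3 * radius * (a - ?c) - 3 * radius * (b - ?d)\<bar> \<le> 6 * radius * \<delta>"
    by (rule M3) (use \<delta>(1) cd in argo)
  moreover have "0 \<le> radius * \<delta>" using radius_ge \<delta>0 by simp
  ultimately show "\<bar>lateral a s - lateral b t\<bar> \<le> 30 * radius * \<delta>" unfolding lateral_def by argo
  have "\<bar>slope s * (width s - \<bar>?c\<bar>) - slope t * (width t - \<bar>?d\<bar>)\<bar> \<le> 9 * radius * \<delta> * 1 + 3 * radius * (2 * \<delta>)"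
    by (rule abs_mult_diff_le[OF k c1(2) kt]) (use wst acd in argo)
  moreover have "\<bar>3 * radius * max 0 (min (\<bar>a\<bar> - width s) (1 - \<bar>a\<bar>)) - 3 * radius * max 0 (min (\<bar>b\<bar> - width t) (1 - \<bar>b\<bar>))\<bar> \<le> 6 * radius * \<delta>"
    by (intro M3 abs_max_min_diff_le) (use wst aab \<delta>0 in \<open>simp; argo\<close>)+
  ultimately show "\<bar>axial a s - axial b t\<bar> \<le> 30 * radius * \<delta>" using \<open>0 \<le> radius * \<delta>\<close> unfolding axial_def by argo
qed

lemma model_map_lipschitz:
  assumes x: "x \<in> prism" "0 \<le> x $ 3" "x $ 3 \<le> 1" and y: "y \<in> prism" "0 \<le> y $ 3" "y $ 3 \<le> 1"
  shows "norm (model_map x - model_map y) \<le> 120 * radius * norm (x - y)"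
proof -
  have c: "\<bar>x $ i - y $ i\<bar> \<le> norm (x - y)" for i using component_le_norm_cart[of "x - y" i] by simp
  have i: "\<bar>x $ i\<bar> \<le> 1 \<and> \<bar>y $ i\<bar> \<le> 1" if "i \<in> {1, 2}" for i using x y that by (auto simp: prism_def)
  note L = profile_lipschitz[OF _ _ x(2,3) y(2,3) c c]
  have 1: "\<bar>model_map x $ 1 - model_map y $ 1\<bar> \<le> 30 * radius * norm (x - y)" "\<bar>model_map x $ 2 - model_map y $ 2\<bar> \<le> 30 * radius * norm (x - y)"
    using L(1)[of 1] L(1)[of 2] i by auto
  have m: "\<bar>signed_min p q - signed_min p' q'\<bar> \<le> \<bar>p - p'\<bar> + \<bar>q - q'\<bar>" for p q p' q'
  proof -
    have "\<bar>\<bar>p + q\<bar> - \<bar>p' + q'\<bar>\<bar> \<le> \<bar>p - p'\<bar> + \<bar>q - q'\<bar>"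
      using abs_triangle_ineq3[of "p + q" "p' + q'"] abs_triangle_ineq[of "p - p'" "q - q'"]
      by (simp add: algebra_simps)
    moreover have "\<bar>\<bar>p - q\<bar> - \<bar>p' - q'\<bar>\<bar> \<le> \<bar>p - p'\<bar> + \<bar>q - q'\<bar>"
      using abs_triangle_ineq3[of "p - q" "p' - q'"] abs_triangle_ineq4[of "p - p'" "q - q'"]
      by (simp add: algebra_simps)
    ultimately show ?thesis unfolding signed_min_def by argo
  qed
  have 2: "\<bar>model_map x $ 3 - model_map y $ 3\<bar> \<le> 60 * radius * norm (x - y)"
    using m[of "axial (x $ 1) (x $ 3)" "axial (x $ 2) (x $ 3)" "axial (y $ 1) (y $ 3)" "axial (y $ 2) (y $ 3)"]
      L(2)[of 1] L(2)[of 2] i[of 1] i[of 2] by simp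
  show ?thesis using norm_le_l1_cart[of "model_map x - model_map y"] 1 2 by (simp add: sum_3)
qed

section \<open>Derivatives and Jacobian of the model map\<close>

lemma slope_derivative:
  assumes "0 < s" "s < 1"
  shows "(slope has_real_derivative (radius - 1 / 3) / (width s)\<^sup>2) (at s)"
proof -
  have w: "width s \<noteq> 0" using assms by (simp add: width_def)
  have r: "(height has_real_derivative (radius - 1)) (at s)" unfolding height_def by (auto intro!: derivative_eq_intros)
  have width: "(width has_real_derivative (- 2 / 3)) (at s)" unfolding width_def by (auto intro!: derivative_eq_intros)
  have "((\<lambda>s. height s / width s) has_real_derivative (((radius - 1) * width s - height s * (- 2 / 3)) / (width s * width s))) (at s)"
    by (rule DERIV_divide[OF r width w])
  moreover have "(radius - 1) * width s - height s * (- 2 / 3) = radius - 1 / 3" unfolding height_def width_def by algebra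
  moreover have "(\<lambda>s. height s / width s) = slope" by (simp add: slope_def fun_eq_iff)
  ultimately show ?thesis by (simp add: power2_eq_square)
qed

text \<open>These estimates are why the interpolation preserves orientation: where
  \<open>\<bar>axial\<bar>\<close> is smaller in the first coordinate, the Jacobian of \<open>model_map\<close> is \<open>A * H - B * G\<close> there times the
  absolute value of \<open>A\<close> in the second coordinate, and symmetrically.\<close>

lemma profile_derivative:
  fixes x :: "real^3"
  assumes i: "i \<noteq> 3" and x: "\<bar>x $ i\<bar> < 1" "0 < x $ 3" "x $ 3 < 1"
    and reg: "x $ i \<noteq> 0" "\<bar>x $ i\<bar> \<noteq> width (x $ 3)" "\<bar>x $ i\<bar> - width (x $ 3) \<noteq> 1 - \<bar>x $ i\<bar>"
  shows "\<exists>A B G H. ((\<lambda>x. lateral (x $ i) (x $ 3)) has_derivative (\<lambda>v. A * v $ i + B * v $ 3)) (at x) \<and>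
    ((\<lambda>x. axial (x $ i) (x $ 3)) has_derivative (\<lambda>v. G * v $ i + H * v $ 3)) (at x) \<and>
    \<bar>A\<bar> \<le> 20 * radius \<and> \<bar>B\<bar> \<le> 20 * radius \<and> \<bar>G\<bar> \<le> 20 * radius \<and> \<bar>H\<bar> \<le> 20 * radius \<and>
    1 \<le> sgn (axial (x $ i) (x $ 3)) * A \<and> 1 \<le> A * H - B * G \<and> G \<noteq> 0"
proof -
  \<comment> \<open>The sign of the coordinate is constant near \<open>x\<close>, so that every
    absolute value can be replaced by a linear expression.\<close>
  define \<epsilon> where "\<epsilon> = sgn (x $ i)"
  have \<epsilon>: "\<epsilon> = 1 \<or> \<epsilon> = -1" "0 < \<epsilon> * x $ i" "\<epsilon> * x $ i = \<bar>x $ i\<bar>"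
    using reg(1) by (auto simp: \<epsilon>_def sgn_if)
  have ee: "\<epsilon> * \<epsilon> = 1" using \<epsilon>(1) by auto
  have absu: "\<bar>z $ i\<bar> = \<epsilon> * z $ i" "sgn (z $ i) = \<epsilon>" if "0 < \<epsilon> * z $ i" for z :: "real^3"
    using that \<epsilon>(1) by (auto simp: abs_if sgn_if)
  define s where "s = x $ 3"
  have s: "0 < s" "s < 1" using x by (simp_all add: s_def)
  have s': "0 \<le> s" "s \<le> 1" using s by auto
  have w: "1 / 3 \<le> width s" "width s \<le> 1" using width_bounds[OF s'] by auto
  have dc: "((\<lambda>z. z $ j) has_derivative (\<lambda>v. v $ j)) (at x)" for j :: 3
    by (intro bounded_linear_imp_has_derivative bounded_linear_vec_nth)
  have cont: "continuous_on UNIV (\<lambda>z::real^3. width (z $ 3))" unfolding width_def by (intro continuous_intros)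
  define k' where "k' = (radius - 1 / 3) / (width s)\<^sup>2"
  have k': "0 \<le> k'" "k' \<le> 9 * radius"
  proof -
    have "(1 / 3)\<^sup>2 \<le> (width s)\<^sup>2" using w by (intro power_mono) auto
    then have w2: "1 \<le> 9 * (width s)\<^sup>2" by (simp add: power_divide)
    then have w20: "0 < (width s)\<^sup>2" by argo
    show "0 \<le> k'" using radius_ge w20 by (simp add: k'_def)
    have "radius * 1 \<le> radius * (9 * (width s)\<^sup>2)" using radius_ge by (intro mult_left_mono w2) simp
    then have "radius - 1 / 3 \<le> radius * (9 * (width s)\<^sup>2)" by argo
    then show "k' \<le> 9 * radius" unfolding k'_def by (subst pos_divide_le_eq[OF w20]) simp
  qed
  have dk: "((\<lambda>z::real^3. slope (z $ 3)) has_derivative (\<lambda>v. v $ 3 * k')) (at x)"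
    unfolding k'_def s_def by (rule DERIV_compose_FDERIV[OF slope_derivative dc]) (use x in auto)
  have dw: "((\<lambda>z::real^3. width (z $ 3)) has_derivative (\<lambda>v. - (2 / 3) * v $ 3)) (at x)"
  proof -
    have "((\<lambda>z::real^3. 1 - 2 / 3 * z $ 3) has_derivative (\<lambda>v. 0 - 2 / 3 * v $ 3)) (at x)"
      by (intro has_derivative_diff has_derivative_const has_derivative_mult_right dc)
    then show ?thesis by (simp add: width_def)
  qed
  have dr: "((\<lambda>z::real^3. height (z $ 3)) has_derivative (\<lambda>v. (radius - 1) * v $ 3)) (at x)"
  proof -
    have "((\<lambda>z::real^3. 1 + (radius - 1) * z $ 3) has_derivative (\<lambda>v. 0 + (radius - 1) * v $ 3)) (at x)"
      by (intro has_derivative_add has_derivative_const has_derivative_mult_right dc)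
    then show ?thesis by (simp add: height_def)
  qed
  have e1: "\<bar>\<epsilon>\<bar> = 1" using \<epsilon>(1) by auto
  define S where "S = {z::real^3. 0 < \<epsilon> * z $ i \<and> \<epsilon> * z $ i < 1 \<and> 0 < z $ 3 \<and> z $ 3 < 1}"
  have opS: "open S" unfolding S_def
    by (intro open_Collect_conj open_Collect_less continuous_intros)
  have xS: "x \<in> S" using x \<epsilon> by (simp add: S_def)
  have zS: "\<bar>z $ i\<bar> = \<epsilon> * z $ i" "sgn (z $ i) = \<epsilon>" "\<epsilon> * z $ i < 1" "0 \<le> z $ 3" "z $ 3 \<le> 1"
    "1 / 3 \<le> width (z $ 3)" "width (z $ 3) \<le> 1" "slope (z $ 3) * width (z $ 3) = height (z $ 3)" if "z \<in> S" for z
    using that absu[of z] width_bounds[of "z $ 3"] slope_width[of "z $ 3"] by (auto simp: S_def)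
  have abs_le: "\<bar>z $ i\<bar> \<le> 1" if "z \<in> S" for z
    using zS(3)[OF that] unfolding zS(1)[OF that] by (rule less_imp_le)
  \<comment> \<open>Both outer cases share this formula for \<open>lateral\<close>; they differ only
    in the branch of the minimum inside \<open>axial\<close>.\<close>
  have al_outer: "((\<lambda>x. lateral (x $ i) (x $ 3)) has_derivative (\<lambda>v. - 3 * radius * v $ i + - \<epsilon> * (radius + 1) * v $ 3)) (at x)"
    if outer: "width s < \<bar>x $ i\<bar>"
  proof -
    define T where "T = S \<inter> {z. width (z $ 3) < \<epsilon> * z $ i}"
    have opT: "open T" unfolding T_def
      by (intro open_Int opS open_Collect_less continuous_intros cont)
    have xT: "x \<in> T" using xS outer \<epsilon>(3) by (simp add: T_def s_def)
    define A where "A = - 3 * radius"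
    define B where "B = - \<epsilon> * (radius + 1)"
    have "((\<lambda>z. \<epsilon> * (height (z $ 3) - 3 * radius * (\<epsilon> * z $ i - width (z $ 3)))) has_derivative
        (\<lambda>v. \<epsilon> * ((radius - 1) * v $ 3 - 3 * radius * (\<epsilon> * v $ i - (- (2 / 3) * v $ 3))))) (at x)"
      by (intro has_derivative_diff has_derivative_mult_right dr dw dc)
    moreover have "(\<lambda>v::real^3. \<epsilon> * ((radius - 1) * v $ 3 - 3 * radius * (\<epsilon> * v $ i - (- (2 / 3) * v $ 3)))) =
        (\<lambda>v. A * v $ i + B * v $ 3)"
    proof
      fix v :: "real^3"
      have "\<epsilon> * ((radius - 1) * v $ 3 - 3 * radius * (\<epsilon> * v $ i - (- (2 / 3) * v $ 3))) =
          (\<epsilon> * \<epsilon>) * (- 3 * radius * v $ i) + B * v $ 3" by (simp add: B_def algebra_simps)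
      then show "\<epsilon> * ((radius - 1) * v $ 3 - 3 * radius * (\<epsilon> * v $ i - (- (2 / 3) * v $ 3))) = A * v $ i + B * v $ 3"
        by (simp add: ee A_def)
    qed
    ultimately have d1: "((\<lambda>z. \<epsilon> * (height (z $ 3) - 3 * radius * (\<epsilon> * z $ i - width (z $ 3)))) has_derivative
        (\<lambda>v. A * v $ i + B * v $ 3)) (at x)" by simp
    have lateral: "((\<lambda>x. lateral (x $ i) (x $ 3)) has_derivative (\<lambda>v. A * v $ i + B * v $ 3)) (at x)"
    proof (rule has_derivative_transform_within_open[OF d1 opT xT])
      fix z assume z: "z \<in> T"
      then have zz: "z \<in> S" "width (z $ 3) \<le> \<bar>z $ i\<bar>" "\<bar>z $ i\<bar> \<le> 1" using abs_le[of z] zS(1) by (auto simp: T_def)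
      have "0 \<le> width (z $ 3)" using zS(6)[OF zz(1)] by argo
      from profile_outer(1)[OF zz(2,3) this]
      show "\<epsilon> * (height (z $ 3) - 3 * radius * (\<epsilon> * z $ i - width (z $ 3))) = lateral (z $ i) (z $ 3)"
        by (simp only: zS[OF zz(1)])
    qed
    show ?thesis using lateral by (simp only: A_def B_def)
  qed
  consider "\<bar>x $ i\<bar> < width s" | "width s < \<bar>x $ i\<bar>" "\<bar>x $ i\<bar> - width s < 1 - \<bar>x $ i\<bar>"
    | "width s < \<bar>x $ i\<bar>" "1 - \<bar>x $ i\<bar> < \<bar>x $ i\<bar> - width s"
    using reg(2,3) unfolding s_def by linarith
  then show ?thesis
  proof cases
    case 1
    define T where "T = S \<inter> {z. \<epsilon> * z $ i < width (z $ 3)}"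
    have opT: "open T" unfolding T_def
      by (intro open_Int opS open_Collect_less continuous_intros cont)
    have xT: "x \<in> T" using xS 1 \<epsilon>(3) by (simp add: T_def s_def)
    define A where "A = slope s"
    define B where "B = k' * x $ i"
    define G where "G = - \<epsilon> * slope s"
    define H where "H = (radius - 1) - k' * (\<epsilon> * x $ i)"
    have "((\<lambda>z. slope (z $ 3) * z $ i) has_derivative (\<lambda>v. slope (x $ 3) * v $ i + (v $ 3 * k') * x $ i)) (at x)"
      by (rule has_derivative_mult[OF dk dc])
    then have d1: "((\<lambda>z. slope (z $ 3) * z $ i) has_derivative (\<lambda>v. A * v $ i + B * v $ 3)) (at x)"
      by (simp add: A_def B_def s_def mult_ac)
    have lateral: "((\<lambda>x. lateral (x $ i) (x $ 3)) has_derivative (\<lambda>v. A * v $ i + B * v $ 3)) (at x)"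
      by (rule has_derivative_transform_within_open[OF d1 opT xT])
        (use zS profile_inner in \<open>auto simp: T_def\<close>)
    have "((\<lambda>z. height (z $ 3) - \<epsilon> * (slope (z $ 3) * z $ i)) has_derivative
        (\<lambda>v. (radius - 1) * v $ 3 - \<epsilon> * (A * v $ i + B * v $ 3))) (at x)"
      by (intro has_derivative_diff has_derivative_mult_right dr d1)
    then have d2: "((\<lambda>z. height (z $ 3) - \<epsilon> * (slope (z $ 3) * z $ i)) has_derivative (\<lambda>v. G * v $ i + H * v $ 3)) (at x)"
      by (simp add: A_def B_def G_def H_def algebra_simps)
    have axial: "((\<lambda>x. axial (x $ i) (x $ 3)) has_derivative (\<lambda>v. G * v $ i + H * v $ 3)) (at x)"
    proof (rule has_derivative_transform_within_open[OF d2 opT xT])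
      fix z assume z: "z \<in> T"
      then have zz: "z \<in> S" "\<epsilon> * z $ i < width (z $ 3)" by (auto simp: T_def)
      have "axial (z $ i) (z $ 3) = slope (z $ 3) * (width (z $ 3) - \<bar>z $ i\<bar>)"
        using zS[OF zz(1)] zz(2) by (intro profile_inner) auto
      then show "height (z $ 3) - \<epsilon> * (slope (z $ 3) * z $ i) = axial (z $ i) (z $ 3)"
        using zS(8)[OF zz(1)] by (simp add: zS(1)[OF zz(1)] right_diff_distrib)
    qed
    have kb: "1 \<le> slope s" "slope s \<le> 3 * radius" using slope_bounds[OF s'] by auto
    have "\<bar>k' * x $ i\<bar> \<le> (9 * radius) * 1" unfolding abs_mult using k' x by (intro mult_mono) auto
    then have Bb: "\<bar>B\<bar> \<le> 9 * radius" by (simp add: B_def)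
    have "H = (radius - 1) - \<epsilon> * B" by (simp add: H_def B_def)
    then have Hb: "\<bar>H\<bar> \<le> 20 * radius" using \<epsilon>(1) Bb radius_ge by auto
    have "axial (x $ i) (x $ 3) = slope s * (width s - \<bar>x $ i\<bar>)" using 1 w by (simp add: s_def profile_inner)
    then have "0 < axial (x $ i) (x $ 3)" using 1 kb by simp
    then have "1 \<le> sgn (axial (x $ i) (x $ 3)) * A" using kb by (simp add: A_def)
    \<comment> \<open>The terms with \<open>k'\<close> cancel in \<open>A * H - B * G\<close>, which
      equals \<open>slope s * (radius - 1)\<close>.\<close>
    moreover have "1 * 1 \<le> slope s * (radius - 1)" using kb radius_ge by (intro mult_mono) auto
    then have "1 \<le> A * H - B * G" unfolding A_def B_def G_def H_def by (simp add: algebra_simps)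
    moreover have "\<bar>A\<bar> \<le> 20 * radius" "\<bar>G\<bar> \<le> 20 * radius" using kb e1 radius_ge by (auto simp: A_def G_def abs_mult)
    moreover have "\<bar>B\<bar> \<le> 20 * radius" using Bb radius_ge by linarith
    moreover have "G \<noteq> 0" using kb \<epsilon>(1) by (auto simp: G_def)
    ultimately show ?thesis using lateral axial Hb by blast
  next
    case 2
    define T where "T = S \<inter> {z. width (z $ 3) < \<epsilon> * z $ i \<and> \<epsilon> * z $ i - width (z $ 3) < 1 - \<epsilon> * z $ i}"
    have opT: "open T" unfolding T_def
      by (intro open_Int opS open_Collect_conj open_Collect_less continuous_intros cont)
    have xT: "x \<in> T" using xS 2 \<epsilon>(3) by (simp add: T_def s_def)
    define A where "A = - 3 * radius"
    define B where "B = - \<epsilon> * (radius + 1)"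
    define G where "G = - 3 * radius * \<epsilon>"
    define H where "H = - 2 * radius"
    have lateral: "((\<lambda>x. lateral (x $ i) (x $ 3)) has_derivative (\<lambda>v. A * v $ i + B * v $ 3)) (at x)"
      unfolding A_def B_def using 2(1) by (rule al_outer)
    have "((\<lambda>z. - (3 * radius * (\<epsilon> * z $ i - width (z $ 3)))) has_derivative
        (\<lambda>v. - (3 * radius * (\<epsilon> * v $ i - (- (2 / 3) * v $ 3))))) (at x)"
      by (intro has_derivative_minus has_derivative_diff has_derivative_mult_right dw dc)
    then have d2: "((\<lambda>z. - (3 * radius * (\<epsilon> * z $ i - width (z $ 3)))) has_derivative (\<lambda>v. G * v $ i + H * v $ 3)) (at x)"
      by (simp add: G_def H_def algebra_simps)
    have muT: "axial (z $ i) (z $ 3) = - (3 * radius * (\<epsilon> * z $ i - width (z $ 3)))" if z: "z \<in> T" for z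
    proof -
      have zz: "z \<in> S" "width (z $ 3) \<le> \<bar>z $ i\<bar>" "\<bar>z $ i\<bar> \<le> 1" using z abs_le[of z] zS(1) by (auto simp: T_def)
      have "0 \<le> width (z $ 3)" using zS(6)[OF zz(1)] by argo
      from profile_outer(2)[OF zz(2,3) this]
      show ?thesis using z by (simp add: zS(1)[OF zz(1)] T_def)
    qed
    have axial: "((\<lambda>x. axial (x $ i) (x $ 3)) has_derivative (\<lambda>v. G * v $ i + H * v $ 3)) (at x)"
      by (rule has_derivative_transform_within_open[OF d2 opT xT]) (simp add: muT)
    have "axial (x $ i) (x $ 3) < 0" using muT[OF xT] xT radius_ge by (simp add: T_def)
    then have "1 \<le> sgn (axial (x $ i) (x $ 3)) * A" using radius_ge by (simp add: A_def)
    moreover have "1 \<le> A * H - B * G"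
    proof -
      have "A * H - B * G = 6 * radius * radius - 3 * radius * (radius + 1) * (\<epsilon> * \<epsilon>)"
        unfolding A_def B_def G_def H_def by algebra
      also have "\<dots> = 3 * (radius * (radius - 1))" unfolding ee by algebra
      finally show ?thesis using mult_mono[of 1 radius 1 "radius - 1"] radius_ge by simp
    qed
    moreover have "\<bar>A\<bar> \<le> 20 * radius" "\<bar>B\<bar> \<le> 20 * radius" "\<bar>G\<bar> \<le> 20 * radius" "\<bar>H\<bar> \<le> 20 * radius"
      using e1 radius_ge by (auto simp: A_def B_def G_def H_def abs_mult)
    moreover have "G \<noteq> 0" using radius_ge \<epsilon>(1) by (auto simp: G_def)
    ultimately show ?thesis using lateral axial by blast
  next
    case 3
    define T where "T = S \<inter> {z. width (z $ 3) < \<epsilon> * z $ i \<and> 1 - \<epsilon> * z $ i < \<epsilon> * z $ i - width (z $ 3)}"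
    have opT: "open T" unfolding T_def
      by (intro open_Int opS open_Collect_conj open_Collect_less continuous_intros cont)
    have xT: "x \<in> T" using xS 3 \<epsilon>(3) by (simp add: T_def s_def)
    define A where "A = - 3 * radius"
    define B where "B = - \<epsilon> * (radius + 1)"
    \<comment> \<open>Past the middle of the fold \<open>axial\<close> returns to 0 at the fixed
      wall, so it no longer depends on the height.\<close>
    define G where "G = 3 * radius * \<epsilon>"
    have lateral: "((\<lambda>x. lateral (x $ i) (x $ 3)) has_derivative (\<lambda>v. A * v $ i + B * v $ 3)) (at x)"
      unfolding A_def B_def using 3(1) by (rule al_outer)
    have "((\<lambda>z. - (3 * radius * (1 - \<epsilon> * z $ i))) has_derivative (\<lambda>v. - (3 * radius * (0 - \<epsilon> * v $ i)))) (at x)"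
      by (intro has_derivative_minus has_derivative_diff has_derivative_const has_derivative_mult_right dc)
    then have d2: "((\<lambda>z. - (3 * radius * (1 - \<epsilon> * z $ i))) has_derivative (\<lambda>v. G * v $ i + 0 * v $ 3)) (at x)"
      by (simp add: G_def algebra_simps)
    have muT: "axial (z $ i) (z $ 3) = - (3 * radius * (1 - \<epsilon> * z $ i))" if z: "z \<in> T" for z
    proof -
      have zz: "z \<in> S" "width (z $ 3) \<le> \<bar>z $ i\<bar>" "\<bar>z $ i\<bar> \<le> 1" using z abs_le[of z] zS(1) by (auto simp: T_def)
      have "0 \<le> width (z $ 3)" using zS(6)[OF zz(1)] by argo
      from profile_outer(2)[OF zz(2,3) this]
      show ?thesis using z by (simp add: zS(1)[OF zz(1)] T_def)
    qed
    have axial: "((\<lambda>x. axial (x $ i) (x $ 3)) has_derivative (\<lambda>v. G * v $ i + 0 * v $ 3)) (at x)"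
      by (rule has_derivative_transform_within_open[OF d2 opT xT]) (simp add: muT)
    have "axial (x $ i) (x $ 3) < 0" using muT[OF xT] zS(3)[OF xS] radius_ge by simp
    then have "1 \<le> sgn (axial (x $ i) (x $ 3)) * A" using radius_ge by (simp add: A_def)
    moreover have "1 \<le> A * 0 - B * G"
    proof -
      have "A * 0 - B * G = 3 * radius * (radius + 1) * (\<epsilon> * \<epsilon>)"
        unfolding A_def B_def G_def by algebra
      also have "\<dots> = 3 * (radius * (radius + 1))" unfolding ee by algebra
      finally show ?thesis using mult_mono[of 1 radius 1 "radius + 1"] radius_ge by simp
    qed
    moreover have "\<bar>A\<bar> \<le> 20 * radius" "\<bar>B\<bar> \<le> 20 * radius" "\<bar>G\<bar> \<le> 20 * radius" "\<bar>0\<bar> \<le> 20 * radius"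
      using e1 radius_ge by (auto simp: A_def B_def G_def abs_mult)
    moreover have "G \<noteq> 0" using radius_ge \<epsilon>(1) by (auto simp: G_def)
    ultimately show ?thesis using lateral axial by blast
  qed
qed

text \<open>The value from \<open>qc_at_of_partials\<close> for entries at most
  \<open>20 * radius\<close>, determinant at least 1 and scale 1.\<close>

definition model_distortion :: real where "model_distortion = 162 * (20 * radius) ^ 3 / 1"

text \<open>Removed are the creases of the profiles (the centre, the edge of the inner part, the
  middle of the fold) and the walls.\<close>

definition regular_set :: "(real^3) set" where
  "regular_set = {x. 0 < x $ 3 \<and> x $ 3 < 1 \<and> (\<forall>i\<in>{1, 2}. \<bar>x $ i\<bar> < 1 \<and> x $ i \<noteq> 0 \<and>
     \<bar>x $ i\<bar> \<noteq> width (x $ 3) \<and> \<bar>x $ i\<bar> - width (x $ 3) \<noteq> 1 - \<bar>x $ i\<bar>)}"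

text \<open>Since \<open>width\<close> is affine in the height, each crease lies in finitely many
  planes.\<close>

lemma negligible_not_regular: "negligible {x \<in> prism. 0 < x $ 3 \<and> x $ 3 < 1 \<and> x \<notin> regular_set}"
proof -
  define W where "W i = {x::real^3. 1 * x $ i + 0 * x $ 3 = 0} \<union> {x. 1 * x $ i + 0 * x $ 3 = 1} \<union> {x. 1 * x $ i + 0 * x $ 3 = -1} \<union>
    {x. 1 * x $ i + 2 / 3 * x $ 3 = 1} \<union> {x. (-1) * x $ i + 2 / 3 * x $ 3 = 1} \<union>
    {x. 2 * x $ i + 2 / 3 * x $ 3 = 2} \<union> {x. (-2) * x $ i + 2 / 3 * x $ 3 = 2}" for i :: 3
  have W: "negligible (W i)" if "i \<noteq> 3" for i
    unfolding W_def by (intro negligible_Un negligible_coordinate_plane that) simp_all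
  have "negligible (W 1 \<union> W 2)" by (intro negligible_Un W) simp_all
  then show ?thesis
  proof (rule negligible_subset)
    show "{x \<in> prism. 0 < x $ 3 \<and> x $ 3 < 1 \<and> x \<notin> regular_set} \<subseteq> W 1 \<union> W 2"
    proof
      fix x :: "real^3" assume x: "x \<in> {x \<in> prism. 0 < x $ 3 \<and> x $ 3 < 1 \<and> x \<notin> regular_set}"
      then have "x \<in> prism" "0 < x $ 3" "x $ 3 < 1" "x \<notin> regular_set" by blast+
      then obtain i where i: "i \<in> {1, 2}"
        "\<not> (\<bar>x $ i\<bar> < 1 \<and> x $ i \<noteq> 0 \<and> \<bar>x $ i\<bar> \<noteq> width (x $ 3) \<and> \<bar>x $ i\<bar> - width (x $ 3) \<noteq> 1 - \<bar>x $ i\<bar>)"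
        unfolding regular_set_def by blast
      have xi: "\<bar>x $ i\<bar> \<le> 1" using i(1) \<open>x \<in> prism\<close> unfolding prism_def by blast
      define a where "a = x $ i"
      have Wi: "x \<in> W i \<longleftrightarrow> a = 0 \<or> a = 1 \<or> a = -1 \<or> a + 2 / 3 * x $ 3 = 1 \<or> - a + 2 / 3 * x $ 3 = 1 \<or>
          2 * a + 2 / 3 * x $ 3 = 2 \<or> - (2 * a) + 2 / 3 * x $ 3 = 2"
        by (simp add: W_def a_def disj_assoc)
      have "\<bar>a\<bar> = 1 \<or> a = 0 \<or> \<bar>a\<bar> = 1 - 2 / 3 * x $ 3 \<or> \<bar>a\<bar> - (1 - 2 / 3 * x $ 3) = 1 - \<bar>a\<bar>"
        using i(2) xi unfolding a_def[symmetric] width_def by argo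
      then have "x \<in> W i"
      proof (cases "0 \<le> a")
        case True
        then have "\<bar>a\<bar> = a" by (rule abs_of_nonneg)
        then show ?thesis using \<open>\<bar>a\<bar> = 1 \<or> _\<close> unfolding Wi by argo
      next
        case False
        then have "\<bar>a\<bar> = - a" by (intro abs_of_neg) simp
        then show ?thesis using \<open>\<bar>a\<bar> = 1 \<or> _\<close> unfolding Wi by argo
      qed
      then show "x \<in> W 1 \<union> W 2" using i(1) by auto
    qed
  qed
qed

lemma regular_set_derivative:
  assumes "x \<in> regular_set" "i \<in> {1, 2}"
  obtains A B G H where "((\<lambda>x. lateral (x $ i) (x $ 3)) has_derivative (\<lambda>v. A * v $ i + B * v $ 3)) (at x)"
    "((\<lambda>x. axial (x $ i) (x $ 3)) has_derivative (\<lambda>v. G * v $ i + H * v $ 3)) (at x)"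
    "\<bar>A\<bar> \<le> 20 * radius" "\<bar>B\<bar> \<le> 20 * radius" "\<bar>G\<bar> \<le> 20 * radius" "\<bar>H\<bar> \<le> 20 * radius"
    "1 \<le> sgn (axial (x $ i) (x $ 3)) * A" "1 \<le> A * H - B * G" "G \<noteq> 0"
proof -
  have i3: "i \<noteq> 3" using assms(2) by auto
  have "0 < x $ 3" "x $ 3 < 1" "\<bar>x $ i\<bar> < 1" "x $ i \<noteq> 0" "\<bar>x $ i\<bar> \<noteq> width (x $ 3)"
    "\<bar>x $ i\<bar> - width (x $ 3) \<noteq> 1 - \<bar>x $ i\<bar>"
    using assms unfolding regular_set_def by blast+
  from profile_derivative[OF i3 this(3,1,2,4,5,6)] show ?thesis using that by blast
qed

lemma lateral_index: "(1::3) \<in> {1, 2}" "(2::3) \<in> {1, 2}"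
  by simp_all

text \<open>The tie set may be curved, so it is exhibited as the preimage of a plane under a map
  with injective derivatives. Squares avoid the absolute values; the decisive partial derivative is
  twice \<open>axial\<close> times \<open>G1\<close>, and neither factor vanishes on
  \<open>regular_set\<close>.\<close>

lemma negligible_tie: "negligible {x \<in> regular_set. \<bar>axial (x $ 1) (x $ 3)\<bar> = \<bar>axial (x $ 2) (x $ 3)\<bar>}"
proof -
  let ?m = "\<lambda>i x. axial (x $ i) (x $ 3)"
  define F where "F x = (vector [(?m 1 x)\<^sup>2 - (?m 2 x)\<^sup>2, x $ 2, x $ 3] :: real^3)" for x :: "real^3"
  have dc: "((\<lambda>z::real^3. z $ j) has_derivative (\<lambda>v. v $ j)) (at x)" for j :: 3 and x
    by (intro bounded_linear_imp_has_derivative bounded_linear_vec_nth)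
  have "\<forall>x. \<exists>F'. x \<in> regular_set \<longrightarrow> (F has_derivative F') (at x) \<and> inj F'"
  proof (rule allI)
    fix x :: "real^3"
    show "\<exists>F'. x \<in> regular_set \<longrightarrow> (F has_derivative F') (at x) \<and> inj F'"
    proof (cases "x \<in> regular_set")
      case True
      obtain A1 B1 G1 H1 where 1: "((\<lambda>x. lateral (x $ 1) (x $ 3)) has_derivative (\<lambda>v. A1 * v $ 1 + B1 * v $ 3)) (at x)"
        "((\<lambda>x. axial (x $ 1) (x $ 3)) has_derivative (\<lambda>v. G1 * v $ 1 + H1 * v $ 3)) (at x)"
        "\<bar>A1\<bar> \<le> 20 * radius" "\<bar>B1\<bar> \<le> 20 * radius" "\<bar>G1\<bar> \<le> 20 * radius" "\<bar>H1\<bar> \<le> 20 * radius"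
        "1 \<le> sgn (axial (x $ 1) (x $ 3)) * A1" "1 \<le> A1 * H1 - B1 * G1" "G1 \<noteq> 0"
        by (rule regular_set_derivative[OF True lateral_index(1)])
      obtain A2 B2 G2 H2 where 2: "((\<lambda>x. lateral (x $ 2) (x $ 3)) has_derivative (\<lambda>v. A2 * v $ 2 + B2 * v $ 3)) (at x)"
        "((\<lambda>x. axial (x $ 2) (x $ 3)) has_derivative (\<lambda>v. G2 * v $ 2 + H2 * v $ 3)) (at x)"
        "\<bar>A2\<bar> \<le> 20 * radius" "\<bar>B2\<bar> \<le> 20 * radius" "\<bar>G2\<bar> \<le> 20 * radius" "\<bar>H2\<bar> \<le> 20 * radius"
        "1 \<le> sgn (axial (x $ 2) (x $ 3)) * A2" "1 \<le> A2 * H2 - B2 * G2" "G2 \<noteq> 0"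
        by (rule regular_set_derivative[OF True lateral_index(2)])
      define F' where "F' v = (vector [(2 * (?m 1 x) * (G1 * v $ 1 + H1 * v $ 3)) - (2 * (?m 2 x) * (G2 * v $ 2 + H2 * v $ 3)),
          v $ 2, v $ 3] :: real^3)" for v :: "real^3"
      have sq: "((\<lambda>x. (g x)\<^sup>2) has_derivative (\<lambda>v. 2 * g x * g' v)) (at x)"
        if "(g has_derivative g') (at x)" for g :: "real^3 \<Rightarrow> real" and g'
        using has_derivative_power[OF that, of 2] by (simp add: mult_ac)
      have "((\<lambda>x. (?m 1 x)\<^sup>2 - (?m 2 x)\<^sup>2) has_derivative
          (\<lambda>v. (2 * (?m 1 x) * (G1 * v $ 1 + H1 * v $ 3)) - (2 * (?m 2 x) * (G2 * v $ 2 + H2 * v $ 3)))) (at x)"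
        by (intro has_derivative_diff sq 1(2) 2(2))
      then have "((\<lambda>x. F x $ j) has_derivative (\<lambda>v. F' v $ j)) (at x)" for j
        using exhaust_3[of j] dc by (auto simp: F_def F'_def)
      then have "(F has_derivative F') (at x)" by (rule has_derivative_vec)
      moreover have "inj F'"
      proof -
        \<comment> \<open>If \<open>axial\<close> were 0, so would be its sign, against the lower
          bound for \<open>sgn (axial (x $ 1) (x $ 3)) * A1\<close>.\<close>
        have m1: "?m 1 x \<noteq> 0" using 1(7) by auto
        have lin: "linear F'" using \<open>(F has_derivative F') (at x)\<close> by (rule has_derivative_linear)
        show ?thesis
          unfolding linear_injective_0[OF lin]
        proof (intro allI impI)
          fix v assume "F' v = 0"
          then have z: "F' v $ j = 0" for j by simp
          have v23: "v $ 2 = 0" "v $ 3 = 0" using z[of 2] z[of 3] by (simp_all add: F'_def)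
          then have "2 * ?m 1 x * (G1 * v $ 1) = 0" using z[of 1] by (simp add: F'_def)
          then have "v $ 1 = 0" using m1 1(9) by simp
          with v23 show "v = 0" by (simp add: vec_eq_iff forall_3)
        qed
      qed
      ultimately show ?thesis by blast
    qed simp
  qed
  then obtain F' where F': "\<And>x. x \<in> regular_set \<Longrightarrow> (F has_derivative F' x) (at x)" "\<And>x. x \<in> regular_set \<Longrightarrow> inj (F' x)"
    by metis
  have "negligible {x \<in> regular_set. F x \<in> {y. y $ 1 = 0}}"
    by (rule negligible_differentiable_vimage[OF negligible_coordinate_hyperplane F'(2)])
       (use F'(1) has_derivative_at_withinI in blast)+
  then show ?thesis
  proof (rule negligible_subset)
    have "F x $ 1 = 0" if "\<bar>?m 1 x\<bar> = \<bar>?m 2 x\<bar>" for x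
      using arg_cong[OF that, of "\<lambda>t. t\<^sup>2"] by (simp add: F_def)
    then show "{x \<in> regular_set. \<bar>?m 1 x\<bar> = \<bar>?m 2 x\<bar>} \<subseteq> {x \<in> regular_set. F x \<in> {y. y $ 1 = 0}}" by blast
  qed
qed

lemma signed_min_half: "signed_min p q = 1 / 2 * (\<bar>p + q\<bar> - \<bar>p - q\<bar>)"
  by (simp add: signed_min_def)

lemma model_map_qc:
  assumes x: "x \<in> regular_set" and tie: "\<bar>axial (x $ 1) (x $ 3)\<bar> \<noteq> \<bar>axial (x $ 2) (x $ 3)\<bar>"
  shows "qc_at model_distortion model_map x"
proof -
  define p where "p = axial (x $ 1) (x $ 3)"
  define q where "q = axial (x $ 2) (x $ 3)"
  obtain A1 B1 G1 H1 where 1: "((\<lambda>x. lateral (x $ 1) (x $ 3)) has_derivative (\<lambda>v. A1 * v $ 1 + B1 * v $ 3)) (at x)"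
        "((\<lambda>x. axial (x $ 1) (x $ 3)) has_derivative (\<lambda>v. G1 * v $ 1 + H1 * v $ 3)) (at x)"
        "\<bar>A1\<bar> \<le> 20 * radius" "\<bar>B1\<bar> \<le> 20 * radius" "\<bar>G1\<bar> \<le> 20 * radius" "\<bar>H1\<bar> \<le> 20 * radius"
        "1 \<le> sgn (p) * A1" "1 \<le> A1 * H1 - B1 * G1" "G1 \<noteq> 0"
    unfolding p_def by (rule regular_set_derivative[OF x lateral_index(1)])
  obtain A2 B2 G2 H2 where 2: "((\<lambda>x. lateral (x $ 2) (x $ 3)) has_derivative (\<lambda>v. A2 * v $ 2 + B2 * v $ 3)) (at x)"
        "((\<lambda>x. axial (x $ 2) (x $ 3)) has_derivative (\<lambda>v. G2 * v $ 2 + H2 * v $ 3)) (at x)"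
        "\<bar>A2\<bar> \<le> 20 * radius" "\<bar>B2\<bar> \<le> 20 * radius" "\<bar>G2\<bar> \<le> 20 * radius" "\<bar>H2\<bar> \<le> 20 * radius"
        "1 \<le> sgn (q) * A2" "1 \<le> A2 * H2 - B2 * G2" "G2 \<noteq> 0"
    unfolding q_def by (rule regular_set_derivative[OF x lateral_index(2)])
  have pq: "p + q \<noteq> 0" "p - q \<noteq> 0" using tie by (auto simp: p_def q_def)
  have dm: "((\<lambda>x. signed_min (axial (x $ 1) (x $ 3)) (axial (x $ 2) (x $ 3))) has_derivative
      (\<lambda>v. 1 / 2 * (((G1 * v $ 1 + H1 * v $ 3) + (G2 * v $ 2 + H2 * v $ 3)) * sgn (p + q) -
        ((G1 * v $ 1 + H1 * v $ 3) - (G2 * v $ 2 + H2 * v $ 3)) * sgn (p - q)))) (at x)"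
    unfolding signed_min_half p_def q_def
    by (intro has_derivative_mult_right has_derivative_diff has_derivative_abs_nonzero has_derivative_add 1(2) 2(2))
       (use pq in \<open>simp_all add: p_def q_def\<close>)
  have s20: "\<bar>sgn t * y\<bar> \<le> 20 * radius * 1" if "\<bar>y\<bar> \<le> 20 * radius" for t y
    using that radius_ge by (auto simp: sgn_if)
  have z: "\<bar>0\<bar> \<le> 20 * radius * 1" using radius_ge by simp
  have M: "0 < 20 * radius" using radius_ge by simp
  have b: "\<bar>y\<bar> \<le> 20 * radius * 1" if "\<bar>y\<bar> \<le> 20 * radius" for y using that by simp
  have d1: "((\<lambda>x. model_map x $ 1) has_derivative (\<lambda>v. A1 * v $ 1 + 0 * v $ 2 + B1 * v $ 3)) (at x)"
    using 1(1) by simp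
  have d2: "((\<lambda>x. model_map x $ 2) has_derivative (\<lambda>v. 0 * v $ 1 + A2 * v $ 2 + B2 * v $ 3)) (at x)"
    using 2(1) by simp
  show ?thesis
  proof (cases "\<bar>p\<bar> < \<bar>q\<bar>")
    case True
    \<comment> \<open>The larger absolute value decides both signs, so the derivative of the third
      component is \<open>sgn q\<close> times that of the first \<open>axial\<close>. The second
      column then has \<open>A2\<close> as its only entry, and the determinant factors.\<close>
    then have sg: "sgn (p + q) = sgn q" "sgn (p - q) = - sgn q" by (auto simp: sgn_if abs_if split: if_splits)
    have d3: "((\<lambda>x. model_map x $ 3) has_derivative (\<lambda>v. sgn q * G1 * v $ 1 + 0 * v $ 2 + sgn q * H1 * v $ 3)) (at x)"
      using dm unfolding sg by (simp add: algebra_simps)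
    have "1 * 1 \<le> (sgn q * A2) * (A1 * H1 - B1 * G1)" using 1(8) 2(7) by (intro mult_mono) auto
    then have det: "1 * 1 ^ 3 \<le> A1 * (A2 * (sgn q * H1) - B2 * 0) - 0 * (0 * (sgn q * H1) - B2 * (sgn q * G1)) + B1 * (0 * 0 - A2 * (sgn q * G1))"
      by (simp add: algebra_simps)
    show ?thesis unfolding model_distortion_def
      by (rule qc_at_of_partials[OF d1 d2 d3 b[OF 1(3)] z b[OF 1(4)] z b[OF 2(3)] b[OF 2(4)]
            s20[OF 1(5)] z s20[OF 1(6)] det zero_less_one zero_less_one M])
  next
    case False
    then have "\<bar>q\<bar> < \<bar>p\<bar>" using tie unfolding p_def q_def by linarith
    then have sg: "sgn (p + q) = sgn p" "sgn (p - q) = sgn p" by (auto simp: sgn_if abs_if split: if_splits)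
    have d3: "((\<lambda>x. model_map x $ 3) has_derivative (\<lambda>v. 0 * v $ 1 + sgn p * G2 * v $ 2 + sgn p * H2 * v $ 3)) (at x)"
      using dm unfolding sg by (simp add: algebra_simps)
    have "1 * 1 \<le> (sgn p * A1) * (A2 * H2 - B2 * G2)" using 2(8) 1(7) by (intro mult_mono) auto
    then have det: "1 * 1 ^ 3 \<le> A1 * (A2 * (sgn p * H2) - B2 * (sgn p * G2)) - 0 * (0 * (sgn p * H2) - B2 * 0) + B1 * (0 * (sgn p * G2) - A2 * 0)"
      by (simp add: algebra_simps)
    show ?thesis unfolding model_distortion_def
      by (rule qc_at_of_partials[OF d1 d2 d3 b[OF 1(3)] z b[OF 1(4)] z b[OF 2(3)] b[OF 2(4)]
            z s20[OF 2(5)] s20[OF 2(6)] det zero_less_one zero_less_one M])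
  qed
qed

lemma model_map_not_qc: "negligible {x \<in> prism. 0 < x $ 3 \<and> x $ 3 < 1 \<and> \<not> qc_at model_distortion model_map x}"
proof -
  have "negligible ({x \<in> prism. 0 < x $ 3 \<and> x $ 3 < 1 \<and> x \<notin> regular_set} \<union>
      {x \<in> regular_set. \<bar>axial (x $ 1) (x $ 3)\<bar> = \<bar>axial (x $ 2) (x $ 3)\<bar>})"
    by (intro negligible_Un negligible_not_regular negligible_tie)
  then show ?thesis by (rule negligible_subset) (use model_map_qc in blast)
qed

section \<open>Interpolation between power maps\<close>

lemma abs_diff_le_abs_exp_diff:
  fixes a b :: real
  assumes "0 \<le> a" "0 \<le> b"
  shows "\<bar>a - b\<bar> \<le> \<bar>exp a - exp b\<bar>"
proof -
  have *: "a - b \<le> exp a - exp b" if "0 \<le> b" "b \<le> a" for a b :: real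
  proof -
    have "1 * (a - b) \<le> exp b * (exp (a - b) - 1)"
    proof (rule mult_mono)
      show "a - b \<le> exp (a - b) - 1" using exp_ge_add_one_self[of "a - b"] by argo
    qed (use that in auto)
    also have "\<dots> = exp a - exp b" by (simp add: exp_diff right_diff_distrib)
    finally show ?thesis by simp
  qed
  show ?thesis
  proof (cases "b \<le> a")
    case True
    then show ?thesis using *[OF assms(2) True] by simp
  next
    case False
    then show ?thesis using *[OF assms(1), of b] by simp
  qed
qed

lemma norm_le_l1_3: "norm (x - y) \<le> \<bar>x $ 1 - y $ 1\<bar> + \<bar>x $ 2 - y $ 2\<bar> + \<bar>x $ 3 - y $ (3::3)\<bar>"
  using norm_le_l1_cart[of "x - y"] by (simp add: sum_3)

lemma signed_min_signs:
  assumes "s1 = 1 \<or> s1 = -1" "s2 = 1 \<or> s2 = (-1::real)" "0 \<le> p" "0 \<le> q"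
  shows "signed_min (s1 * p) (s2 * q) = s1 * s2 * min p q"
  using assms by (auto simp: signed_min_def min_def abs_if)

context zorich
begin

text \<open>The argument is the point above \<open>(c1, c2)\<close> on the upper half of the
  bipyramid, scaled by \<open>t\<close>; its gauge is \<open>t\<close>, and \<open>h\<close> is
  evaluated at its vertical projection.\<close>

lemma bip_extension_model:
  assumes c: "\<bar>c1\<bar> \<le> 1" "\<bar>c2\<bar> \<le> 1" and t: "0 < t"
  shows "bip_extension (vector [t * c1, t * c2, t * (1 - max \<bar>c1\<bar> \<bar>c2\<bar>)]) = t *\<^sub>R h (vector [c1, c2])"
proof -
  define y :: "real^3" where "y = vector [t * c1, t * c2, t * (1 - max \<bar>c1\<bar> \<bar>c2\<bar>)]"
  have y: "y $ 1 = t * c1" "y $ 2 = t * c2" "y $ 3 = t * (1 - max \<bar>c1\<bar> \<bar>c2\<bar>)" by (simp_all add: y_def)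
  have m: "max \<bar>c1\<bar> \<bar>c2\<bar> \<le> 1" using c by simp
  have y3: "0 \<le> y $ 3" using t m by (simp add: y)
  have "max \<bar>t * c1\<bar> \<bar>t * c2\<bar> = t * max \<bar>c1\<bar> \<bar>c2\<bar>"
    using t by (simp add: abs_mult max_mult_distrib_left)
  moreover have "\<bar>y $ 3\<bar> = y $ 3" using y3 by simp
  ultimately have N: "bip_norm y = t" unfolding bip_norm_def y(1,2) by (simp add: y(3) right_diff_distrib)
  have "base_point (bip_chart y) = vector [c1, c2]" using t by (simp add: N y vec_eq_iff forall_2)
  then have "bip_extension y = t *\<^sub>R h (vector [c1, c2])"
    using y3 by (simp add: bip_extension_def reflect_extension_def bip_extension_upper_def N)
  then show ?thesis by (simp add: y_def)
qed

text \<open>Here \<open>c\<close> is \<open>3 * a\<close> folded back into the unit interval, and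
  \<open>s\<close> records whether a reflection was used. The last clause says that \<open>Z\<close>
  undergoes the same folding, so model and power map can be compared one coordinate at a
  time.\<close>

lemma profile_top_fold:
  assumes a: "\<bar>a\<bar> \<le> 1" and i: "i \<in> {1, 2}"
  obtains c s where "\<bar>c\<bar> \<le> 1" "lateral a 1 = radius * c" "axial a 1 = s * (radius * (1 - \<bar>c\<bar>))" "s = 1 \<or> s = -1"
    "\<forall>z. z $ i = 3 * a \<longrightarrow> Z z = (if s = 1 then Z (update i c z) else reflect_plane 3 0 (Z (update i c z)))"
proof (cases "\<bar>a\<bar> \<le> 1 / 3")
  case True
  show ?thesis
  proof (rule that[of "3 * a" 1])
    show "\<bar>3 * a\<bar> \<le> 1" using True by (simp add: abs_mult)
    show "\<forall>z. z $ i = 3 * a \<longrightarrow>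
        Z z = (if (1::real) = 1 then Z (update i (3 * a) z) else reflect_plane 3 0 (Z (update i (3 * a) z)))"
    proof (intro allI impI)
      fix z :: "real^3" assume "z $ i = 3 * a"
      then have "update i (3 * a) z = z" by (auto simp: vec_eq_iff)
      then show "Z z = (if (1::real) = 1 then Z (update i (3 * a) z) else reflect_plane 3 0 (Z (update i (3 * a) z)))"
        by simp
    qed
  qed (use profile_top[of a] True in auto)
next
  case False
  then have a3: "1 / 3 \<le> \<bar>a\<bar>" by simp
  have a0: "a \<noteq> 0" using False by auto
  show ?thesis
  proof (rule that[of "2 * sgn a - 3 * a" "-1"])
    show "\<bar>2 * sgn a - 3 * a\<bar> \<le> 1" using a a3 by (auto simp: sgn_if abs_if split: if_splits)
    show "\<forall>z. z $ i = 3 * a \<longrightarrow> Z z = (if (-1::real) = 1 then Z (update i (2 * sgn a - 3 * a) z)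
        else reflect_plane 3 0 (Z (update i (2 * sgn a - 3 * a) z)))"
    proof (intro allI impI)
      fix z :: "real^3" assume z: "z $ i = 3 * a"
      define n :: int where "n = (if 0 < a then 1 else -1)"
      have n: "odd n" "real_of_int n = sgn a" using a0 by (auto simp: n_def sgn_if)
      have "update i (2 * sgn a - 3 * a) z = reflect_plane i (real_of_int n) z"
        by (simp add: vec_eq_iff n(2) z)
      then show "Z z = (if (-1::real) = 1 then Z (update i (2 * sgn a - 3 * a) z)
        else reflect_plane 3 0 (Z (update i (2 * sgn a - 3 * a) z)))" using Z_reflect[OF i n(1), of z] by simp
    qed
  qed (use profile_top[of a] a a3 in auto)
qed

text \<open>Folding both coordinates brings \<open>3 *\<^sub>R x\<close> into the prism. Of the
  reflections used, two would cancel; \<open>signed_min\<close> yields the matching sign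
  \<open>s1 * s2\<close>, and \<open>bip_extension\<close> commutes with the reflection.\<close>

lemma bip_extension_model_map_top:
  assumes x: "x \<in> prism" "x $ 3 = 1"
  shows "bip_extension (model_map x) = Z (3 *\<^sub>R x)"
proof -
  have i: "(1::3) \<in> {1, 2}" "(2::3) \<in> {1, 2}" by simp_all
  have x1: "\<bar>x $ 1\<bar> \<le> 1" "\<bar>x $ 2\<bar> \<le> 1" using x by (simp_all add: prism_def)
  obtain c1 s1 where 1: "\<bar>c1\<bar> \<le> 1" "lateral (x $ 1) 1 = radius * c1" "axial (x $ 1) 1 = s1 * (radius * (1 - \<bar>c1\<bar>))" "s1 = 1 \<or> s1 = -1"
    "\<forall>z. z $ 1 = 3 * x $ 1 \<longrightarrow> Z z = (if s1 = 1 then Z (update 1 c1 z) else reflect_plane 3 0 (Z (update 1 c1 z)))"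
    by (rule profile_top_fold[OF x1(1) i(1)])
  obtain c2 s2 where 2: "\<bar>c2\<bar> \<le> 1" "lateral (x $ 2) 1 = radius * c2" "axial (x $ 2) 1 = s2 * (radius * (1 - \<bar>c2\<bar>))" "s2 = 1 \<or> s2 = -1"
    "\<forall>z. z $ 2 = 3 * x $ 2 \<longrightarrow> Z z = (if s2 = 1 then Z (update 2 c2 z) else reflect_plane 3 0 (Z (update 2 c2 z)))"
    by (rule profile_top_fold[OF x1(2) i(2)])
  define y where "y = update 2 c2 (update 1 c1 (3 *\<^sub>R x))"
  have y: "y $ 1 = c1" "y $ 2 = c2" "y $ 3 = 3" using x(2) by (simp_all add: y_def)
  have "y \<in> prism" using 1(1) 2(1) by (simp add: prism_def y)
  then have Zy: "Z y = radius *\<^sub>R h (vector [c1, c2])" by (simp add: Z_prism y radius_def)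
  have Z1: "Z (3 *\<^sub>R x) = (if s1 = 1 then Z (update 1 c1 (3 *\<^sub>R x)) else reflect_plane 3 0 (Z (update 1 c1 (3 *\<^sub>R x))))"
    by (rule 1(5)[rule_format]) simp
  have Z2: "Z (update 1 c1 (3 *\<^sub>R x)) = (if s2 = 1 then Z y else reflect_plane 3 0 (Z y))"
    unfolding y_def by (rule 2(5)[rule_format]) simp
  have M0: "0 < radius" using radius_ge by simp
  define u where "u = (vector [radius * c1, radius * c2, radius * (1 - max \<bar>c1\<bar> \<bar>c2\<bar>)] :: real^3)"
  have psiu: "bip_extension u = Z y" unfolding u_def Zy by (rule bip_extension_model[OF 1(1) 2(1) M0])
  have mm: "min (radius * (1 - \<bar>c1\<bar>)) (radius * (1 - \<bar>c2\<bar>)) = radius * (1 - max \<bar>c1\<bar> \<bar>c2\<bar>)"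
    using M0 by (simp add: min_def max_def)
  have nn: "0 \<le> radius * (1 - \<bar>c1\<bar>)" "0 \<le> radius * (1 - \<bar>c2\<bar>)" using M0 1(1) 2(1) by simp_all
  have "model_map x $ 3 = s1 * s2 * (radius * (1 - max \<bar>c1\<bar> \<bar>c2\<bar>))"
    using signed_min_signs[OF 1(4) 2(4) nn] by (simp add: x(2) 1(3) 2(3) mm)
  then have Q: "model_map x = (if s1 * s2 = 1 then u else reflect_plane 3 0 u)"
    using 1(4) 2(4) by (auto simp: vec_eq_iff forall_3 u_def x(2) 1(2) 2(2))
  show ?thesis
    unfolding Z1 Z2 Q using 1(4) 2(4) by (auto simp: psiu bip_extension_reflect)
qed

text \<open>This is Phi of the overview; \<open>descend\<close> performs the extension by
  reflection.\<close>

definition interpolation :: "real^3 \<Rightarrow> real^3" where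
  "interpolation = descend (\<lambda>x. bip_extension (model_map x))"

definition "interpolation_distortion = Z_distortion * (model_distortion * bip_distortion)"

text \<open>At heights between 0 and 1 the exponential is at least 1 and does not contract
  distances, so an ordinary Lipschitz bound on the prism implies the weighted form that
  \<open>descend_lipschitz\<close> asks for.\<close>

lemma interpolation_lipschitz:
  "\<exists>B. B-lipschitz_on {w. 1 \<le> norm w \<and> norm w \<le> exp 1} interpolation"
proof -
  define C where "C = 3 * (2 + 6 * L) * (120 * radius)"
  have C: "0 \<le> C" using L radius_ge by (simp add: C_def)
  have est: "norm (bip_extension (model_map x) - bip_extension (model_map y)) \<le> C * (\<bar>exp (x $ 3) - exp (y $ 3)\<bar> +
        exp (x $ 3) * (\<bar>x $ 1 - y $ 1\<bar> + \<bar>x $ 2 - y $ 2\<bar>))"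
    if xy: "x \<in> prism" "y \<in> prism" "x $ 3 \<in> {0..1}" "y $ 3 \<in> {0..1}" for x y
  proof -
    have "norm (bip_extension (model_map x) - bip_extension (model_map y)) \<le> 3 * (2 + 6 * L) * norm (model_map x - model_map y)" by (rule bip_extension_lipschitz)
    also have "\<dots> \<le> 3 * (2 + 6 * L) * (120 * radius * norm (x - y))"
      using xy L by (intro mult_left_mono model_map_lipschitz) auto
    also have "\<dots> = C * norm (x - y)" by (simp add: C_def)
    also have "norm (x - y) \<le> \<bar>exp (x $ 3) - exp (y $ 3)\<bar> + exp (x $ 3) * (\<bar>x $ 1 - y $ 1\<bar> + \<bar>x $ 2 - y $ 2\<bar>)"
    proof -
      have "1 * (\<bar>x $ 1 - y $ 1\<bar> + \<bar>x $ 2 - y $ 2\<bar>) \<le> exp (x $ 3) * (\<bar>x $ 1 - y $ 1\<bar> + \<bar>x $ 2 - y $ 2\<bar>)"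
        using xy by (intro mult_right_mono) auto
      moreover have "\<bar>x $ 3 - y $ 3\<bar> \<le> \<bar>exp (x $ 3) - exp (y $ 3)\<bar>"
        using xy by (intro abs_diff_le_abs_exp_diff) auto
      ultimately show ?thesis using norm_le_l1_3[of x y] by argo
    qed
    finally show ?thesis using C by (simp add: mult_left_mono)
  qed
  define B where "B = 6 * C * (1 + 4 * L)"
  have "B-lipschitz_on {w. 1 \<le> norm w \<and> norm w \<le> exp 1} interpolation"
  proof (rule lipschitz_onI)
    fix v w :: "real^3"
    assume vw: "v \<in> {w. 1 \<le> norm w \<and> norm w \<le> exp 1}" "w \<in> {w. 1 \<le> norm w \<and> norm w \<le> exp 1}"
    have *: "w \<noteq> 0 \<and> ln (norm w) \<in> {0..1}" if "w \<in> {w. 1 \<le> norm w \<and> norm w \<le> exp 1}" for w :: "real^3"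
    proof -
      have w: "1 \<le> norm w" "norm w \<le> exp 1" using that by auto
      then have "0 < norm w" by linarith
      then show ?thesis using w ln_le_cancel_iff[of "norm w" "exp 1"] by (auto simp: ln_ge_zero)
    qed
    have "norm (interpolation v - interpolation w) \<le> B * norm (v - w)"
      unfolding interpolation_def B_def
      by (rule descend_lipschitz[where I = "{0..1}"])
         (use C est * [OF vw(1)] *[OF vw(2)] bip_extension_flat model_map_flat in auto)
    then show "dist (interpolation v) (interpolation w) \<le> B * dist v w" by (simp add: dist_norm)
  qed (use C L in \<open>simp add: B_def\<close>)
  then show ?thesis by blast
qed

lemma interpolation_not_qc:
  "negligible {w. w \<noteq> 0 \<and> ln (norm w) \<in> {0<..<1} \<and> \<not> qc_at interpolation_distortion interpolation w}"
  unfolding interpolation_def interpolation_distortion_def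
proof (rule descend_not_qc)
  have "negligible {x \<in> {x \<in> prism. 0 < x $ 3 \<and> x $ 3 < 1}. \<not> qc_at (model_distortion * bip_distortion) (\<lambda>x. bip_extension (model_map x)) x}"
  proof (rule negligible_not_qc_compose[where V = UNIV and f = model_map and g = bip_extension])
    show "negligible {x \<in> {x \<in> prism. 0 < x $ 3 \<and> x $ 3 < 1}. \<not> qc_at model_distortion model_map x}"
      by (rule negligible_subset[OF model_map_not_qc]) blast
    show "negligible {y \<in> UNIV. \<not> qc_at bip_distortion bip_extension y}" using bip_extension_not_qc by simp
  qed simp
  then show "negligible {x \<in> prism. x $ 3 \<in> {0<..<1} \<and> \<not> qc_at (model_distortion * bip_distortion) (\<lambda>x. bip_extension (model_map x)) x}"
    by (rule negligible_subset) auto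
qed

text \<open>A sphere around the origin corresponds to a single height of the prism, so boundary
  values have to be compared at that height only.\<close>

lemma interpolation_cases:
  assumes w: "w \<noteq> 0" and P: "\<And>x. x \<in> prism \<Longrightarrow> x $ 3 = ln (norm w) \<Longrightarrow> bip_extension (model_map x) = T x"
  shows "interpolation w = descend T w"
proof (cases "0 \<le> w $ 3")
  case True
  then show ?thesis using P[of "zinv w"] w zinv(1)[of w] by (simp add: interpolation_def descend_upper)
next
  case False
  then show ?thesis using P[of "zinv (reflect_plane 3 0 w)"] w zinv(1)[of "reflect_plane 3 0 w"]
    by (simp add: interpolation_def descend_lower)
qed

lemma interpolation_inner:
  assumes "norm w = 1"
  shows "interpolation w = w"
proof -
  have w: "w \<noteq> 0" using assms by auto
  have "interpolation w = descend Z w"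
  proof (rule interpolation_cases[OF w])
    fix x assume x: "x \<in> prism" "x $ 3 = ln (norm w)"
    then have x3: "x $ 3 = 0" using assms by simp
    have "bip_extension (vector [1 * x $ 1, 1 * x $ 2, 1 * (1 - max \<bar>x $ 1\<bar> \<bar>x $ 2\<bar>)]) = 1 *\<^sub>R h (vector [x $ 1, x $ 2])"
      by (rule bip_extension_model) (use x in \<open>auto simp: prism_def\<close>)
    then show "bip_extension (model_map x) = Z x" using x(1) x3 by (simp add: model_map_bottom Z_prism)
  qed
  also have "descend Z w = w"
  proof (cases "0 \<le> w $ 3")
    case True
    then show ?thesis using w by (simp add: descend_upper zinv)
  next
    case False
    then show ?thesis using w by (simp add: descend_lower zinv)
  qed
  finally show ?thesis .
qed

lemma interpolation_outer:
  assumes "norm w = exp 1"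
  shows "interpolation w = zpower 3 w"
proof -
  have w: "w \<noteq> 0" using assms by auto
  show ?thesis unfolding zpower_def
    by (rule interpolation_cases[OF w]) (use assms in \<open>simp add: bip_extension_model_map_top\<close>)
qed

lemma norm_interpolation_le:
  assumes w: "1 \<le> norm w" "norm w \<le> exp 1"
  shows "norm (interpolation w) \<le> exp 3"
proof -
  have w0: "w \<noteq> 0" "0 < norm w" using w by auto
  then have ln: "0 \<le> ln (norm w)" "ln (norm w) \<le> 1"
    using w ln_le_cancel_iff[of "norm w" "exp 1"] by (auto simp: ln_ge_zero)
  have *: "norm (bip_extension (model_map x)) \<le> exp 3" if "x \<in> prism" "x $ 3 = ln (norm w)" for x
    using bip_norm_model_map[OF that(1)] that(2) ln by (simp add: norm_bip_extension radius_def)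
  show ?thesis
  proof (cases "0 \<le> w $ 3")
    case True
    then show ?thesis using *[of "zinv w"] w0 zinv(1)[of w] by (simp add: interpolation_def descend_upper)
  next
    case False
    then show ?thesis using *[of "zinv (reflect_plane 3 0 w)"] w0 zinv(1)[of "reflect_plane 3 0 w"]
      by (simp add: interpolation_def descend_lower)
  qed
qed

lemma interpolation_distortion_ge_1: "1 \<le> interpolation_distortion"
proof -
  have *: "1 \<le> a * b" if "1 \<le> a" "1 \<le> b" for a b :: real
    using mult_mono[of 1 a 1 b] that by simp
  have "1 \<le> (20 * radius) ^ 3" using radius_ge by (intro one_le_power) simp
  then have "1 \<le> model_distortion" by (simp add: model_distortion_def)
  moreover have "1 \<le> bip_distortion" using Z_distortion_ge_1 by (simp add: bip_distortion_def)
  ultimately show ?thesis unfolding interpolation_distortion_def by (intro * Z_distortion_ge_1)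
qed

section \<open>Composition with the power maps\<close>

lemma zpower_zpower:
  assumes "odd c" "odd d"
  shows "zpower c (zpower d w) = zpower (c * d) w"
proof (cases "w = 0")
  case True
  then show ?thesis by (simp add: zpower_def descend_def)
next
  case False
  then obtain x where x: "Z x = w" using Z_surj by blast
  show ?thesis using assms by (simp add: x[symmetric] zpower_Z)
qed

text \<open>\<open>K\<close> is free of \<open>d\<close>: two factors come from
  \<open>zpower d\<close> and one from \<open>interpolation\<close>, and the exponent turns the
  stretching ratio into a dilatation.\<close>

lemma interpolation_between_powers:
  assumes d: "odd d"
  defines "U \<equiv> interior (closed_ring 1 (exp (1 / real d)))"
    and "P \<equiv> (\<lambda>w. interpolation (zpower d w))"
    and "K \<equiv> (Z_distortion * Z_distortion * interpolation_distortion) ^ CARD(3)"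
  shows "quasiregular_on_ring 1 (exp (1 / real d)) P"
    "P ` closed_ring 1 (exp (1 / real d)) \<subseteq> closure (ball 0 (exp 3))"
    "\<And>x. norm x = 1 \<Longrightarrow> P x = power_map Z d x"
    "\<And>x. norm x = exp (1 / real d) \<Longrightarrow> P x = power_map Z (3 * d) x"
    "max_dilatation U P \<le> K"
proof -
  let ?\<rho> = "exp (1 / real d)"
  define R where "R = closed_ring 1 ?\<rho>"
  define V where "V = {v::real^3. 1 \<le> norm v \<and> norm v \<le> exp 1}"
  have d0: "0 < real d" using d by (simp add: odd_pos)
  have \<rho>d: "?\<rho> ^ d = exp 1" using d0 by (simp add: exp_of_nat_mult[symmetric])
  have RV: "zpower d w \<in> V" if "w \<in> R" for w
  proof -
    have w: "1 \<le> norm w" "norm w \<le> ?\<rho>" using that by (auto simp: R_def closed_ring_def)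
    then have "1 \<le> norm w ^ d" "norm w ^ d \<le> ?\<rho> ^ d" by (auto intro: one_le_power power_mono)
    then show ?thesis by (simp add: V_def norm_zpower[OF d] \<rho>d)
  qed
  have "1 \<le> ?\<rho>" using d0 by simp
  then obtain B1 where B1: "B1-lipschitz_on (cball 0 ?\<rho>) (zpower d)" using zpower_lipschitz[OF d] by blast
  obtain B2 where B2: "B2-lipschitz_on V interpolation"
    using interpolation_lipschitz unfolding V_def by blast
  have "R \<subseteq> cball 0 ?\<rho>" by (auto simp: R_def closed_ring_def)
  then have B1R: "B1-lipschitz_on R (zpower d)" using B1 lipschitz_on_subset by blast
  have "B2-lipschitz_on (zpower d ` R) interpolation" by (rule lipschitz_on_subset[OF B2]) (use RV in blast)
  \<comment> \<open>\<open>B1\<close> may depend on \<open>d\<close>; the product is used only for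
    continuity and Sobolev regularity.\<close>
  then have lip: "(B2 * B1)-lipschitz_on R P" unfolding P_def by (rule lipschitz_on_compose2[OF B1R])
  have UR: "U \<subseteq> R" unfolding U_def R_def by (rule interior_subset)
  have opU: "open U" unfolding U_def by (rule open_interior)
  have lipC: "\<exists>B. B-lipschitz_on C P" if "C \<subseteq> U" for C
    using lip that UR lipschitz_on_subset by blast
  have neg: "negligible {w \<in> U. \<not> qc_at (Z_distortion * Z_distortion * interpolation_distortion) P w}"
  proof -
    have "negligible {w \<in> {w. 1 < norm w \<and> norm w < ?\<rho>}. \<not> qc_at (Z_distortion * Z_distortion * interpolation_distortion) (\<lambda>w. interpolation (zpower d w)) w}"
    proof (rule negligible_not_qc_compose[where V = "{v. v \<noteq> 0 \<and> ln (norm v) \<in> {0<..<1}}" and f = "zpower d" and g = interpolation])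
      show "negligible {w \<in> {w. 1 < norm w \<and> norm w < ?\<rho>}. \<not> qc_at (Z_distortion * Z_distortion) (zpower d) w}"
        by (rule negligible_subset[OF zpower_not_qc[OF d]]) blast
      show "negligible {y \<in> {v. v \<noteq> 0 \<and> ln (norm v) \<in> {0<..<1}}. \<not> qc_at interpolation_distortion interpolation y}"
        by (rule negligible_subset[OF interpolation_not_qc]) blast
      fix w :: "real^3" assume "w \<in> {w. 1 < norm w \<and> norm w < ?\<rho>}"
      then have w: "1 < norm w" "norm w < ?\<rho>" by auto
      then have "0 < norm w" by linarith
      then have "0 < ln (norm w)" "ln (norm w) < 1 / real d"
        using w ln_less_cancel_iff[of "norm w" ?\<rho>] by (simp_all add: ln_gt_zero)
      then have "0 < real d * ln (norm w)" "real d * ln (norm w) < 1" using d0 by (simp_all add: field_simps)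
      moreover have "ln (norm (zpower d w)) = real d * ln (norm w)"
        using \<open>0 < norm w\<close> by (simp add: norm_zpower[OF d] ln_realpow)
      moreover have "norm (zpower d w) \<noteq> 0" using \<open>0 < norm w\<close> by (simp add: norm_zpower[OF d])
      ultimately show "zpower d w \<in> {v. v \<noteq> 0 \<and> ln (norm v) \<in> {0<..<1}}" by auto
    qed
    \<comment> \<open>The interior of the ring is never computed: it lies in the closed ring, and
      the two bounding spheres are null.\<close>
    then have "negligible ({w \<in> {w. 1 < norm w \<and> norm w < ?\<rho>}. \<not> qc_at (Z_distortion * Z_distortion * interpolation_distortion) P w} \<union>
        (sphere 0 1 \<union> sphere 0 ?\<rho>))"
      unfolding P_def by (intro negligible_Un negligible_sphere)
    then show ?thesis
    proof (rule negligible_subset)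
      show "{w \<in> U. \<not> qc_at (Z_distortion * Z_distortion * interpolation_distortion) P w} \<subseteq> {w \<in> {w. 1 < norm w \<and> norm w < ?\<rho>}. \<not> qc_at (Z_distortion * Z_distortion * interpolation_distortion) P w} \<union>
        (sphere 0 1 \<union> sphere 0 ?\<rho>)"
        using UR by (auto simp: R_def closed_ring_def dest!: subsetD)
    qed
  qed
  have K1: "1 \<le> Z_distortion * Z_distortion * interpolation_distortion"
    using mult_mono[of 1 Z_distortion 1 Z_distortion] mult_mono[of 1 "Z_distortion * Z_distortion" 1 interpolation_distortion] Z_distortion_ge_1 interpolation_distortion_ge_1 by simp
  then have K1': "1 \<le> K" unfolding K_def by (rule one_le_power)
  have K0: "0 \<le> Z_distortion * Z_distortion * interpolation_distortion" using K1 by simp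
  have bounds: "outer_bound U P K" "inner_bound U P K"
    unfolding K_def by (rule ae_qc_dilatation_bounds[OF opU lipC neg K0]; assumption)+
  show "max_dilatation U P \<le> K" by (rule max_dilatation_le[OF K1' bounds])
  have contR: "continuous_on R P" using lip by (rule lipschitz_on_continuous_on)
  then show "quasiregular_on_ring 1 ?\<rho> P"
    using bounds(1) K1' opU continuous_on_subset[OF contR UR]
    unfolding quasiregular_on_ring_def quasiregular_on_def R_def U_def by blast
  show "P ` closed_ring 1 ?\<rho> \<subseteq> closure (ball 0 (exp 3))"
  proof
    fix v assume "v \<in> P ` closed_ring 1 ?\<rho>"
    then obtain w where w: "w \<in> R" "v = P w" unfolding R_def by blast
    then have "norm v \<le> exp 3" using RV[OF w(1)] norm_interpolation_le[of "zpower d w"] by (simp add: P_def V_def)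
    then show "v \<in> closure (ball 0 (exp 3))" by simp
  qed
  show "P x = power_map Z d x" if "norm x = 1" for x
    using that interpolation_inner[of "zpower d x"] by (simp add: P_def norm_zpower[OF d] power_map_eq[OF d])
  show "P x = power_map Z (3 * d) x" if x: "norm x = ?\<rho>" for x
  proof -
    have "norm (zpower d x) = exp 1" by (simp add: norm_zpower[OF d] x \<rho>d)
    then have "P x = zpower 3 (zpower d x)" unfolding P_def by (rule interpolation_outer)
    also have "\<dots> = zpower (3 * d) x" using d by (intro zpower_zpower) auto
    finally show ?thesis using d by (simp add: power_map_eq)
  qed
qed

end

theorem theorem2:
  fixes h :: "real^2 \<Rightarrow> real^3" and Z :: "real^3 \<Rightarrow> real^3"
  assumes "bilipschitz_on square h"
    and "h ` square = upper_hemisphere"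
    and "h 0 = axis 3 1"
    and "zorich_map h Z"
    and "orientation_preserving Z"
  shows "\<exists>K::real. K \<ge> 1 \<and> (\<forall>d::nat. odd d \<longrightarrow>
    (\<exists>P :: real^3 \<Rightarrow> real^3.
       quasiregular_on_ring 1 (exp (1 / real d)) P \<and>
       P ` closed_ring 1 (exp (1 / real d)) \<subseteq> closure (ball 0 (exp 3)) \<and>
       (\<forall>x. norm x = 1 \<longrightarrow> P x = power_map Z d x) \<and>
       (\<forall>x. norm x = exp (1 / real d) \<longrightarrow> P x = power_map Z (3 * d) x) \<and>
       max_dilatation (interior (closed_ring 1 (exp (1 / real d)))) P \<le> K))"
proof -
  obtain L where L: "1 \<le> L" "\<And>a b. a \<in> square \<Longrightarrow> b \<in> square \<Longrightarrow>
     dist a b / L \<le> dist (h a) (h b) \<and> dist (h a) (h b) \<le> L * dist a b"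
    using assms(1) unfolding bilipschitz_on_def by blast
  interpret zorich h Z L
  proof
    fix a b assume "a \<in> square" "b \<in> square"
    from L(2)[OF this] show "norm (h a - h b) \<le> L * norm (a - b)" "norm (a - b) \<le> L * norm (h a - h b)"
      using L(1) by (simp_all add: dist_norm divide_le_eq mult.commute)
  qed (use assms L in auto)
  have "1 \<le> Z_distortion * Z_distortion * interpolation_distortion"
    using mult_mono[of 1 Z_distortion 1 Z_distortion] mult_mono[of 1 "Z_distortion * Z_distortion" 1 interpolation_distortion] Z_distortion_ge_1 interpolation_distortion_ge_1 by simp
  then have "1 \<le> (Z_distortion * Z_distortion * interpolation_distortion) ^ CARD(3)" by (rule one_le_power)
  then show ?thesis
    using interpolation_between_powers by (intro exI[of _ "(Z_distortion * Z_distortion * interpolation_distortion) ^ CARD(3)"] conjI allI impI) blast+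
qed

end
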